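(* Consider a sequence of linear models $y = X\beta + z$ satisfying the working assumption stated in the context. Then, for each of the three procedures forward stepwise regression, the lasso, and least angle regression, the rank $T$ of the first noise variable selected by the procedure satisfies $$\frac{T}{k}\longrightarrow 0\quad\text{in probability}.$$
   Context: Asymptotics. We consider a sequence of problems indexed by $(k_l,n_l,p_l)$ with $k_l,n_l,p_l\to\infty$ as $l\to\infty$; the index $l$ is suppressed. All limits are as $l\to\infty$. Constants do not depend on $l$. Working assumption. $y=X\beta+z$, where $X\in\mathbb R^{n\times p}$ has independent $\mathcal N(0,1/n)$ entries, $z\in\mathbb R^n$ has independent $\mathcal N(0,\sigma^2)$ entries ($\sigma=0$ allowed), and $X$ and $z$ are independent. The (nonrandom) vector $\beta\in\mathbb R^p$ has $k$ fixed components equal to some $M\neq 0$ and the rest are zero. The nonrandom parameters $\sigma\ge 0$ and $M$ may vary with $l$. Moreover $c_1 p/\log^{c_2}p\le n\le c_3p$ and $c_4 n\le k\le\min\{0.99p,\; c_5 n\log^{0.99}p\}$ for arbitrary positive constants $c_1,\dots,c_5$. Signal and noise variables. Variable $j$ (column $X_j$) is a signal variable if $\beta_j\ne0$ and a noise (spurious) variable if $\beta_j=0$. Procedures (no intercept, no normalization of columns). - Forward stepwise: start from the empty set; at each step add the variable that, together with the variables already selected, gives the smallest least-squares residual sum of squares for $y$. - Lasso: the path of minimizers of $\frac12\|y-Xb\|_2^2+\lambda\|b\|_1$ over $b\in\mathbb R^p$ as $\lambda$ decreases from $\infty$ to $0$; a variable is selected when its coefficient first becomes nonzero along the path. - Least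 angle regression: start with zero coefficients and with the variable having the largest absolute inner product with $y$; move the coefficients of the included variables in their joint least-squares direction (for the current residual) until an unselected variable has as large an absolute inner product with the current residual; that variable is included in the next step; continue until the residual is zero or all variables are included. Rank. For a given procedure, $T$ is the rank of the first noise variable: one plus the number of signal variables selected before the first noise variable. *)

theory Defs
  imports "HOL-Probability.Probability"
begin

text \<open>
  Since the dimensions vary, vectors and matrices are functions on natural numbers, of which only
  the entries with row index \<open>i < n\<close> and column index \<open>j < p\<close> are ever used. A procedure is a
  relation between the data \<open>(n, p, X, y)\<close> and the list of selected variables, in order of
  selection; it is a relation rather than a function because ties may be broken arbitrarily.
\<close>

definition residual :: "nat \<Rightarrow> (nat \<Rightarrow> nat \<Rightarrow> real) \<Rightarrow> (nat \<Rightarrow> real) \<Rightarrow> (nat \<Rightarrow> real) \<Rightarrow> nat \<Rightarrow> real" where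
  "residual p X y b i = y i - (\<Sum>j<p. X i j * b j)"

definition rss :: "nat \<Rightarrow> nat \<Rightarrow> (nat \<Rightarrow> nat \<Rightarrow> real) \<Rightarrow> (nat \<Rightarrow> real) \<Rightarrow> (nat \<Rightarrow> real) \<Rightarrow> real" where
  "rss n p X y b = (\<Sum>i<n. (residual p X y b i)\<^sup>2)"

definition supported_on :: "nat set \<Rightarrow> (nat \<Rightarrow> real) \<Rightarrow> bool" where
  "supported_on A b \<longleftrightarrow> (\<forall>j. j \<notin> A \<longrightarrow> b j = 0)"


subsection \<open>Forward stepwise regression\<close>

definition least_squares_rss ::
  "nat \<Rightarrow> nat \<Rightarrow> (nat \<Rightarrow> nat \<Rightarrow> real) \<Rightarrow> (nat \<Rightarrow> real) \<Rightarrow> nat set \<Rightarrow> real" where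
  "least_squares_rss n p X y A = (INF b \<in> Collect (supported_on A). rss n p X y b)"

text \<open>
  There is no stopping rule: selection goes on until all \<open>p\<close> variables are included, in arbitrary
  order once the residual sum of squares is zero.
\<close>

definition forward_stepwise ::
  "nat \<Rightarrow> nat \<Rightarrow> (nat \<Rightarrow> nat \<Rightarrow> real) \<Rightarrow> (nat \<Rightarrow> real) \<Rightarrow> nat list \<Rightarrow> bool" where
  "forward_stepwise n p X y sel \<longleftrightarrow>
     distinct sel \<and> set sel = {..<p} \<and>
     (\<forall>m<p. \<forall>j\<in>{..<p} - set (take m sel).
        least_squares_rss n p X y (insert (sel ! m) (set (take m sel)))
          \<le> least_squares_rss n p X y (insert j (set (take m sel))))"


subsection \<open>Lasso\<close>

definition lasso_objective ::
  "nat \<Rightarrow> nat \<Rightarrow> (nat \<Rightarrow> nat \<Rightarrow> real) \<Rightarrow> (nat \<Rightarrow> real) \<Rightarrow> real \<Rightarrow> (nat \<Rightarrow> real) \<Rightarrow> real" where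
  "lasso_objective n p X y \<mu> b = 1 / 2 * rss n p X y b + \<mu> * (\<Sum>j<p. \<bar>b j\<bar>)"

definition lasso_path ::
  "nat \<Rightarrow> nat \<Rightarrow> (nat \<Rightarrow> nat \<Rightarrow> real) \<Rightarrow> (nat \<Rightarrow> real) \<Rightarrow> (real \<Rightarrow> nat \<Rightarrow> real) \<Rightarrow> bool" where
  "lasso_path n p X y bhat \<longleftrightarrow>
     (\<forall>\<mu>>0. is_arg_min (lasso_objective n p X y \<mu>) (\<lambda>_. True) (bhat \<mu>))"

text \<open>
  The penalty level at which a coefficient first becomes nonzero as \<open>\<mu>\<close> decreases. The set is
  bounded above because \<open>bhat \<mu>\<close> vanishes for large \<open>\<mu>\<close>; inserting 0 only makes the supremum
  meaningful for variables that are never selected.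
\<close>

definition lasso_entry :: "(real \<Rightarrow> nat \<Rightarrow> real) \<Rightarrow> nat \<Rightarrow> real" where
  "lasso_entry bhat j = Sup (insert 0 {\<mu>. 0 < \<mu> \<and> bhat \<mu> j \<noteq> 0})"

definition lasso ::
  "nat \<Rightarrow> nat \<Rightarrow> (nat \<Rightarrow> nat \<Rightarrow> real) \<Rightarrow> (nat \<Rightarrow> real) \<Rightarrow> nat list \<Rightarrow> bool" where
  "lasso n p X y sel \<longleftrightarrow>
     (\<exists>bhat. lasso_path n p X y bhat \<and>
        distinct sel \<and> set sel = {j. j < p \<and> (\<exists>\<mu>>0. bhat \<mu> j \<noteq> 0)} \<and>
        sorted_wrt (\<lambda>i j. lasso_entry bhat i \<ge> lasso_entry bhat j) sel)"


subsection \<open>Least angle regression\<close>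

definition correlation ::
  "nat \<Rightarrow> nat \<Rightarrow> (nat \<Rightarrow> nat \<Rightarrow> real) \<Rightarrow> (nat \<Rightarrow> real) \<Rightarrow> (nat \<Rightarrow> real) \<Rightarrow> nat \<Rightarrow> real" where
  "correlation n p X y b j = (\<Sum>i<n. X i j * residual p X y b i)"

text \<open>
  A state consists of the included variables and the coefficients reached at the moment the last
  of them is included.
\<close>

definition lar_start ::
  "nat \<Rightarrow> nat \<Rightarrow> (nat \<Rightarrow> nat \<Rightarrow> real) \<Rightarrow> (nat \<Rightarrow> real) \<Rightarrow> nat list \<times> (nat \<Rightarrow> real) \<Rightarrow> bool" where
  "lar_start n p X y st \<longleftrightarrow>
     snd st = (\<lambda>_. 0) \<and>
     (if p = 0 then fst st = []
      else \<exists>j<p. fst st = [j] \<and>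
        (\<forall>i<p. \<bar>correlation n p X y (\<lambda>_. 0) i\<bar> \<le> \<bar>correlation n p X y (\<lambda>_. 0) j\<bar>))"

definition lar_direction ::
  "nat \<Rightarrow> nat \<Rightarrow> (nat \<Rightarrow> nat \<Rightarrow> real) \<Rightarrow> (nat \<Rightarrow> real) \<Rightarrow> nat set \<Rightarrow> (nat \<Rightarrow> real) \<Rightarrow> (nat \<Rightarrow> real) \<Rightarrow> bool" where
  "lar_direction n p X y A b d \<longleftrightarrow>
     is_arg_min (rss n p X (residual p X y b)) (supported_on A) d"

definition lar_catches_up ::
  "nat \<Rightarrow> nat \<Rightarrow> (nat \<Rightarrow> nat \<Rightarrow> real) \<Rightarrow> (nat \<Rightarrow> real) \<Rightarrow> nat set \<Rightarrow> (nat \<Rightarrow> real) \<Rightarrow> nat \<Rightarrow> bool" where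
  "lar_catches_up n p X y A b j \<longleftrightarrow>
     j < p \<and> j \<notin> A \<and> (\<forall>i\<in>A. \<bar>correlation n p X y b i\<bar> \<le> \<bar>correlation n p X y b j\<bar>)"

text \<open>
  At step size \<open>\<gamma> = 1\<close> the included variables are orthogonal to the residual, so as long as a
  variable is left, some variable catches up at a first \<open>\<gamma> \<in> [0, 1]\<close>. It is included unless the
  residual has become zero. A variable tied with the one just included follows with \<open>\<gamma> = 0\<close>.
\<close>

definition lar_step ::
  "nat \<Rightarrow> nat \<Rightarrow> (nat \<Rightarrow> nat \<Rightarrow> real) \<Rightarrow> (nat \<Rightarrow> real) \<Rightarrow>
     nat list \<times> (nat \<Rightarrow> real) \<Rightarrow> nat list \<times> (nat \<Rightarrow> real) \<Rightarrow> bool" where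
  "lar_step n p X y st st' \<longleftrightarrow>
     (\<exists>d \<gamma> j. let A = set (fst st); b = (\<lambda>t i. snd st i + t * d i) in
        lar_direction n p X y A (snd st) d \<and> 0 \<le> \<gamma> \<and>
        (\<forall>t. 0 \<le> t \<and> t < \<gamma> \<longrightarrow> (\<nexists>i. lar_catches_up n p X y A (b t) i)) \<and>
        lar_catches_up n p X y A (b \<gamma>) j \<and>
        (\<exists>i<n. residual p X y (b \<gamma>) i \<noteq> 0) \<and>
        st' = (fst st @ [j], b \<gamma>))"

definition least_angle_regression ::
  "nat \<Rightarrow> nat \<Rightarrow> (nat \<Rightarrow> nat \<Rightarrow> real) \<Rightarrow> (nat \<Rightarrow> real) \<Rightarrow> nat list \<Rightarrow> bool" where
  "least_angle_regression n p X y sel \<longleftrightarrow>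
     (\<exists>st b. lar_start n p X y st \<and> (lar_step n p X y)\<^sup>*\<^sup>* st (sel, b) \<and>
        (\<nexists>st'. lar_step n p X y (sel, b) st'))"


subsection \<open>Rank of the first noise variable\<close>

definition first_noise_rank :: "(nat \<Rightarrow> real) \<Rightarrow> nat list \<Rightarrow> nat" where
  "first_noise_rank \<beta> sel = 1 + length (takeWhile (\<lambda>j. \<beta> j \<noteq> 0) sel)"


subsection \<open>Probability\<close>

text \<open>A Gaussian random variable with standard deviation \<open>\<sigma>\<close>; \<open>\<sigma> = 0\<close> gives a point mass.\<close>

definition normally_distributed :: "'a measure \<Rightarrow> ('a \<Rightarrow> real) \<Rightarrow> real \<Rightarrow> real \<Rightarrow> bool" where
  "normally_distributed M Z \<mu> \<sigma> \<longleftrightarrow>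
     Z \<in> borel_measurable M \<and>
     distr M borel Z =
       (if \<sigma> = 0 then return borel \<mu> else density lborel (\<lambda>x. ennreal (normal_density \<mu> \<sigma> x)))"

text \<open>
  Convergence in probability to a constant. The outer measure agrees with the measure on
  measurable sets; it is used because \<^term>\<open>measure M A\<close> is 0 for non-measurable \<open>A\<close>, and arbitrary
  tie-breaking need not give measurable selections.
\<close>

definition tendsto_in_probability ::
  "(nat \<Rightarrow> 'a measure) \<Rightarrow> (nat \<Rightarrow> 'a \<Rightarrow> real) \<Rightarrow> real \<Rightarrow> bool" where
  "tendsto_in_probability \<Omega> Z c \<longleftrightarrow>
     (\<forall>\<epsilon>>0. (\<lambda>l. outer_measure_of (\<Omega> l) {\<omega> \<in> space (\<Omega> l). \<bar>Z l \<omega> - c\<bar> > \<epsilon>}) \<longlonglongrightarrow> 0)"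

end

theory Submission
  imports Defs "HOL-Real_Asymp.Real_Asymp"
begin

text \<open>
  Write \<open>\<tau>\<^sup>2 = M\<^sup>2 k / n + \<sigma>\<^sup>2\<close> for the variance of an entry of \<open>y\<close> and \<open>\<theta> = \<tau> sqrt (ln p)\<close>. Given
  \<open>y\<close>, the inner product of a noise column with \<open>y\<close> is Gaussian with standard deviation about \<open>\<tau>\<close>,
  so the largest of at least \<open>p / 100\<close> of them is close to \<open>sqrt 2 \<theta>\<close>. For a signal column the mean
  is shifted by about \<open>M\<close>, and \<open>M\<close> is at most a constant times \<open>\<tau>\<close> because \<open>k\<close> is at least
  proportional to \<open>n\<close>; hence this shift is negligible compared with \<open>\<theta>\<close>. The signal columns are
  therefore not better placed than the noise columns. With probability tending to 1 some noise
  variable, the leader, has absolute inner product at least \<open>1.3 \<theta>\<close> with \<open>y\<close>, while the set \<open>H\<close> of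
  columns whose absolute inner product is at least \<open>1.1 \<theta>\<close> has at most \<open>p powr 0.46\<close> elements. As
  \<open>n\<close> is almost proportional to \<open>p\<close>, this is negligible compared with \<open>k\<close>.

  It remains to see that no procedure leaves \<open>H\<close> before it selects the leader. The inner products of
  two distinct columns are of order \<open>\<rho> = sqrt (ln p / n)\<close>, and \<open>\<bar>H\<bar> \<rho>\<close> tends to 0 since
  \<open>0.46 < 1 / 2\<close>. As long as only variables of \<open>H\<close> are included, the coefficients have \<open>\<ell>\<^sub>1\<close> norm at
  most a constant times \<open>\<bar>H\<bar> \<theta>\<close>, so fitting them changes the correlation of every other column with
  the residual by at most a small fraction of \<open>\<theta>\<close>. The leader then still beats every column outside
  \<open>H\<close>. This deterministic step is the locale \<open>incoherent_design\<close>, and its outcome for all three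
  procedures is \<open>first_noise_rank_le\<close>. It holds for every way of breaking ties, and for arbitrary,
  possibly non-measurable, selections.

  The probabilistic part, \<open>emeasure_bad\<close>, bounds the probability that the design is not of this
  kind. It uses Chernoff bounds for column norms and for inner products of independent Gaussian
  vectors, Markov's inequality for the size of \<open>H\<close>, and conditioning on \<open>y\<close> for the existence of the
  leader.
\<close>

section \<open>Linear algebra of the design\<close>

definition gram :: "nat \<Rightarrow> (nat \<Rightarrow> nat \<Rightarrow> real) \<Rightarrow> nat \<Rightarrow> nat \<Rightarrow> real" where
  "gram n X i j = (\<Sum>a<n. X a i * X a j)"

definition inner_with :: "nat \<Rightarrow> (nat \<Rightarrow> nat \<Rightarrow> real) \<Rightarrow> (nat \<Rightarrow> real) \<Rightarrow> nat \<Rightarrow> real" where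
  "inner_with n X y j = (\<Sum>a<n. X a j * y a)"

lemma correlation_eq:
  "correlation n p X y b j = inner_with n X y j - (\<Sum>i<p. gram n X j i * b i)"
proof -
  have "(\<Sum>a<n. X a j * (\<Sum>i<p. X a i * b i)) = (\<Sum>i<p. gram n X j i * b i)"
    unfolding gram_def sum_distrib_left sum_distrib_right
    by (subst sum.swap) (simp add: mult.assoc)
  then show ?thesis
    by (simp add: correlation_def residual_def inner_with_def right_diff_distrib sum_subtractf)
qed

lemma residual_residual:
  "residual p X (residual p X y b) d = residual p X y (\<lambda>i. b i + d i)"
  by (simp add: residual_def fun_eq_iff distrib_left sum.distrib)

lemma correlation_residual:
  "correlation n p X (residual p X y b) d j = correlation n p X y (\<lambda>i. b i + d i) j"
  by (simp add: correlation_def residual_residual)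

lemma correlation_add_scaled:
  "correlation n p X y (\<lambda>i. b i + t * d i) j =
     correlation n p X y b j - t * (\<Sum>i<p. gram n X j i * d i)"
  by (simp add: correlation_eq distrib_left sum.distrib sum_distrib_left mult.left_commute)

lemma sum_fit_square:
  "(\<Sum>a<n. (\<Sum>j<p. X a j * d j)\<^sup>2) = (\<Sum>i<p. \<Sum>j<p. d i * d j * gram n X i j)"
proof -
  have "(\<Sum>a<n. (\<Sum>j<p. X a j * d j)\<^sup>2) = (\<Sum>a<n. \<Sum>i<p. \<Sum>j<p. X a i * d i * (X a j * d j))"
    by (simp add: power2_eq_square sum_product)
  also have "\<dots> = (\<Sum>i<p. \<Sum>a<n. \<Sum>j<p. X a i * d i * (X a j * d j))"
    by (rule sum.swap)
  also have "\<dots> = (\<Sum>i<p. \<Sum>j<p. \<Sum>a<n. X a i * d i * (X a j * d j))"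
    by (intro sum.cong refl sum.swap)
  finally show ?thesis
    by (simp add: gram_def sum_distrib_left mult_ac)
qed

lemma rss_add:
  "rss n p X y (\<lambda>i. b i + d i) =
     rss n p X y b - 2 * (\<Sum>j<p. d j * correlation n p X y b j) + (\<Sum>a<n. (\<Sum>j<p. X a j * d j)\<^sup>2)"
proof -
  have eq: "(\<Sum>j<p. d j * correlation n p X y b j) = (\<Sum>a<n. residual p X y b a * (\<Sum>j<p. X a j * d j))"
    unfolding correlation_def sum_distrib_left
    by (subst sum.swap) (simp add: mult_ac)
  have "rss n p X y (\<lambda>i. b i + d i) = (\<Sum>a<n. (residual p X y b a - (\<Sum>j<p. X a j * d j))\<^sup>2)"
    unfolding rss_def by (intro sum.cong refl) (simp add: residual_def distrib_left sum.distrib diff_diff_eq)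
  then show ?thesis
    unfolding eq rss_def
    by (simp add: power2_diff sum.distrib sum_subtractf sum_distrib_left mult_ac)
qed

lemma sum_unit: "finite A \<Longrightarrow> (\<Sum>j\<in>A. f j * (if j = i then t else 0)) = (if i \<in> A then f i * t else (0::real))"
  by (simp add: if_distrib cong: if_cong)

lemma rss_add_unit:
  assumes "i < p"
  shows "rss n p X y (\<lambda>j. b j + (if j = i then t else 0)) =
     rss n p X y b - 2 * t * correlation n p X y b i + t\<^sup>2 * gram n X i i"
proof -
  have "(\<Sum>a<n. (\<Sum>j<p. X a j * (if j = i then t else 0))\<^sup>2) = t\<^sup>2 * gram n X i i"
    using assms by (simp add: sum_unit gram_def power_mult_distrib sum_distrib_left power2_eq_square mult_ac)
  moreover have "(\<Sum>j<p. (if j = i then t else 0) * correlation n p X y b j) = t * correlation n p X y b i"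
    using assms sum_unit[of "{..<p}" "correlation n p X y b" i t] by (simp add: mult.commute)
  ultimately show ?thesis unfolding rss_add by simp
qed

lemma rss_nonneg: "rss n p X y b \<ge> 0"
  by (simp add: rss_def sum_nonneg)

lemma least_squares_rss_le:
  "supported_on A b \<Longrightarrow> least_squares_rss n p X y A \<le> rss n p X y b"
  unfolding least_squares_rss_def
  by (intro cINF_lower bdd_belowI2[of _ 0]) (auto simp: rss_nonneg)

lemma least_squares_rss_ge:
  assumes "\<And>b. supported_on A b \<Longrightarrow> c \<le> rss n p X y b"
  shows "c \<le> least_squares_rss n p X y A"
  unfolding least_squares_rss_def
  by (intro cINF_greatest) (auto intro: assms exI[of _ "\<lambda>_. 0"] simp: supported_on_def)

lemma quadratic_nonneg_imp_zero:
  fixes c g :: real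
  assumes "\<And>t. 0 \<le> - 2 * t * c + t\<^sup>2 * g"
  shows "c = 0"
proof (rule ccontr)
  assume "c \<noteq> 0"
  define s where "s = 1 + \<bar>g\<bar>"
  define u where "u = c / s"
  have "s > 0" and "g < 2 * s" by (auto simp: s_def)
  then have c: "c = u * s" and "u \<noteq> 0" using \<open>c \<noteq> 0\<close> by (auto simp: u_def)
  have "0 \<le> - 2 * u * c + u\<^sup>2 * g" by (rule assms)
  also have "\<dots> = u\<^sup>2 * (g - 2 * s)" by (simp add: c algebra_simps power2_eq_square)
  also have "\<dots> < 0" using \<open>u \<noteq> 0\<close> \<open>g < 2 * s\<close> by (intro mult_pos_neg) auto
  finally show False by simp
qed

text \<open>Gram--Schmidt: the part of the new column orthogonal to the old ones absorbs what is left of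
  the response, and if it vanishes the old solution is still one.\<close>

lemma normal_equations_solvable:
  assumes "finite A" "A \<subseteq> {..<p}"
  shows "\<exists>b. supported_on A b \<and> (\<forall>i\<in>A. correlation n p X y b i = 0)"
  using assms
proof (induction A arbitrary: y rule: finite_induct)
  case empty
  show ?case by (auto simp: supported_on_def)
next
  case (insert a A)
  have a: "a < p" and A: "A \<subseteq> {..<p}" using insert.prems by auto
  obtain b where b: "supported_on A b" "\<forall>i\<in>A. correlation n p X y b i = 0"
    using insert.IH[OF A] by blast
  obtain b' where b': "supported_on A b'" "\<forall>i\<in>A. correlation n p X (\<lambda>r. X r a) b' i = 0"
    using insert.IH[OF A] by blast
  define d where "d j = (if j = a then 1 else 0) - b' j" for j
  have fit_d: "(\<Sum>j<p. X r j * d j) = residual p X (\<lambda>r. X r a) b' r" for r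
    using a sum_unit[of "{..<p}" "\<lambda>j. X r j" a 1]
    by (simp add: d_def residual_def right_diff_distrib sum_subtractf)
  have gram_d: "(\<Sum>i<p. gram n X j i * d i) = correlation n p X (\<lambda>r. X r a) b' j" for j
  proof -
    have "(\<Sum>i<p. gram n X j i * d i) = (\<Sum>r<n. X r j * (\<Sum>i<p. X r i * d i))"
      unfolding gram_def sum_distrib_left sum_distrib_right
      by (subst sum.swap) (simp add: mult.assoc)
    then show ?thesis by (simp add: fit_d correlation_def)
  qed
  have supp: "supported_on (insert a A) (\<lambda>i. b i + t * d i)" for t
    using b(1) b'(1) by (auto simp: supported_on_def d_def)
  have in_A: "correlation n p X y (\<lambda>i. b i + t * d i) i = 0" if "i \<in> A" for i t
    using that b(2) b'(2) by (simp add: correlation_add_scaled gram_d)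
  define g where "g = correlation n p X (\<lambda>r. X r a) b' a"
  have expand: "correlation n p X z b' a = (\<Sum>r<n. residual p X z b' r * residual p X (\<lambda>r. X r a) b' r)
      + (\<Sum>j<p. b' j * correlation n p X z b' j)" for z
  proof -
    have "(\<Sum>j<p. b' j * correlation n p X z b' j) = (\<Sum>r<n. residual p X z b' r * (\<Sum>j<p. X r j * b' j))"
      unfolding correlation_def sum_distrib_left
      by (subst sum.swap) (simp add: mult_ac)
    moreover have "correlation n p X z b' a = (\<Sum>r<n. residual p X z b' r * X r a)"
      by (simp add: correlation_def mult.commute)
    ultimately show ?thesis
      by (simp add: residual_def[of p X "\<lambda>r. X r a"] right_diff_distrib sum_subtractf)
  qed
  have orth: "(\<Sum>j<p. b' j * correlation n p X z c j) = 0" if "\<forall>i\<in>A. correlation n p X z c i = 0" for z c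
    using that b'(1) by (intro sum.neutral) (auto simp: supported_on_def)
  show ?case
  proof (cases "g = 0")
    case False
    define t where "t = correlation n p X y b a / g"
    have "correlation n p X y (\<lambda>i. b i + t * d i) a = 0"
      using False by (simp only: correlation_add_scaled gram_d g_def[symmetric] t_def) simp
    then show ?thesis using supp in_A by (intro exI[of _ "\<lambda>i. b i + t * d i"]) auto
  next
    case True
    \<comment> \<open>the new column lies in the span of the old ones\<close>
    have "(\<Sum>r<n. (residual p X (\<lambda>r. X r a) b' r)\<^sup>2) = 0"
      using expand[of "\<lambda>r. X r a"] orth[OF b'(2)] True by (simp add: g_def power2_eq_square)
    then have zero: "residual p X (\<lambda>r. X r a) b' r = 0" if "r < n" for r
      using that by (subst (asm) sum_nonneg_eq_0_iff) auto
    have "correlation n p X y b a = (\<Sum>r<n. (\<Sum>j<p. X r j * b' j) * residual p X y b r)"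
      unfolding correlation_def
      by (intro sum.cong refl) (use zero in \<open>auto simp: residual_def[of p X "\<lambda>r. X r a"]\<close>)
    also have "\<dots> = (\<Sum>j<p. b' j * correlation n p X y b j)"
      unfolding correlation_def sum_distrib_left sum_distrib_right
      by (subst sum.swap) (simp add: mult_ac)
    finally have "correlation n p X y b a = 0" using orth[OF b(2)] by simp
    then show ?thesis using b supp[of 0] by (intro exI[of _ b]) auto
  qed
qed

lemma normal_equations_imp_arg_min:
  assumes "supported_on A b" "\<forall>i\<in>A. correlation n p X y b i = 0"
  shows "is_arg_min (rss n p X y) (supported_on A) b"
proof -
  have "rss n p X y b \<le> rss n p X y b'" if "supported_on A b'" for b'
  proof -
    have "(\<Sum>j<p. (b' j - b j) * correlation n p X y b j) = 0"
      using assms that by (intro sum.neutral) (auto simp: supported_on_def)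
    then show ?thesis
      using rss_add[of n p X y b "\<lambda>j. b' j - b j"] by (simp add: sum_nonneg)
  qed
  then show ?thesis using assms(1) by (auto simp: is_arg_min_linorder)
qed

lemma arg_min_imp_normal_equations:
  assumes "is_arg_min (rss n p X y) (supported_on A) b" "i \<in> A" "i < p"
  shows "correlation n p X y b i = 0"
proof (rule quadratic_nonneg_imp_zero)
  fix t
  have "supported_on A (\<lambda>j. b j + (if j = i then t else 0))"
    using assms by (auto simp: supported_on_def is_arg_min_linorder)
  then have "rss n p X y b \<le> rss n p X y (\<lambda>j. b j + (if j = i then t else 0))"
    using assms(1) by (auto simp: is_arg_min_linorder)
  then show "0 \<le> - 2 * t * correlation n p X y b i + t\<^sup>2 * gram n X i i"
    using assms(3) by (simp add: rss_add_unit)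
qed

section \<open>Selection in incoherent designs\<close>

text \<open>
  The threshold \<open>1.1\<close> sits strictly between two other multiples of \<open>\<theta>\<close>: the value \<open>1.3\<close> that the
  best noise variable reaches, and the value \<open>1.05\<close> that few columns reach by chance.
\<close>

definition large_inner :: "nat \<Rightarrow> nat \<Rightarrow> (nat \<Rightarrow> nat \<Rightarrow> real) \<Rightarrow> (nat \<Rightarrow> real) \<Rightarrow> real \<Rightarrow> nat set" where
  "large_inner n p X y \<theta> = {i. i < p \<and> 1.1 * \<theta> \<le> \<bar>inner_with n X y i\<bar>}"

definition selected_from_up_to :: "nat set \<Rightarrow> nat \<Rightarrow> nat list \<Rightarrow> bool" where
  "selected_from_up_to H j sel \<longleftrightarrow> j \<in> set sel \<and> set (takeWhile (\<lambda>i. i \<noteq> j) sel) \<subseteq> H"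

lemma selected_from_up_to_append:
  "selected_from_up_to H j l \<Longrightarrow> selected_from_up_to H j (l @ l')"
  by (auto simp: selected_from_up_to_def takeWhile_append1)

lemma selected_from_up_to_snoc:
  assumes "j \<notin> set l" "set l \<subseteq> H"
  shows "selected_from_up_to H j (l @ [j])"
proof -
  have "takeWhile (\<lambda>i. i \<noteq> j) (l @ [j]) = l @ takeWhile (\<lambda>i. i \<noteq> j) [j]"
    using assms(1) by (intro takeWhile_append2) auto
  then show ?thesis using assms(2) by (auto simp: selected_from_up_to_def)
qed

text \<open>
  If \<open>j\<close> is a noise variable, the first noise variable comes no later than \<open>j\<close>, and the variables
  selected up to and including \<open>j\<close> are distinct elements of \<open>H\<close>.
\<close>

lemma first_noise_rank_le_card:
  assumes sel: "selected_from_up_to H j sel" "distinct sel" and "finite H" "j \<in> H" "\<beta> j = 0"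
  shows "first_noise_rank \<beta> sel \<le> card H"
proof -
  obtain l l' where l: "sel = l @ j # l'" "j \<notin> set l"
    using sel(1) by (metis selected_from_up_to_def split_list_first)
  have tw: "takeWhile (\<lambda>i. i \<noteq> j) (l @ j # l') = l @ takeWhile (\<lambda>i. i \<noteq> j) (j # l')"
    using l(2) by (intro takeWhile_append2) auto
  then have "set l \<subseteq> H" using sel(1) by (auto simp: selected_from_up_to_def l(1))
  have "length (takeWhile (\<lambda>i. \<beta> i \<noteq> 0) sel) \<le> length l"
  proof (cases "\<forall>i\<in>set l. \<beta> i \<noteq> 0")
    case True
    then have "takeWhile (\<lambda>i. \<beta> i \<noteq> 0) (l @ j # l') = l @ takeWhile (\<lambda>i. \<beta> i \<noteq> 0) (j # l')"
      by (intro takeWhile_append2) auto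
    then show ?thesis using \<open>\<beta> j = 0\<close> by (simp add: l(1))
  next
    case False
    then show ?thesis by (auto simp: l(1) takeWhile_append length_takeWhile_le)
  qed
  also have "\<dots> = card (set l)" using sel(2) l(1) by (simp add: distinct_card)
  also have "\<dots> < card H"
    using \<open>set l \<subseteq> H\<close> l(2) \<open>finite H\<close> \<open>j \<in> H\<close> by (intro psubset_card_mono) auto
  finally show ?thesis by (simp add: first_noise_rank_def)
qed

text \<open>
  The deterministic setting in which all three procedures can be analysed: nearly normalized, nearly
  orthogonal columns, and few columns with a large inner product with the response, one of which
  stands out. The numbers leave room for the two comparisons that matter: forward stepwise compares
  squared correlations divided by squared column norms and needs \<open>(1.3 / 1.1)\<^sup>2 > 1.1 / 0.9\<close>, and
  the lasso needs penalty levels strictly between \<open>1.1 \<theta>\<close> and \<open>1.3 \<theta>\<close>. The bound \<open>few_large\<close> makes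
  the interference among the columns in \<open>H\<close> negligible.
\<close>

locale incoherent_design =
  fixes n p :: nat and X :: "nat \<Rightarrow> nat \<Rightarrow> real" and y :: "nat \<Rightarrow> real" and \<theta> \<rho> :: real and leader :: nat
  assumes threshold_pos: "\<theta> > 0" and coherence_nonneg: "\<rho> \<ge> 0"
    and gram_diag: "\<And>j. j < p \<Longrightarrow> 0.9 \<le> gram n X j j" "\<And>j. j < p \<Longrightarrow> gram n X j j \<le> 1.1"
    and gram_off_diag: "\<And>i j. i < p \<Longrightarrow> j < p \<Longrightarrow> i \<noteq> j \<Longrightarrow> \<bar>gram n X i j\<bar> \<le> \<rho>"
    and inner_le: "\<And>i. i < p \<Longrightarrow> \<bar>inner_with n X y i\<bar> \<le> 3 * \<theta>"
    and few_large: "real (card (large_inner n p X y \<theta>)) * \<rho> \<le> 1 / 10000"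
    and leader: "leader < p" "1.3 * \<theta> \<le> \<bar>inner_with n X y leader\<bar>"
begin

definition "H = large_inner n p X y \<theta>"

definition l1 :: "(nat \<Rightarrow> real) \<Rightarrow> real" where "l1 b = (\<Sum>i<p. \<bar>b i\<bar>)"

lemma finite_H: "finite H" by (simp add: H_def large_inner_def)
lemma H_subset: "H \<subseteq> {..<p}" by (auto simp: H_def large_inner_def)
lemma leader_in_H: "leader \<in> H" using leader threshold_pos by (auto simp: H_def large_inner_def)
lemma not_in_H: "i < p \<Longrightarrow> i \<notin> H \<Longrightarrow> \<bar>inner_with n X y i\<bar> < 1.1 * \<theta>"
  by (auto simp: H_def large_inner_def)
lemma card_H: "real (card H) * \<rho> \<le> 1 / 10000" using few_large by (simp add: H_def)
lemma card_H_ge_1: "1 \<le> real (card H)"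
  using card_0_eq[OF finite_H] leader_in_H by (metis One_nat_def Suc_leI empty_iff gr0I of_nat_1 of_nat_le_iff)
lemma l1_nonneg: "l1 b \<ge> 0" by (simp add: l1_def sum_nonneg)

text \<open>
  Fitting changes the correlation of a column only through its own coefficient and, by incoherence,
  by at most \<open>\<rho>\<close> times the \<open>\<ell>\<^sub>1\<close> norm of the coefficients. All comparisons between columns rest on
  this.
\<close>

lemma correlation_near:
  assumes "i < p"
  shows "\<bar>correlation n p X y b i - (inner_with n X y i - gram n X i i * b i)\<bar> \<le> \<rho> * l1 b"
proof -
  have "(\<Sum>j<p. gram n X i j * b j) = gram n X i i * b i + (\<Sum>j\<in>{..<p} - {i}. gram n X i j * b j)"
    using assms by (simp add: sum.remove)
  moreover have "\<bar>\<Sum>j\<in>{..<p} - {i}. gram n X i j * b j\<bar> \<le> \<rho> * l1 b"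
  proof -
    have "\<bar>\<Sum>j\<in>{..<p} - {i}. gram n X i j * b j\<bar> \<le> (\<Sum>j\<in>{..<p} - {i}. \<rho> * \<bar>b j\<bar>)"
      using assms gram_off_diag
      by (intro order_trans[OF sum_abs] sum_mono) (auto simp: abs_mult intro!: mult_right_mono)
    also have "\<dots> \<le> (\<Sum>j<p. \<rho> * \<bar>b j\<bar>)"
      using coherence_nonneg by (intro sum_mono2) auto
    finally show ?thesis by (simp add: l1_def sum_distrib_left)
  qed
  ultimately show ?thesis by (simp add: correlation_eq)
qed

text \<open>
  Up to interference, each active coefficient times its squared column norm is the change of the
  correlation of its own column. Hence the coefficient is at most about \<open>6 \<theta> / 0.9\<close>, and there are
  at most \<open>card H\<close> of them. Both least squares (active correlations 0) and least angle regression
  (active correlations equal, at most \<open>3 \<theta>\<close>) satisfy the hypothesis.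
\<close>

lemma l1_small:
  assumes "supported_on A b" "A \<subseteq> H" "\<And>i. i \<in> A \<Longrightarrow> \<bar>correlation n p X y b i\<bar> \<le> 3 * \<theta>"
  shows "\<rho> * l1 b \<le> \<theta> / 100"
proof -
  have A: "A \<subseteq> {..<p}" "finite A" using assms(2) H_subset finite_H by (auto intro: finite_subset)
  have coeff: "0.9 * \<bar>b i\<bar> \<le> 6 * \<theta> + \<rho> * l1 b" if "i \<in> A" for i
  proof -
    have "i < p" using that A by auto
    then have "\<bar>gram n X i i * b i\<bar> \<le> 6 * \<theta> + \<rho> * l1 b"
      using correlation_near[of i b] inner_le[of i] assms(3)[OF that] by linarith
    moreover have "0.9 * \<bar>b i\<bar> \<le> gram n X i i * \<bar>b i\<bar>"
      using gram_diag(1)[OF \<open>i < p\<close>] by (intro mult_right_mono) auto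
    ultimately show ?thesis using gram_diag(1)[OF \<open>i < p\<close>] by (simp add: abs_mult)
  qed
  have "l1 b = (\<Sum>i\<in>A. \<bar>b i\<bar>)"
    unfolding l1_def using assms(1) A by (intro sum.mono_neutral_right) (auto simp: supported_on_def)
  then have "0.9 * l1 b = (\<Sum>i\<in>A. 0.9 * \<bar>b i\<bar>)" by (simp add: sum_distrib_left)
  also have "\<dots> \<le> (\<Sum>i\<in>A. 6 * \<theta> + \<rho> * l1 b)" using coeff by (rule sum_mono)
  also have "\<dots> \<le> real (card H) * (6 * \<theta> + \<rho> * l1 b)"
    using assms(2) finite_H threshold_pos coherence_nonneg l1_nonneg[of b]
    by (auto intro!: mult_right_mono card_mono)
  finally have "\<rho> * (0.9 * l1 b) \<le> \<rho> * (real (card H) * (6 * \<theta> + \<rho> * l1 b))"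
    using coherence_nonneg by (rule mult_left_mono)
  also have "\<dots> = (real (card H) * \<rho>) * (6 * \<theta> + \<rho> * l1 b)" by simp
  also have "\<dots> \<le> 1 / 10000 * (6 * \<theta> + \<rho> * l1 b)"
    using card_H threshold_pos coherence_nonneg l1_nonneg[of b]
    by (intro mult_right_mono) auto
  finally show ?thesis using threshold_pos by simp
qed

lemma correlation_outside_H:
  assumes "\<rho> * l1 b \<le> \<theta> / 100" "b i = 0" "i < p" "i \<notin> H"
  shows "\<bar>correlation n p X y b i\<bar> < 1.11 * \<theta>"
  using correlation_near[OF assms(3), of b] not_in_H[OF assms(3,4)] assms(1,2) by simp

lemma correlation_leader:
  assumes "\<rho> * l1 b \<le> \<theta> / 100" "b leader = 0"
  shows "1.29 * \<theta> \<le> \<bar>correlation n p X y b leader\<bar>"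
  using correlation_near[OF leader(1), of b] leader(2) assms by simp

text \<open>
  Diagonal dominance of the Gram matrix, in a form that stays useful for coefficient vectors whose
  support is not known to be small.
\<close>

lemma fit_square_ge:
  "0.9 * (\<Sum>i<p. (d i)\<^sup>2) - \<rho> * (l1 d)\<^sup>2 \<le> (\<Sum>a<n. (\<Sum>j<p. X a j * d j)\<^sup>2)"
proof -
  have "0.9 * (\<Sum>i<p. (d i)\<^sup>2) - \<rho> * (l1 d)\<^sup>2
    = (\<Sum>i<p. \<Sum>j<p. (if i = j then 0.9 * (d i)\<^sup>2 else 0) - \<rho> * (\<bar>d i\<bar> * \<bar>d j\<bar>))"
  proof -
    have "(\<Sum>i<p. \<Sum>j<p. if i = j then 0.9 * (d i)\<^sup>2 else 0) = 0.9 * (\<Sum>i<p. (d i)\<^sup>2)"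
      unfolding sum_distrib_left by (intro sum.cong refl) simp
    moreover have "(\<Sum>i<p. \<Sum>j<p. \<rho> * (\<bar>d i\<bar> * \<bar>d j\<bar>)) = \<rho> * (l1 d)\<^sup>2"
      by (simp add: l1_def power2_eq_square sum_product flip: sum_distrib_left)
    ultimately show ?thesis by (simp only: sum_subtractf)
  qed
  also have "\<dots> \<le> (\<Sum>i<p. \<Sum>j<p. d i * d j * gram n X i j)"
  proof (intro sum_mono)
    fix i j assume ij: "i \<in> {..<p}" "j \<in> {..<p}"
    show "(if i = j then 0.9 * (d i)\<^sup>2 else 0) - \<rho> * (\<bar>d i\<bar> * \<bar>d j\<bar>) \<le> d i * d j * gram n X i j"
    proof (cases "i = j")
      case True
      have "0.9 * (d i)\<^sup>2 \<le> gram n X i i * (d i)\<^sup>2"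
        using gram_diag(1) ij by (intro mult_right_mono) auto
      moreover have "0 \<le> \<rho> * (\<bar>d i\<bar> * \<bar>d j\<bar>)" using coherence_nonneg by simp
      ultimately show ?thesis
        by (simp only: True if_True power2_eq_square) (simp add: mult_ac)
    next
      case False
      have "\<bar>d i * d j * gram n X i j\<bar> \<le> \<bar>d i\<bar> * \<bar>d j\<bar> * \<rho>"
        using gram_off_diag[of i j] ij False unfolding abs_mult by (intro mult_left_mono) auto
      then have "- (\<bar>d i\<bar> * \<bar>d j\<bar> * \<rho>) \<le> d i * d j * gram n X i j" by linarith
      then show ?thesis using False by (simp add: mult_ac)
    qed
  qed
  finally show ?thesis by (simp add: sum_fit_square)
qed

lemma square_sum_le_card:
  fixes f :: "nat \<Rightarrow> real"
  shows "(\<Sum>i\<in>A. \<bar>f i\<bar>)\<^sup>2 \<le> real (card A) * (\<Sum>i\<in>A. (f i)\<^sup>2)"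
  using Cauchy_Schwarz_ineq_sum[of "\<lambda>_. 1" "\<lambda>i. \<bar>f i\<bar>" A] by simp

subsection \<open>Forward stepwise regression\<close>

text \<open>
  Relative to the least-squares fit on \<open>A\<close>, adding the leader already gains its squared correlation
  divided by its squared norm when the other coefficients are kept. Adding another column gains at
  most its squared correlation divided by a lower bound for the squared distance of that column from
  the span of \<open>A\<close>.
\<close>

lemma leader_reduces_rss_more:
  assumes A: "A \<subseteq> H" "leader \<notin> A" and i: "i < p" "i \<notin> H"
  shows "least_squares_rss n p X y (insert leader A) < least_squares_rss n p X y (insert i A)"
proof -
  have "finite A" "A \<subseteq> {..<p}" using A(1) finite_H H_subset by (auto intro: finite_subset)
  then obtain b where b: "supported_on A b" "\<forall>a\<in>A. correlation n p X y b a = 0"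
    using normal_equations_solvable by blast
  have small: "\<rho> * l1 b \<le> \<theta> / 100"
    using l1_small[OF b(1) A(1)] b(2) threshold_pos by simp
  define c where "c j = correlation n p X y b j" for j
  have c_leader: "1.29 * \<theta> \<le> \<bar>c leader\<bar>" and c_i: "\<bar>c i\<bar> < 1.11 * \<theta>"
    unfolding c_def using A i b(1)
    by (intro correlation_leader correlation_outside_H small; auto simp: supported_on_def)+
  define g where "g = gram n X leader leader"
  have g: "0.9 \<le> g" "g \<le> 1.1" using gram_diag leader(1) by (auto simp: g_def)
  have "least_squares_rss n p X y (insert leader A)
      \<le> rss n p X y (\<lambda>j. b j + (if j = leader then c leader / g else 0))"
    using b(1) by (intro least_squares_rss_le) (auto simp: supported_on_def)
  also have "\<dots> = rss n p X y b - (c leader)\<^sup>2 / g"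
    using leader(1) g(1) unfolding rss_add_unit[OF leader(1)] c_def[symmetric] g_def[symmetric]
    by (simp add: field_simps power2_eq_square)
  also have "\<dots> \<le> rss n p X y b - (1.29 * \<theta>)\<^sup>2 / 1.1"
    using c_leader g threshold_pos by (intro diff_left_mono frac_le) (auto simp: abs_le_square_iff[symmetric])
  also have "\<dots> < rss n p X y b - (1.11 * \<theta>)\<^sup>2 / 0.89"
    using threshold_pos by (simp add: power_mult_distrib field_simps power2_eq_square)
  also have "\<dots> \<le> least_squares_rss n p X y (insert i A)"
  proof (rule least_squares_rss_ge)
    fix b' assume b': "supported_on (insert i A) b'"
    define d where "d j = b' j - b j" for j
    have supp_d: "d j = 0" if "j \<notin> insert i A" for j
      using that b' b(1) by (auto simp: d_def supported_on_def)
    have "(\<Sum>j<p. d j * c j) = (\<Sum>j\<in>{i}. d j * c j)"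
      using i supp_d b(2) by (intro sum.mono_neutral_right) (auto simp: c_def)
    then have lin: "(\<Sum>j<p. d j * c j) = d i * c i" by simp
    define q where "q = (\<Sum>j<p. (d j)\<^sup>2)"
    have "(d i)\<^sup>2 \<le> q" unfolding q_def using i by (intro member_le_sum) auto
    have nz: "j = i \<or> j \<in> A" if "d j \<noteq> 0" for j using that supp_d by blast
    have iA: "insert i A \<subseteq> {..<p}" using i \<open>A \<subseteq> {..<p}\<close> by auto
    have "q = (\<Sum>j\<in>insert i A. (d j)\<^sup>2)" and l1_d: "l1 d = (\<Sum>j\<in>insert i A. \<bar>d j\<bar>)"
      unfolding q_def l1_def using iA by (auto intro!: sum.mono_neutral_right dest: nz)
    then have "(l1 d)\<^sup>2 \<le> real (card (insert i A)) * q" using square_sum_le_card by simp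
    moreover have "card (insert i A) \<le> 1 + card H"
      using A(1) finite_H i \<open>finite A\<close> by (auto simp: card_insert_if card_mono)
    ultimately have "(l1 d)\<^sup>2 \<le> (2 * real (card H)) * q"
      using card_H_ge_1 \<open>(d i)\<^sup>2 \<le> q\<close>
      by (intro order_trans[OF \<open>(l1 d)\<^sup>2 \<le> _\<close>] mult_right_mono)
         (auto intro: order_trans[of 0 "(d i)\<^sup>2"])
    then have "\<rho> * (l1 d)\<^sup>2 \<le> \<rho> * ((2 * real (card H)) * q)"
      using coherence_nonneg by (rule mult_left_mono)
    also have "\<dots> = 2 * q * (real (card H) * \<rho>)" by simp
    also have "\<dots> \<le> 2 * q * (1 / 10000)"
      using card_H \<open>(d i)\<^sup>2 \<le> q\<close> by (intro mult_left_mono) (auto intro: order_trans[of 0 "(d i)\<^sup>2"])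
    finally have "0.89 * q \<le> (\<Sum>a<n. (\<Sum>j<p. X a j * d j)\<^sup>2)"
      using fit_square_ge[of d] order_trans[OF zero_le_power2 \<open>(d i)\<^sup>2 \<le> q\<close>] unfolding q_def[symmetric] by simp
    then have fit: "0.89 * (d i)\<^sup>2 \<le> (\<Sum>a<n. (\<Sum>j<p. X a j * d j)\<^sup>2)" using \<open>(d i)\<^sup>2 \<le> q\<close> by simp
    have "2 * (d i * c i) - 0.89 * (d i)\<^sup>2 \<le> (c i)\<^sup>2 / 0.89"
    proof -
      have "0 \<le> (c i - 0.89 * d i)\<^sup>2 / 0.89" by simp
      also have "\<dots> = (c i)\<^sup>2 / 0.89 - 2 * (d i * c i) + 0.89 * (d i)\<^sup>2"
        by (simp add: power2_eq_square field_simps)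
      finally show ?thesis by simp
    qed
    moreover have "(c i)\<^sup>2 \<le> (1.11 * \<theta>)\<^sup>2" using c_i threshold_pos by (intro abs_le_square_iff[THEN iffD1]) auto
    ultimately have "2 * (d i * c i) - 0.89 * (d i)\<^sup>2 \<le> (1.11 * \<theta>)\<^sup>2 / 0.89" by (simp add: divide_right_mono order_trans)
    moreover have "rss n p X y b' = rss n p X y b - 2 * (d i * c i) + (\<Sum>a<n. (\<Sum>j<p. X a j * d j)\<^sup>2)"
      using rss_add[of n p X y b d] lin by (simp add: d_def c_def)
    ultimately show "rss n p X y b - (1.11 * \<theta>)\<^sup>2 / 0.89 \<le> rss n p X y b'"
      using fit by linarith
  qed
  finally show ?thesis .
qed

lemma forward_stepwise_selects_from_H:
  assumes fs: "forward_stepwise n p X y sel"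
  shows "selected_from_up_to H leader sel"
proof -
  have d: "distinct sel" and s: "set sel = {..<p}"
    and greedy: "\<And>m j. m < p \<Longrightarrow> j < p \<Longrightarrow> j \<notin> set (take m sel) \<Longrightarrow>
      least_squares_rss n p X y (insert (sel ! m) (set (take m sel)))
        \<le> least_squares_rss n p X y (insert j (set (take m sel)))"
    using fs by (auto simp: forward_stepwise_def)
  have len: "length sel = p" using d s by (metis card_lessThan distinct_card)
  have "leader \<notin> set (take m sel) \<Longrightarrow> m \<le> p \<Longrightarrow> set (take m sel) \<subseteq> H" for m
  proof (induction m)
    case (Suc m)
    then have tk: "take (Suc m) sel = take m sel @ [sel ! m]" using len by (simp add: take_Suc_conv_app_nth)
    then have IH: "set (take m sel) \<subseteq> H" "leader \<notin> set (take m sel)" using Suc by auto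
    have "sel ! m < p" using Suc.prems s len nth_mem[of m sel] by auto
    then have "sel ! m \<in> H"
      using leader_reduces_rss_more[OF IH, of "sel ! m"] greedy[of m leader] IH(2) leader(1) Suc.prems(2)
      by force
    then show ?case using IH tk by auto
  qed simp
  moreover obtain l l' where l: "sel = l @ leader # l'" "leader \<notin> set l"
    using leader(1) s by (metis lessThan_iff split_list_first)
  moreover have "take (length l) sel = l" "length l \<le> p" using l(1) len by auto
  ultimately have "set l \<subseteq> H" by metis
  then show ?thesis using selected_from_up_to_append[OF selected_from_up_to_snoc[OF l(2)], of H l'] l(1) by simp
qed

subsection \<open>Lasso\<close>

text \<open>
  Moving one coefficient of a minimizer cannot lower the objective; the optimality conditions of the
  lasso are read off from small \<open>t\<close>.
\<close>

lemma lasso_unit_perturbation: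
  assumes "is_arg_min (lasso_objective n p X y \<mu>) (\<lambda>_. True) b" "i < p"
  shows "0 \<le> - t * correlation n p X y b i + t\<^sup>2 / 2 * gram n X i i + \<mu> * (\<bar>b i + t\<bar> - \<bar>b i\<bar>)"
proof -
  define b' where "b' j = b j + (if j = i then t else 0)" for j
  have "lasso_objective n p X y \<mu> b \<le> lasso_objective n p X y \<mu> b'"
    using assms(1) by (auto simp: is_arg_min_linorder)
  moreover have "rss n p X y b' = rss n p X y b - 2 * t * correlation n p X y b i + t\<^sup>2 * gram n X i i"
    unfolding b'_def using assms(2) by (rule rss_add_unit)
  moreover have "(\<Sum>j<p. \<bar>b' j\<bar>) = (\<Sum>j<p. \<bar>b j\<bar>) + (\<bar>b i + t\<bar> - \<bar>b i\<bar>)"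
    using assms(2) by (simp add: sum.remove[of "{..<p}" i] b'_def)
  ultimately show ?thesis by (simp add: lasso_objective_def algebra_simps)
qed

lemma lasso_KKT:
  assumes min: "is_arg_min (lasso_objective n p X y \<mu>) (\<lambda>_. True) b" and i: "i < p"
    and pos: "0 < \<mu>"
  shows "\<bar>correlation n p X y b i\<bar> \<le> \<mu>" and "b i \<noteq> 0 \<Longrightarrow> correlation n p X y b i = \<mu> * sgn (b i)"
proof -
  define c where "c = correlation n p X y b i"
  define g where "g = gram n X i i"
  have g: "g > 0" using gram_diag(1)[OF i] by (simp add: g_def)
  have pert: "0 \<le> - t * c + t\<^sup>2 / 2 * g + \<mu> * (\<bar>b i + t\<bar> - \<bar>b i\<bar>)" for t
    using lasso_unit_perturbation[OF min i] by (simp add: c_def g_def)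
  have slope: "s * c \<le> \<mu> * u" if s: "\<bar>s\<bar> = 1" and "\<delta> > 0"
    and u: "\<And>t. 0 < t \<Longrightarrow> t < \<delta> \<Longrightarrow> \<mu> * (\<bar>b i + s * t\<bar> - \<bar>b i\<bar>) \<le> \<mu> * (u * t)" for s u \<delta>
  proof (rule ccontr)
    assume "\<not> s * c \<le> \<mu> * u"
    then have gap: "s * c - \<mu> * u > 0" by simp
    \<comment> \<open>a step so short that the quadratic term is at most half of the linear gain\<close>
    define t where "t = min (\<delta> / 2) ((s * c - \<mu> * u) / g)"
    have t: "0 < t" "t < \<delta>" "t * g \<le> s * c - \<mu> * u"
      using gap g \<open>\<delta> > 0\<close> by (auto simp: t_def min_def field_simps)
    have "s\<^sup>2 = 1" using s by (metis one_power2 power2_abs)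
    then have "(s * t)\<^sup>2 = t * t" by (simp add: power_mult_distrib power2_eq_square[of t])
    then have "0 \<le> - (s * t) * c + t * t / 2 * g + \<mu> * (u * t)"
      using pert[of "s * t"] u[OF t(1,2)] by simp
    also have "\<dots> = t * (t * g / 2 - (s * c - \<mu> * u))" by (simp add: algebra_simps)
    also have "\<dots> < 0" using t gap by (intro mult_pos_neg) auto
    finally show False by simp
  qed
  show kkt: "b i \<noteq> 0 \<Longrightarrow> correlation n p X y b i = \<mu> * sgn (b i)"
  proof -
    assume "b i \<noteq> 0"
    then have d: "\<bar>b i\<bar> > 0" by simp
    have "1 * c \<le> \<mu> * sgn (b i)" "-1 * c \<le> \<mu> * (- sgn (b i))"
      by (rule slope[OF _ d]; force simp: sgn_if abs_if)+
    then show ?thesis by (simp add: c_def)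
  qed
  show "\<bar>correlation n p X y b i\<bar> \<le> \<mu>"
  proof (cases "b i = 0")
    case True
    have "1 * c \<le> \<mu> * 1" "-1 * c \<le> \<mu> * 1"
      by (rule slope[of _ 1]; simp add: True)+
    then show ?thesis by (simp add: c_def)
  next
    case False
    then show ?thesis using kkt[OF False] pos by (simp add: abs_mult abs_sgn_eq)
  qed
qed

text \<open>
  Nothing is known in advance about the support of a lasso solution, so \<open>l1_small\<close> does not apply.
  Instead, pairing the optimality conditions with the solution itself expresses the squared norm of
  the fit as \<open>\<Sum>i. b i * inner_with n X y i - \<mu> * \<bar>b i\<bar>\<close>. Outside \<open>H\<close> every summand is at most
  \<open>- 0.05 * \<theta> * \<bar>b i\<bar>\<close>, which forces a fixed fraction of the \<open>\<ell>\<^sub>1\<close> norm to lie on \<open>H\<close> (a cone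
  condition). On such a cone incoherence bounds the norm of the fit from below, and the two bounds
  together limit the size of the solution.
\<close>

lemma lasso_l1_small:
  assumes min: "is_arg_min (lasso_objective n p X y \<mu>) (\<lambda>_. True) b" and \<mu>: "1.15 * \<theta> \<le> \<mu>"
  shows "\<rho> * l1 b \<le> \<theta> / 100"
proof -
  have pos: "0 < \<mu>" using \<mu> threshold_pos by simp
  define h where "h = (\<Sum>i\<in>H. \<bar>b i\<bar>)"
  define h' where "h' = (\<Sum>i\<in>{..<p} - H. \<bar>b i\<bar>)"
  define F where "F = (\<Sum>a<n. (\<Sum>j<p. X a j * b j)\<^sup>2)"
  have split: "(\<Sum>i<p. f i) = (\<Sum>i\<in>H. f i) + (\<Sum>i\<in>{..<p} - H. f i)" for f :: "nat \<Rightarrow> real"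
    using sum.subset_diff[OF H_subset, of f] by simp
  have l1_split: "l1 b = h + h'" unfolding l1_def h_def h'_def by (rule split)
  have "h \<ge> 0" "h' \<ge> 0" "F \<ge> 0" by (auto simp: h_def h'_def F_def sum_nonneg)
  have "F = (\<Sum>i<p. b i * inner_with n X y i) - (\<Sum>i<p. b i * correlation n p X y b i)"
    unfolding F_def sum_fit_square
    by (simp add: correlation_eq right_diff_distrib sum_subtractf sum_distrib_left mult_ac)
  also have "(\<Sum>i<p. b i * correlation n p X y b i) = (\<Sum>i<p. \<mu> * \<bar>b i\<bar>)"
  proof (intro sum.cong refl)
    fix i assume "i \<in> {..<p}"
    then show "b i * correlation n p X y b i = \<mu> * \<bar>b i\<bar>"
      using lasso_KKT(2)[OF min _ pos, of i] by (cases "b i = 0") (auto simp: abs_sgn mult_ac)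
  qed
  also have "(\<Sum>i<p. b i * inner_with n X y i) - (\<Sum>i<p. \<mu> * \<bar>b i\<bar>)
      = (\<Sum>i<p. b i * inner_with n X y i - \<mu> * \<bar>b i\<bar>)" by (simp add: sum_subtractf)
  also have "\<dots> = (\<Sum>i\<in>H. b i * inner_with n X y i - \<mu> * \<bar>b i\<bar>)
      + (\<Sum>i\<in>{..<p} - H. b i * inner_with n X y i - \<mu> * \<bar>b i\<bar>)" by (rule split)
  also have "\<dots> \<le> (\<Sum>i\<in>H. 1.85 * \<theta> * \<bar>b i\<bar>) + (\<Sum>i\<in>{..<p} - H. - 0.05 * \<theta> * \<bar>b i\<bar>)"
  proof (intro add_mono sum_mono)
    fix i assume "i \<in> H"
    then have "\<bar>b i * inner_with n X y i\<bar> \<le> \<bar>b i\<bar> * (3 * \<theta>)"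
      unfolding abs_mult using inner_le[of i] H_subset by (intro mult_left_mono) auto
    moreover have "1.15 * \<theta> * \<bar>b i\<bar> \<le> \<mu> * \<bar>b i\<bar>" using \<mu> by (rule mult_right_mono) simp
    ultimately show "b i * inner_with n X y i - \<mu> * \<bar>b i\<bar> \<le> 1.85 * \<theta> * \<bar>b i\<bar>" by (simp add: abs_le_iff algebra_simps)
  next
    fix i assume "i \<in> {..<p} - H"
    then have "\<bar>b i * inner_with n X y i\<bar> \<le> \<bar>b i\<bar> * (1.1 * \<theta>)"
      unfolding abs_mult using not_in_H[of i] by (intro mult_left_mono) auto
    moreover have "1.15 * \<theta> * \<bar>b i\<bar> \<le> \<mu> * \<bar>b i\<bar>" using \<mu> by (rule mult_right_mono) simp
    ultimately show "b i * inner_with n X y i - \<mu> * \<bar>b i\<bar> \<le> - 0.05 * \<theta> * \<bar>b i\<bar>" by (simp add: abs_le_iff algebra_simps)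
  qed
  also have "\<dots> = 1.85 * \<theta> * h - 0.05 * \<theta> * h'"
    by (simp add: h_def h'_def sum_distrib_left sum_negf)
  finally have F_le: "F \<le> 1.85 * \<theta> * h - 0.05 * \<theta> * h'" .
  then have "\<theta> * h' \<le> \<theta> * (37 * h)" using \<open>F \<ge> 0\<close> by simp
  then have cone: "h' \<le> 37 * h" using threshold_pos by simp
  define s where "s = real (card H)"
  have s: "s \<ge> 1" "s * \<rho> \<le> 1 / 10000" using card_H_ge_1 card_H by (auto simp: s_def)
  have "(\<Sum>i\<in>H. (b i)\<^sup>2) \<le> (\<Sum>i<p. (b i)\<^sup>2)" using H_subset by (intro sum_mono2) auto
  then have "0.9 * (\<Sum>i\<in>H. (b i)\<^sup>2) - \<rho> * (l1 b)\<^sup>2 \<le> F"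
    using fit_square_ge[of b] unfolding F_def by linarith
  moreover have "F \<le> 1.85 * \<theta> * h"
  proof -
    have "0 \<le> 0.05 * \<theta> * h'" using threshold_pos \<open>h' \<ge> 0\<close> by simp
    then show ?thesis using F_le by linarith
  qed
  ultimately have F_le': "0.9 * (\<Sum>i\<in>H. (b i)\<^sup>2) - \<rho> * (l1 b)\<^sup>2 \<le> 1.85 * \<theta> * h"
    by (rule order_trans)
  have "s * (0.9 * (\<Sum>i\<in>H. (b i)\<^sup>2) - \<rho> * (l1 b)\<^sup>2) \<le> s * (1.85 * \<theta> * h)"
    using s F_le' by (intro mult_left_mono) auto
  moreover have "h\<^sup>2 \<le> s * (\<Sum>i\<in>H. (b i)\<^sup>2)" unfolding h_def s_def by (rule square_sum_le_card)
  moreover have "s * \<rho> * (l1 b)\<^sup>2 \<le> 1 / 10000 * (38 * h)\<^sup>2"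
  proof (rule mult_mono)
    show "(l1 b)\<^sup>2 \<le> (38 * h)\<^sup>2"
      using cone \<open>h \<ge> 0\<close> \<open>h' \<ge> 0\<close> l1_split by (intro power_mono) auto
  qed (use s in auto)
  ultimately have "0.9 * h\<^sup>2 - 1444 / 10000 * h\<^sup>2 \<le> s * (1.85 * \<theta> * h)"
    by (simp add: power_mult_distrib algebra_simps)
  moreover have "0.75 * h\<^sup>2 \<le> 0.9 * h\<^sup>2 - 1444 / 10000 * h\<^sup>2" by simp
  ultimately have "0.75 * h\<^sup>2 \<le> s * (1.85 * \<theta> * h)" by linarith
  then have "h * (0.75 * h) \<le> h * (s * 1.85 * \<theta>)"
    by (simp add: power2_eq_square mult_ac)
  then have "0.75 * h \<le> s * 1.85 * \<theta>"
    using \<open>h \<ge> 0\<close> s threshold_pos by (cases "h = 0") auto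
  then have "0.75 * h \<le> 1.85 * (s * \<theta>)" by (simp add: mult_ac)
  moreover have "0 \<le> s * \<theta>" using s threshold_pos by simp
  moreover have "h \<le> 2.5 * v" if "0.75 * h \<le> 1.85 * v" "0 \<le> v" for v using that by simp
  ultimately have "h \<le> 2.5 * (s * \<theta>)" by blast
  then have "\<rho> * h \<le> \<rho> * (2.5 * (s * \<theta>))" using coherence_nonneg by (rule mult_left_mono)
  also have "\<dots> = s * \<rho> * (2.5 * \<theta>)" by simp
  also have "\<dots> \<le> 1 / 10000 * (2.5 * \<theta>)" using s threshold_pos by (intro mult_right_mono) auto
  finally have "\<rho> * h \<le> 1 / 10000 * (2.5 * \<theta>)" .
  moreover have "\<rho> * l1 b \<le> \<rho> * (38 * h)"
    using cone l1_split coherence_nonneg by (intro mult_left_mono) auto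
  ultimately show ?thesis using threshold_pos by simp
qed

text \<open>
  The own contribution of a nonzero coefficient has the sign of the correlation that remains, so the
  inner product with \<open>y\<close> must exceed the penalty level, up to interference.
\<close>

lemma lasso_nonzero_imp_inner_ge:
  assumes min: "is_arg_min (lasso_objective n p X y \<mu>) (\<lambda>_. True) b" and \<mu>: "1.15 * \<theta> \<le> \<mu>"
    and i: "i < p" and nz: "b i \<noteq> 0"
  shows "\<mu> - \<theta> / 100 \<le> \<bar>inner_with n X y i\<bar>"
proof -
  have pos: "0 < \<mu>" using \<mu> threshold_pos by simp
  have kkt: "correlation n p X y b i = \<mu> * sgn (b i)" by (rule lasso_KKT(2)[OF min i(1) pos nz])
  have g: "0 < gram n X i i" using gram_diag(1)[OF i] by simp
  have "\<bar>gram n X i i * b i + \<mu> * sgn (b i)\<bar> = \<bar>(gram n X i i * \<bar>b i\<bar> + \<mu>) * sgn (b i)\<bar>"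
    by (simp add: distrib_right mult.assoc) (simp add: abs_mult_sgn)
  also have "\<dots> = gram n X i i * \<bar>b i\<bar> + \<mu>"
    using nz pos g by (simp add: abs_mult abs_sgn_eq)
  finally have "\<mu> \<le> \<bar>gram n X i i * b i + \<mu> * sgn (b i)\<bar>" using g by simp
  then show ?thesis
    using correlation_near[OF i(1), of b] lasso_l1_small[OF min \<mu>] kkt by linarith
qed

lemma lasso_supported_on_H:
  assumes min: "is_arg_min (lasso_objective n p X y \<mu>) (\<lambda>_. True) b" and \<mu>: "1.15 * \<theta> \<le> \<mu>"
    and i: "i < p" "i \<notin> H"
  shows "b i = 0"
  using lasso_nonzero_imp_inner_ge[OF min \<mu> i(1)] not_in_H[OF i] \<mu> threshold_pos by force

text \<open>
  This bounds the set of penalty levels at which a coefficient is nonzero, so that its entry level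
  is an upper bound of them.
\<close>

lemma lasso_vanishes:
  assumes min: "is_arg_min (lasso_objective n p X y \<mu>) (\<lambda>_. True) b" and \<mu>: "4 * \<theta> \<le> \<mu>" and i: "i < p"
  shows "b i = 0"
  using lasso_nonzero_imp_inner_ge[OF min _ i] inner_le[OF i] \<mu> threshold_pos by force

lemma lasso_leader_nonzero:
  assumes min: "is_arg_min (lasso_objective n p X y (1.2 * \<theta>)) (\<lambda>_. True) b"
  shows "b leader \<noteq> 0"
proof
  assume "b leader = 0"
  then have "1.29 * \<theta> \<le> \<bar>correlation n p X y b leader\<bar>"
    using threshold_pos by (intro correlation_leader lasso_l1_small[OF min]) auto
  moreover have "\<bar>correlation n p X y b leader\<bar> \<le> 1.2 * \<theta>"
    using threshold_pos by (intro lasso_KKT(1)[OF min leader(1)]) auto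
  ultimately show False using threshold_pos by simp
qed

text \<open>
  The leader has entered by penalty level \<open>1.2 \<theta>\<close>, whereas no variable outside \<open>H\<close> is nonzero at any
  level from \<open>1.15 \<theta>\<close> on. The gap between the two levels rules out ties with the leader.
\<close>

lemma lasso_selects_from_H:
  assumes "lasso n p X y sel"
  shows "selected_from_up_to H leader sel"
proof -
  obtain bhat where path: "lasso_path n p X y bhat" and d: "distinct sel"
    and s: "set sel = {j. j < p \<and> (\<exists>\<mu>>0. bhat \<mu> j \<noteq> 0)}"
    and sorted: "sorted_wrt (\<lambda>i j. lasso_entry bhat i \<ge> lasso_entry bhat j) sel"
    using assms by (auto simp: lasso_def)
  have min: "is_arg_min (lasso_objective n p X y \<mu>) (\<lambda>_. True) (bhat \<mu>)" if "\<mu> > 0" for \<mu>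
    using path that by (auto simp: lasso_path_def)
  have pos: "0 < 1.2 * \<theta>" using threshold_pos by simp
  have nz: "bhat (1.2 * \<theta>) leader \<noteq> 0" using lasso_leader_nonzero[OF min[OF pos]] .
  have "1.2 * \<theta> \<le> lasso_entry bhat leader"
    unfolding lasso_entry_def
  proof (rule cSup_upper)
    show "1.2 * \<theta> \<in> insert 0 {\<mu>. 0 < \<mu> \<and> bhat \<mu> leader \<noteq> 0}" using nz pos by simp
    have "\<mu> \<le> 4 * \<theta>" if "0 < \<mu>" "bhat \<mu> leader \<noteq> 0" for \<mu>
      using lasso_vanishes[OF min[OF that(1)] _ leader(1)] that(2) by force
    then show "bdd_above (insert 0 {\<mu>. 0 < \<mu> \<and> bhat \<mu> leader \<noteq> 0})"
      using threshold_pos by (intro bdd_aboveI[of _ "4 * \<theta>"]) auto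
  qed
  have "lasso_entry bhat i \<le> 1.15 * \<theta>" if "i < p" "i \<notin> H" for i
    unfolding lasso_entry_def
  proof (rule cSup_least)
    fix \<mu> assume "\<mu> \<in> insert 0 {\<mu>. 0 < \<mu> \<and> bhat \<mu> i \<noteq> 0}"
    then show "\<mu> \<le> 1.15 * \<theta>"
      using lasso_supported_on_H[OF min _ that, of \<mu>] threshold_pos by force
  qed simp
  note entries = \<open>1.2 * \<theta> \<le> lasso_entry bhat leader\<close> this
  have "leader \<in> set sel" using s nz pos leader(1) by blast
  then obtain l l' where l: "sel = l @ leader # l'" "leader \<notin> set l" by (metis split_list_first)
  have "set l \<subseteq> H"
  proof
    fix i assume "i \<in> set l"
    then have "lasso_entry bhat leader \<le> lasso_entry bhat i" "i < p"
      using sorted s l(1) by (auto simp: sorted_wrt_append)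
    then show "i \<in> H" using entries(1) entries(2)[of i] threshold_pos by force
  qed
  then show ?thesis using selected_from_up_to_append[OF selected_from_up_to_snoc[OF l(2)], of H l'] l(1) by simp
qed

subsection \<open>Least angle regression\<close>

text \<open>
  The direction is the least-squares fit of the residual, so along it the active correlations shrink
  linearly to 0, all at the same rate.
\<close>

lemma lar_correlation_along:
  assumes "lar_direction n p X y A b d" "i \<in> A" "i < p"
  shows "correlation n p X y (\<lambda>j. b j + t * d j) i = (1 - t) * correlation n p X y b i"
proof -
  have "correlation n p X (residual p X y b) d i = 0"
    using assms unfolding lar_direction_def by (rule arg_min_imp_normal_equations)
  then have "correlation n p X y (\<lambda>j. b j + 1 * d j) i = 0"
    by (simp add: correlation_residual)
  then have "(\<Sum>j<p. gram n X i j * d j) = correlation n p X y b i"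
    unfolding correlation_add_scaled by simp
  then show ?thesis unfolding correlation_add_scaled by (simp add: algebra_simps)
qed

lemma continuous_correlation_along:
  "continuous_on S (\<lambda>t. \<bar>correlation n p X y (\<lambda>j. b j + t * d j) i\<bar>)"
  unfolding correlation_add_scaled by (intro continuous_intros)

text \<open>
  The invariant of least angle regression as long as the leader has not been included: the included
  variables lie in \<open>H\<close> and share the largest absolute correlation.
\<close>

definition equal_angle_state :: "nat list \<Rightarrow> (nat \<Rightarrow> real) \<Rightarrow> real \<Rightarrow> bool" where
  "equal_angle_state l b \<kappa> \<longleftrightarrow>
     distinct l \<and> l \<noteq> [] \<and> leader \<notin> set l \<and> set l \<subseteq> H \<and> supported_on (set l) b \<and> \<kappa> \<le> 3 * \<theta> \<and>
     (\<forall>i\<in>set l. \<bar>correlation n p X y b i\<bar> = \<kappa>) \<and> (\<forall>i<p. \<bar>correlation n p X y b i\<bar> \<le> \<kappa>)"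

text \<open>
  Before step size \<open>\<gamma>\<close> every excluded variable is strictly below the common correlation, so by
  continuity it is not above it at \<open>\<gamma>\<close>. A variable outside \<open>H\<close> that catches up at \<open>\<gamma>\<close> would have to
  equal the common correlation and hence be at least as correlated as the leader, which incoherence
  excludes.
\<close>

lemma equal_angle_state_extend:
  assumes st: "equal_angle_state l b \<kappa>" and d: "lar_direction n p X y (set l) b d" and "0 \<le> \<gamma>"
    and before: "\<And>t i. 0 \<le> t \<Longrightarrow> t < \<gamma> \<Longrightarrow> \<not> lar_catches_up n p X y (set l) (\<lambda>i. b i + t * d i) i"
    and j: "lar_catches_up n p X y (set l) (\<lambda>i. b i + \<gamma> * d i) j"
  shows "j = leader \<or> equal_angle_state (l @ [j]) (\<lambda>i. b i + \<gamma> * d i) ((1 - \<gamma>) * \<kappa>)"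
proof (cases "j = leader")
  case False
  define B where "B t = (\<lambda>i. b i + t * d i)" for t
  have l: "distinct l" "l \<noteq> []" "leader \<notin> set l" "set l \<subseteq> H" "supported_on (set l) b" "\<kappa> \<le> 3 * \<theta>"
    and eq: "\<And>i. i \<in> set l \<Longrightarrow> \<bar>correlation n p X y b i\<bar> = \<kappa>"
    and le: "\<And>i. i < p \<Longrightarrow> \<bar>correlation n p X y b i\<bar> \<le> \<kappa>"
    using st by (auto simp: equal_angle_state_def)
  have lp: "i < p" if "i \<in> set l" for i using that l(4) H_subset by auto
  have j': "j < p" "j \<notin> set l" "\<And>i. i \<in> set l \<Longrightarrow> \<bar>correlation n p X y (B \<gamma>) i\<bar> \<le> \<bar>correlation n p X y (B \<gamma>) j\<bar>"
    using j by (auto simp: lar_catches_up_def B_def)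
  have along: "correlation n p X y (B t) i = (1 - t) * correlation n p X y b i" if "i \<in> set l" for i t
    unfolding B_def using d that lp[OF that] by (rule lar_correlation_along)
  have "\<kappa> \<ge> 0" using le[OF leader(1)] by (rule order_trans[OF abs_ge_zero])
  have "\<gamma> \<le> 1"
  proof (rule ccontr)
    assume "\<not> \<gamma> \<le> 1"
    moreover have "lar_catches_up n p X y (set l) (B 1) j"
      using j'(1,2) along by (simp add: lar_catches_up_def)
    ultimately show False using before[of 1 j] by (simp add: B_def)
  qed
  have eq': "\<bar>correlation n p X y (B t) i\<bar> = (1 - t) * \<kappa>" if "i \<in> set l" "t \<le> 1" for i t
    using that along eq by (simp add: abs_mult)
  have le': "\<bar>correlation n p X y (B \<gamma>) i\<bar> \<le> (1 - \<gamma>) * \<kappa>" if "i < p" for i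
  proof (cases "i \<in> set l \<or> \<gamma> = 0")
    case True
    then show ?thesis using eq'[of i \<gamma>] \<open>\<gamma> \<le> 1\<close> le[OF that] by (auto simp: B_def)
  next
    case False
    then have i: "i \<notin> set l" and "0 < \<gamma>" using \<open>0 \<le> \<gamma>\<close> by auto
    have slack: "0 \<le> (1 - t) * \<kappa> - \<bar>correlation n p X y (B t) i\<bar>" if t: "t \<in> {0..<\<gamma>}" for t
    proof -
      have "\<not> lar_catches_up n p X y (set l) (B t) i" using before t by (simp add: B_def)
      then show ?thesis
        using i \<open>i < p\<close> eq'[of _ t] t \<open>\<gamma> \<le> 1\<close> by (auto simp: lar_catches_up_def not_le)
    qed
    have "0 \<le> (1 - t) * \<kappa> - \<bar>correlation n p X y (B t) i\<bar>" if "t \<in> closure {0..<\<gamma>}" for t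
      unfolding B_def
      by (rule continuous_ge_on_closure[OF _ that])
         (use slack in \<open>auto intro!: continuous_intros continuous_correlation_along simp: B_def\<close>)
    from this[of \<gamma>] show ?thesis using \<open>0 < \<gamma>\<close> by simp
  qed
  have supp: "supported_on (set l) (B \<gamma>)"
    using l(5) d by (auto simp: supported_on_def B_def lar_direction_def is_arg_min_linorder)
  have corr_j: "\<bar>correlation n p X y (B \<gamma>) j\<bar> = (1 - \<gamma>) * \<kappa>"
  proof -
    obtain a where a: "a \<in> set l" using l(2) by (cases l) auto
    show ?thesis using j'(3)[OF a] eq'[OF a \<open>\<gamma> \<le> 1\<close>] le'[OF j'(1)] by simp
  qed
  have "(1 - \<gamma>) * \<kappa> \<le> 1 * \<kappa>" using \<open>0 \<le> \<gamma>\<close> \<open>\<kappa> \<ge> 0\<close> by (intro mult_right_mono) auto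
  then have "(1 - \<gamma>) * \<kappa> \<le> 3 * \<theta>" using l(6) by simp
  then have small: "\<rho> * l1 (B \<gamma>) \<le> \<theta> / 100"
    using eq'[OF _ \<open>\<gamma> \<le> 1\<close>] by (intro l1_small[OF supp l(4)]) simp
  have "j \<in> H"
  proof (rule ccontr)
    assume "j \<notin> H"
    then have "\<bar>correlation n p X y (B \<gamma>) j\<bar> < 1.11 * \<theta>"
      using supp j' by (intro correlation_outside_H small) (auto simp: supported_on_def)
    moreover have "1.29 * \<theta> \<le> \<bar>correlation n p X y (B \<gamma>) leader\<bar>"
      using supp l(3) by (intro correlation_leader small) (auto simp: supported_on_def)
    ultimately show False using le'[OF leader(1)] corr_j threshold_pos by simp
  qed
  then show ?thesis
    using l j' supp eq'[OF _ \<open>\<gamma> \<le> 1\<close>] le' corr_j \<open>(1 - \<gamma>) * \<kappa> \<le> 3 * \<theta>\<close> False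
    unfolding B_def[symmetric] by (auto simp: equal_angle_state_def supported_on_def)
qed simp

text \<open>
  At step size 1 the active correlations vanish, so the leader catches up at some step size in
  \<open>[0, 1]\<close>; by compactness there is a first one at which some variable does. The residual is still
  nonzero there, because the leader is correlated with it.
\<close>

lemma equal_angle_state_not_final:
  assumes st: "equal_angle_state l b \<kappa>"
  shows "\<exists>st'. lar_step n p X y (l, b) st'"
proof -
  have l: "leader \<notin> set l" "set l \<subseteq> H" "supported_on (set l) b" "\<kappa> \<le> 3 * \<theta>"
    and eq: "\<And>i. i \<in> set l \<Longrightarrow> \<bar>correlation n p X y b i\<bar> = \<kappa>"
    and le: "\<And>i. i < p \<Longrightarrow> \<bar>correlation n p X y b i\<bar> \<le> \<kappa>"
    using st by (auto simp: equal_angle_state_def)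
  have lp: "set l \<subseteq> {..<p}" using l(2) H_subset by auto
  obtain d where d: "lar_direction n p X y (set l) b d"
    unfolding lar_direction_def
    using normal_equations_solvable[OF _ lp] normal_equations_imp_arg_min by blast
  define B where "B t = (\<lambda>i. b i + t * d i)" for t
  have along: "correlation n p X y (B t) i = (1 - t) * correlation n p X y b i" if "i \<in> set l" for i t
    unfolding B_def using lp that by (intro lar_correlation_along[OF d]) auto
  define C where "C = {t \<in> {0..1}. \<exists>i\<in>{..<p} - set l. lar_catches_up n p X y (set l) (B t) i}"
  have "C = (\<Union>i\<in>{..<p} - set l. {0..1} \<inter> (\<Inter>a\<in>set l.
      {t. \<bar>correlation n p X y (B t) a\<bar> \<le> \<bar>correlation n p X y (B t) i\<bar>}))"
    by (auto simp: C_def lar_catches_up_def)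
  also have "closed \<dots>"
    unfolding B_def by (intro closed_UN closed_Int closed_INT ballI closed_Collect_le continuous_correlation_along) auto
  finally have "closed C" .
  moreover have "C \<subseteq> {0..1}" by (auto simp: C_def)
  ultimately have "compact C" using compact_Int_closed[of "{0..1}" C] by (simp add: Int_absorb1)
  moreover have "1 \<in> C"
    using leader(1) l(1) along by (auto simp: C_def lar_catches_up_def intro!: bexI[of _ leader])
  ultimately obtain \<gamma> where \<gamma>: "\<gamma> \<in> C" "\<And>t. t \<in> C \<Longrightarrow> \<gamma> \<le> t"
    using compact_attains_inf[of C] by blast
  then obtain j where j: "lar_catches_up n p X y (set l) (B \<gamma>) j" and "0 \<le> \<gamma>" "\<gamma> \<le> 1"
    by (auto simp: C_def)
  have before: "\<not> lar_catches_up n p X y (set l) (B t) i" if "0 \<le> t" "t < \<gamma>" for t i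
    using \<gamma>(2)[of t] that \<open>\<gamma> \<le> 1\<close> by (auto simp: C_def lar_catches_up_def)
  have supp: "supported_on (set l) (B \<gamma>)"
    using l(3) d by (auto simp: supported_on_def B_def lar_direction_def is_arg_min_linorder)
  have "\<kappa> \<ge> 0" using le[OF leader(1)] by (rule order_trans[OF abs_ge_zero])
  then have "(1 - \<gamma>) * \<kappa> \<le> 1 * \<kappa>" using \<open>0 \<le> \<gamma>\<close> by (intro mult_right_mono) auto
  then have "\<rho> * l1 (B \<gamma>) \<le> \<theta> / 100"
    using along eq l(4) \<open>\<gamma> \<le> 1\<close> by (intro l1_small[OF supp l(2)]) (simp add: abs_mult)
  then have "1.29 * \<theta> \<le> \<bar>correlation n p X y (B \<gamma>) leader\<bar>"
    using supp l(1) by (intro correlation_leader) (auto simp: supported_on_def)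
  then have "correlation n p X y (B \<gamma>) leader \<noteq> 0" using threshold_pos by auto
  then have "\<exists>i<n. residual p X y (B \<gamma>) i \<noteq> 0"
    unfolding correlation_def using sum.neutral by force
  then have "lar_step n p X y (l, b) (l @ [j], B \<gamma>)"
    unfolding lar_step_def Let_def using d \<open>0 \<le> \<gamma>\<close> before j
    by (intro exI[of _ d] exI[of _ \<gamma>] exI[of _ j]) (auto simp: B_def)
  then show ?thesis by blast
qed

lemma lar_selects_from_H:
  assumes "least_angle_regression n p X y sel"
  shows "selected_from_up_to H leader sel" "distinct sel"
proof -
  obtain st b where start: "lar_start n p X y st" and steps: "(lar_step n p X y)\<^sup>*\<^sup>* st (sel, b)"
    and final: "\<nexists>st'. lar_step n p X y (sel, b) st'"
    using assms by (auto simp: least_angle_regression_def)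
  define Inv where "Inv s \<longleftrightarrow> distinct (fst s) \<and>
    (selected_from_up_to H leader (fst s) \<or> (\<exists>\<kappa>. equal_angle_state (fst s) (snd s) \<kappa>))" for s
  have Inv_start: "Inv st"
  proof -
    define c where "c i = correlation n p X y (\<lambda>_. 0) i" for i
    have c: "c i = inner_with n X y i" for i by (simp add: c_def correlation_eq)
    obtain j where j: "j < p" "fst st = [j]" "\<And>i. i < p \<Longrightarrow> \<bar>c i\<bar> \<le> \<bar>c j\<bar>" and b0: "snd st = (\<lambda>_. 0)"
      using start leader(1) by (auto simp: lar_start_def c_def split: if_splits)
    have "1.3 * \<theta> \<le> \<bar>c j\<bar>" using j(3)[OF leader(1)] leader(2) by (simp add: c)
    then have "j \<in> H" using j(1) threshold_pos by (auto simp: H_def large_inner_def c)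
    show ?thesis
    proof (cases "j = leader")
      case True
      then show ?thesis using j(2) by (simp add: Inv_def selected_from_up_to_def)
    next
      case False
      then have "equal_angle_state [j] (\<lambda>_. 0) \<bar>c j\<bar>"
        using j \<open>j \<in> H\<close> inner_le[OF j(1)]
        by (auto simp: equal_angle_state_def supported_on_def c_def[symmetric] c)
      then show ?thesis using j(2) b0 by (auto simp: Inv_def)
    qed
  qed
  have Inv_step: "Inv s'" if "Inv s" and step: "lar_step n p X y s s'" for s s'
  proof -
    obtain d \<gamma> j where d: "lar_direction n p X y (set (fst s)) (snd s) d" and "0 \<le> \<gamma>"
      and before: "\<And>t i. 0 \<le> t \<Longrightarrow> t < \<gamma> \<Longrightarrow> \<not> lar_catches_up n p X y (set (fst s)) (\<lambda>i. snd s i + t * d i) i"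
      and j: "lar_catches_up n p X y (set (fst s)) (\<lambda>i. snd s i + \<gamma> * d i) j"
      and s': "s' = (fst s @ [j], \<lambda>i. snd s i + \<gamma> * d i)"
      using step unfolding lar_step_def Let_def by blast
    have dist: "distinct (fst s')" using \<open>Inv s\<close> j by (auto simp: Inv_def s' lar_catches_up_def)
    consider "selected_from_up_to H leader (fst s)" | \<kappa> where "equal_angle_state (fst s) (snd s) \<kappa>"
      using \<open>Inv s\<close> by (auto simp: Inv_def)
    then show ?thesis
    proof cases
      case 1
      then show ?thesis using dist selected_from_up_to_append by (auto simp: Inv_def s')
    next
      case 2
      have "j = leader \<or> equal_angle_state (fst s @ [j]) (\<lambda>i. snd s i + \<gamma> * d i) ((1 - \<gamma>) * \<kappa>)"
        by (rule equal_angle_state_extend[OF 2 d \<open>0 \<le> \<gamma>\<close> before j])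
      moreover have "selected_from_up_to H leader (fst s @ [leader])"
        using 2 by (intro selected_from_up_to_snoc) (auto simp: equal_angle_state_def)
      ultimately show ?thesis using dist by (auto simp: Inv_def s')
    qed
  qed
  from steps Inv_start have "Inv (sel, b)"
    by (induction rule: rtranclp_induct) (auto intro: Inv_step)
  then show "selected_from_up_to H leader sel" "distinct sel"
    using final equal_angle_state_not_final[of sel b] unfolding Inv_def by (metis fst_conv snd_conv)+
qed

subsection \<open>The rank of the first noise variable\<close>

theorem first_noise_rank_le:
  assumes "\<beta> leader = 0"
    and "forward_stepwise n p X y sel \<or> lasso n p X y sel \<or> least_angle_regression n p X y sel"
  shows "first_noise_rank \<beta> sel \<le> card (large_inner n p X y \<theta>)"
proof -
  have "selected_from_up_to H leader sel" "distinct sel"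
    using assms(2) forward_stepwise_selects_from_H lasso_selects_from_H lar_selects_from_H
    by (auto simp: forward_stepwise_def lasso_def)
  then show ?thesis
    using first_noise_rank_le_card[OF _ _ finite_H leader_in_H, of sel \<beta>] assms(1) by (simp add: H_def)
qed

end

section \<open>Gaussian variables\<close>

lemma normally_distributed_zero_AE:
  assumes "normally_distributed M Z 0 0"
  shows "AE \<omega> in M. Z \<omega> = 0"
proof -
  have [measurable]: "Z \<in> borel_measurable M" and d: "distr M borel Z = return borel 0"
    using assms by (auto simp: normally_distributed_def)
  have "AE x in distr M borel Z. x = 0" unfolding d by (subst AE_return) auto
  then show ?thesis by (subst (asm) AE_distr_iff) auto
qed

lemma normally_distributed_iff_distributed:
  assumes "s > 0"
  shows "normally_distributed M Z 0 s \<longleftrightarrow> distributed M lborel Z (\<lambda>x. ennreal (normal_density 0 s x))"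
  using assms by (auto simp: normally_distributed_def distributed_def cong: distr_cong)

lemma normally_distributed_cong_AE:
  assumes "normally_distributed M Z \<mu> s" "AE \<omega> in M. Z \<omega> = Z' \<omega>" "Z' \<in> borel_measurable M"
  shows "normally_distributed M Z' \<mu> s"
proof -
  have "Z \<in> borel_measurable M" using assms by (auto simp: normally_distributed_def)
  then have "distr M borel Z = distr M borel Z'"
    using assms by (intro distr_cong_AE) auto
  then show ?thesis using assms by (auto simp: normally_distributed_def)
qed

lemma normally_distributed_zero:
  assumes "prob_space M"
  shows "normally_distributed M (\<lambda>_. 0) 0 0"
proof -
  interpret prob_space M by fact
  show ?thesis
    by (auto simp: normally_distributed_def emeasure_distr emeasure_space_1 indicator_def intro!: measure_eqI)
qed

lemma normally_distributed_scale:
  assumes Z: "normally_distributed M Z 0 s" and "s \<ge> 0" "prob_space M"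
  shows "normally_distributed M (\<lambda>\<omega>. c * Z \<omega>) 0 (\<bar>c\<bar> * s)"
proof -
  interpret prob_space M by fact
  have [measurable]: "Z \<in> borel_measurable M" using Z by (auto simp: normally_distributed_def)
  note zero = normally_distributed_zero[OF \<open>prob_space M\<close>]
  consider "c = 0 \<or> s = 0" | "c \<noteq> 0" "s > 0" using \<open>s \<ge> 0\<close> by fastforce
  then show ?thesis
  proof cases
    case 1
    then have "AE \<omega> in M. c * Z \<omega> = 0"
      using normally_distributed_zero_AE[of M Z] Z by (cases "c = 0") auto
    then have "AE \<omega> in M. 0 = c * Z \<omega>" by (auto elim: eventually_mono)
    from normally_distributed_cong_AE[OF zero this] show ?thesis using 1 by auto
  next
    case 2
    then have "distributed M lborel (\<lambda>\<omega>. 0 + c * Z \<omega>) (\<lambda>x. ennreal (normal_density (0 + c * 0) (\<bar>c\<bar> * s) x))"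
      using Z by (intro normal_density_affine) (auto simp: normally_distributed_iff_distributed)
    then show ?thesis using 2 by (simp add: normally_distributed_iff_distributed)
  qed
qed

text \<open>
  Terms with standard deviation 0 vanish almost surely; the others are covered by the closure of
  nondegenerate normal laws under independent sums.
\<close>

lemma normally_distributed_sum:
  assumes "prob_space M" "finite I" and indep: "prob_space.indep_vars M (\<lambda>_. borel) Z I"
    and Z: "\<And>i. i \<in> I \<Longrightarrow> normally_distributed M (Z i) 0 (s i)" "\<And>i. i \<in> I \<Longrightarrow> s i \<ge> 0"
  shows "normally_distributed M (\<lambda>\<omega>. \<Sum>i\<in>I. Z i \<omega>) 0 (sqrt (\<Sum>i\<in>I. (s i)\<^sup>2))"
proof -
  interpret prob_space M by fact
  have [measurable]: "Z i \<in> borel_measurable M" if "i \<in> I" for i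
    using Z(1)[OF that] by (auto simp: normally_distributed_def)
  note zero = normally_distributed_zero[OF \<open>prob_space M\<close>]
  define J where "J = {i \<in> I. s i \<noteq> 0}"
  have J: "J \<subseteq> I" "finite J" "\<And>i. i \<in> J \<Longrightarrow> s i > 0"
    using Z(2) \<open>finite I\<close> by (auto simp: J_def order_less_le)
  have "AE \<omega> in M. \<forall>i\<in>I - J. Z i \<omega> = 0"
    using Z(1) \<open>finite I\<close> by (subst AE_finite_all) (force simp: J_def intro!: normally_distributed_zero_AE)+
  then have AE: "AE \<omega> in M. (\<Sum>i\<in>J. Z i \<omega>) = (\<Sum>i\<in>I. Z i \<omega>)"
    by eventually_elim (auto intro!: sum.mono_neutral_left J \<open>finite I\<close>)
  have s_eq: "(\<Sum>i\<in>I. (s i)\<^sup>2) = (\<Sum>i\<in>J. (s i)\<^sup>2)"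
    by (intro sum.mono_neutral_right) (auto simp: J_def \<open>finite I\<close>)
  have "normally_distributed M (\<lambda>\<omega>. \<Sum>i\<in>J. Z i \<omega>) 0 (sqrt (\<Sum>i\<in>J. (s i)\<^sup>2))"
  proof (cases "J = {}")
    case True
    then show ?thesis using zero by simp
  next
    case False
    have "(\<Sum>i\<in>J. (s i)\<^sup>2) > 0" using False J by (intro sum_pos) force+
    moreover have "distributed M lborel (\<lambda>\<omega>. \<Sum>i\<in>J. Z i \<omega>)
        (\<lambda>x. ennreal (normal_density (\<Sum>i\<in>J. 0) (sqrt (\<Sum>i\<in>J. (s i)\<^sup>2)) x))"
      using False J Z(1) by (intro sum_indep_normal indep_vars_subset[OF indep])
        (auto simp flip: normally_distributed_iff_distributed)
    ultimately show ?thesis by (simp add: normally_distributed_iff_distributed)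
  qed
  from normally_distributed_cong_AE[OF this AE] show ?thesis unfolding s_eq by simp
qed

lemma nn_integral_normally_distributed:
  assumes Z: "normally_distributed M Z 0 s" and [measurable]: "g \<in> borel_measurable borel"
  shows "(\<integral>\<^sup>+\<omega>. g (Z \<omega>) \<partial>M) =
    (if s = 0 then g 0 else \<integral>\<^sup>+x. ennreal (normal_density 0 s x) * g x \<partial>lborel)"
proof -
  have [measurable]: "Z \<in> borel_measurable M" using Z by (auto simp: normally_distributed_def)
  have "(\<integral>\<^sup>+\<omega>. g (Z \<omega>) \<partial>M) = (\<integral>\<^sup>+x. g x \<partial>distr M borel Z)" by (simp add: nn_integral_distr)
  also have "\<dots> = (if s = 0 then g 0 else \<integral>\<^sup>+x. ennreal (normal_density 0 s x) * g x \<partial>lborel)"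
    using Z by (auto simp: normally_distributed_def nn_integral_return nn_integral_density)
  finally show ?thesis .
qed

lemma nn_integral_normal_density:
  "s > 0 \<Longrightarrow> (\<integral>\<^sup>+x. ennreal (normal_density \<mu> s x) \<partial>lborel) = 1"
  using prob_space.emeasure_space_1[OF prob_space_normal_density, of s \<mu>]
  by (simp add: emeasure_density)

text \<open>
  Multiplying the density by \<open>exp (c * x\<^sup>2)\<close> gives a multiple of the normal density with standard
  deviation \<open>s / sqrt (1 - 2 * c * s\<^sup>2)\<close>.
\<close>

lemma nn_integral_exp_square:
  assumes "normally_distributed M Z 0 s" "s \<ge> 0" "2 * c * s\<^sup>2 < 1"
  shows "(\<integral>\<^sup>+\<omega>. ennreal (exp (c * (Z \<omega>)\<^sup>2)) \<partial>M) = ennreal (1 / sqrt (1 - 2 * c * s\<^sup>2))"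
proof (cases "s = 0")
  case False
  then have "s > 0" using assms by simp
  define r where "r = sqrt (1 - 2 * c * s\<^sup>2)"
  have r: "r > 0" "r\<^sup>2 = 1 - 2 * c * s\<^sup>2" using assms by (auto simp: r_def)
  have density: "normal_density 0 s x * exp (c * x\<^sup>2) = 1 / r * normal_density 0 (s / r) x" for x
  proof -
    have "sqrt (2 * pi * (s / r)\<^sup>2) = sqrt (2 * pi * s\<^sup>2) / r"
      using r(1) by (simp add: real_sqrt_mult real_sqrt_divide power_divide)
    moreover have "- x\<^sup>2 / (2 * s\<^sup>2) + c * x\<^sup>2 = - x\<^sup>2 / (2 * (s / r)\<^sup>2)"
      using \<open>s > 0\<close> r(1) by (simp add: power_divide r(2)) (simp add: field_simps)
    ultimately show ?thesis
      using r(1) by (simp only: normal_density_def) (simp add: exp_add[symmetric])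
  qed
  have "(\<integral>\<^sup>+\<omega>. ennreal (exp (c * (Z \<omega>)\<^sup>2)) \<partial>M) =
      (\<integral>\<^sup>+x. ennreal (normal_density 0 s x) * ennreal (exp (c * x\<^sup>2)) \<partial>lborel)"
    using False by (subst nn_integral_normally_distributed[OF assms(1)]) auto
  also have "\<dots> = (\<integral>\<^sup>+x. ennreal (1 / r) * ennreal (normal_density 0 (s / r) x) \<partial>lborel)"
    using r(1) by (simp add: density ennreal_mult''[symmetric])
  also have "\<dots> = ennreal (1 / r) * 1"
    using \<open>s > 0\<close> r(1) by (subst nn_integral_cmult) (auto simp: nn_integral_normal_density)
  finally show ?thesis by (simp add: r_def)
qed (use assms in \<open>subst nn_integral_normally_distributed[OF assms(1)]; simp\<close>)

text \<open>
  Completing the square: the weight \<open>exp (t * x)\<close> shifts the mean of the normal density to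
  \<open>t * s\<^sup>2\<close>.
\<close>

lemma nn_integral_exp_linear:
  assumes "normally_distributed M Z 0 s" "s \<ge> 0"
  shows "(\<integral>\<^sup>+\<omega>. ennreal (exp (t * Z \<omega>)) \<partial>M) = ennreal (exp (t\<^sup>2 * s\<^sup>2 / 2))"
proof (cases "s = 0")
  case False
  then have "s > 0" using assms by simp
  have density: "normal_density 0 s x * exp (t * x) = exp (t\<^sup>2 * s\<^sup>2 / 2) * normal_density (t * s\<^sup>2) s x" for x
  proof -
    have "- x\<^sup>2 / (2 * s\<^sup>2) + t * x = t\<^sup>2 * s\<^sup>2 / 2 + - (x - t * s\<^sup>2)\<^sup>2 / (2 * s\<^sup>2)"
      using \<open>s > 0\<close> by (simp add: field_simps power2_eq_square)
    then show ?thesis by (simp add: normal_density_def exp_add[symmetric])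
  qed
  have "(\<integral>\<^sup>+\<omega>. ennreal (exp (t * Z \<omega>)) \<partial>M) =
      (\<integral>\<^sup>+x. ennreal (normal_density 0 s x) * ennreal (exp (t * x)) \<partial>lborel)"
    using False by (subst nn_integral_normally_distributed[OF assms(1)]) auto
  also have "\<dots> = (\<integral>\<^sup>+x. ennreal (exp (t\<^sup>2 * s\<^sup>2 / 2)) * ennreal (normal_density (t * s\<^sup>2) s x) \<partial>lborel)"
    by (simp add: density ennreal_mult''[symmetric])
  also have "\<dots> = ennreal (exp (t\<^sup>2 * s\<^sup>2 / 2)) * 1"
    using \<open>s > 0\<close> by (subst nn_integral_cmult) (auto simp: nn_integral_normal_density)
  finally show ?thesis by simp
qed (use assms in \<open>subst nn_integral_normally_distributed[OF assms(1)]; simp\<close>)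

text \<open>
  Fubini for independent variables without mentioning their distributions: the first argument may be
  integrated over an independent copy.
\<close>

lemma nn_integral_indep_var:
  assumes "prob_space M" and indep: "prob_space.indep_var M N U N' V"
    and [measurable]: "f \<in> borel_measurable (N \<Otimes>\<^sub>M N')"
  shows "(\<integral>\<^sup>+\<omega>. f (U \<omega>, V \<omega>) \<partial>M) = (\<integral>\<^sup>+\<omega>. (\<integral>\<^sup>+\<omega>'. f (U \<omega>', V \<omega>) \<partial>M) \<partial>M)"
proof -
  interpret prob_space M by fact
  have [measurable]: "U \<in> M \<rightarrow>\<^sub>M N" "V \<in> M \<rightarrow>\<^sub>M N'"
    using indep by (auto dest: indep_var_rv1 indep_var_rv2)
  interpret U: prob_space "distr M N U" by (rule prob_space_distr) simp
  interpret V: prob_space "distr M N' V" by (rule prob_space_distr) simp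
  interpret UV: pair_sigma_finite "distr M N U" "distr M N' V" ..
  have "(\<integral>\<^sup>+\<omega>. f (U \<omega>, V \<omega>) \<partial>M) = (\<integral>\<^sup>+z. f z \<partial>distr M (N \<Otimes>\<^sub>M N') (\<lambda>\<omega>. (U \<omega>, V \<omega>)))"
    by (simp add: nn_integral_distr)
  also have "distr M (N \<Otimes>\<^sub>M N') (\<lambda>\<omega>. (U \<omega>, V \<omega>)) = distr M N U \<Otimes>\<^sub>M distr M N' V"
    using indep indep_var_distribution_eq[of N U N' V] by simp
  also have "(\<integral>\<^sup>+z. f z \<partial>(distr M N U \<Otimes>\<^sub>M distr M N' V))
      = (\<integral>\<^sup>+v. (\<integral>\<^sup>+u. f (u, v) \<partial>distr M N U) \<partial>distr M N' V)"
    by (rule UV.nn_integral_snd[symmetric]) (simp cong: measurable_cong_sets)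
  also have "\<dots> = (\<integral>\<^sup>+\<omega>. (\<integral>\<^sup>+u. f (u, V \<omega>) \<partial>distr M N U) \<partial>M)"
    by (simp add: nn_integral_distr)
  also have "\<dots> = (\<integral>\<^sup>+\<omega>. (\<integral>\<^sup>+\<omega>'. f (U \<omega>', V \<omega>) \<partial>M) \<partial>M)"
  proof (rule nn_integral_cong)
    fix \<omega> assume "\<omega> \<in> space M"
    then have "V \<omega> \<in> space N'" by (rule measurable_space[rotated]) simp
    then have "(\<lambda>u. f (u, V \<omega>)) \<in> borel_measurable N" by measurable
    then show "(\<integral>\<^sup>+u. f (u, V \<omega>) \<partial>distr M N U) = (\<integral>\<^sup>+\<omega>'. f (U \<omega>', V \<omega>) \<partial>M)"
      by (intro nn_integral_distr) auto
  qed
  finally show ?thesis .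
qed

text \<open>
  Given \<open>V\<close>, the product is Gaussian, so the first integration leaves the exponential of a multiple
  of \<open>V\<^sup>2\<close>.
\<close>

lemma nn_integral_exp_product:
  assumes "prob_space M" and indep: "prob_space.indep_var M borel U borel V"
    and U: "normally_distributed M U 0 s" "s \<ge> 0" and V: "normally_distributed M V 0 r" "r \<ge> 0"
    and small: "t\<^sup>2 * s\<^sup>2 * r\<^sup>2 < 1"
  shows "(\<integral>\<^sup>+\<omega>. ennreal (exp (t * (U \<omega> * V \<omega>))) \<partial>M) = ennreal (1 / sqrt (1 - t\<^sup>2 * s\<^sup>2 * r\<^sup>2))"
proof -
  interpret prob_space M by fact
  have "(\<integral>\<^sup>+\<omega>. ennreal (exp (t * (U \<omega> * V \<omega>))) \<partial>M)
      = (\<integral>\<^sup>+\<omega>. (\<integral>\<^sup>+\<omega>'. ennreal (exp (t * (U \<omega>' * V \<omega>))) \<partial>M) \<partial>M)"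
    using nn_integral_indep_var[OF \<open>prob_space M\<close> indep, of "\<lambda>(u, v). ennreal (exp (t * (u * v)))"] by simp
  also have "\<dots> = (\<integral>\<^sup>+\<omega>. ennreal (exp (t\<^sup>2 * s\<^sup>2 / 2 * (V \<omega>)\<^sup>2)) \<partial>M)"
    using nn_integral_exp_linear[OF U, of "t * V _"] by (simp add: mult_ac power_mult_distrib)
  also have "\<dots> = ennreal (1 / sqrt (1 - 2 * (t\<^sup>2 * s\<^sup>2 / 2) * r\<^sup>2))"
    using small by (intro nn_integral_exp_square V) simp
  finally show ?thesis by simp
qed

lemma chernoff_sum:
  assumes "prob_space M" "finite I" and indep: "prob_space.indep_vars M (\<lambda>_. borel) V I"
    and mgf: "\<And>i. i \<in> I \<Longrightarrow> (\<integral>\<^sup>+\<omega>. ennreal (exp (V i \<omega>)) \<partial>M) \<le> ennreal m" and "m \<ge> 0"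
  shows "emeasure M {\<omega> \<in> space M. u \<le> (\<Sum>i\<in>I. V i \<omega>)} \<le> ennreal (m ^ card I * exp (- u))"
proof -
  interpret prob_space M by fact
  have [measurable]: "V i \<in> borel_measurable M" if "i \<in> I" for i
    using indep that by (auto simp: indep_vars_def)
  have "{\<omega> \<in> space M. u \<le> (\<Sum>i\<in>I. V i \<omega>)}
      = {\<omega> \<in> space M. 1 \<le> ennreal (exp (- u)) * (\<Prod>i\<in>I. ennreal (exp (V i \<omega>)))}"
    by (auto simp: prod_ennreal ennreal_mult''[symmetric] exp_sum[OF \<open>finite I\<close>, symmetric] exp_add[symmetric])
  also have "emeasure M \<dots> \<le> ennreal (exp (- u)) * (\<integral>\<^sup>+\<omega>. (\<Prod>i\<in>I. ennreal (exp (V i \<omega>))) * indicator (space M) \<omega> \<partial>M)"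
    using nn_integral_Markov_inequality[of "\<lambda>\<omega>. \<Prod>i\<in>I. ennreal (exp (V i \<omega>))" "space M" M "ennreal (exp (- u))"]
    by simp
  also have "\<dots> \<le> ennreal (exp (- u)) * ennreal (m ^ card I)"
  proof (rule mult_left_mono)
    have "(\<integral>\<^sup>+\<omega>. (\<Prod>i\<in>I. ennreal (exp (V i \<omega>))) * indicator (space M) \<omega> \<partial>M)
        = (\<integral>\<^sup>+\<omega>. (\<Prod>i\<in>I. ennreal (exp (V i \<omega>))) \<partial>M)"
      by (intro nn_integral_cong) simp
    also have "\<dots> = (\<Prod>i\<in>I. \<integral>\<^sup>+\<omega>. ennreal (exp (V i \<omega>)) \<partial>M)"
      using indep_vars_compose2[OF indep, of "\<lambda>_ x. ennreal (exp x)" "\<lambda>_. borel"]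
      by (intro indep_vars_nn_integral \<open>finite I\<close>) auto
    also have "\<dots> \<le> (\<Prod>i\<in>I. ennreal m)" using mgf by (rule prod_mono_ennreal)
    also have "\<dots> = ennreal (m ^ card I)" using \<open>m \<ge> 0\<close> by (simp add: ennreal_power)
    finally show "(\<integral>\<^sup>+\<omega>. (\<Prod>i\<in>I. ennreal (exp (V i \<omega>))) * indicator (space M) \<omega> \<partial>M)
      \<le> ennreal (m ^ card I)" .
  qed simp
  finally show ?thesis
    using \<open>m \<ge> 0\<close> by (simp add: ennreal_mult''[symmetric] mult.commute)
qed

text \<open>
  The mass of \<open>[t, t + s]\<close> is at least its length times the density at its right end, which gives a
  lower bound for the tail of the right exponential order.
\<close>

lemma normal_abs_less:
  assumes "prob_space M" and Z: "normally_distributed M Z 0 s" and s: "s0 > 0" "s0 \<le> s" and "t \<ge> 0"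
  shows "emeasure M {\<omega> \<in> space M. \<bar>Z \<omega>\<bar> < t} \<le> ennreal (1 - exp (- (t / s0 + 1)\<^sup>2 / 2) / sqrt (2 * pi))"
proof -
  interpret prob_space M by fact
  have [measurable]: "Z \<in> borel_measurable M" using Z by (auto simp: normally_distributed_def)
  have "s > 0" using s by simp
  define g where "g = exp (- (t / s0 + 1)\<^sup>2 / 2) / sqrt (2 * pi)"
  have "g \<le> s * normal_density 0 s (t + s)"
  proof -
    have "(t / s + 1)\<^sup>2 \<le> (t / s0 + 1)\<^sup>2"
      using s \<open>t \<ge> 0\<close> by (intro power_mono add_right_mono divide_left_mono) auto
    moreover have "s * normal_density 0 s (t + s) = exp (- (t / s + 1)\<^sup>2 / 2) / sqrt (2 * pi)"
    proof -
      have "- (t + s - 0)\<^sup>2 / (2 * s\<^sup>2) = - (t / s + 1)\<^sup>2 / 2"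
        using \<open>s > 0\<close> by (simp add: field_simps power2_eq_square)
      then show ?thesis
        using \<open>s > 0\<close> unfolding normal_density_def by (simp add: real_sqrt_mult)
    qed
    ultimately show ?thesis by (simp add: g_def divide_right_mono)
  qed
  then have "ennreal g \<le> ennreal (normal_density 0 s (t + s)) * ennreal s"
    using \<open>s > 0\<close> by (simp add: ennreal_mult''[symmetric] mult.commute)
  also have "\<dots> = (\<integral>\<^sup>+x. ennreal (normal_density 0 s (t + s)) * indicator {t..t + s} x \<partial>lborel)"
    using \<open>s > 0\<close> by (simp add: nn_integral_cmult_indicator)
  also have "\<dots> \<le> (\<integral>\<^sup>+x. ennreal (normal_density 0 s x) * indicator {t..t + s} x \<partial>lborel)"
  proof (rule nn_integral_mono)
    fix x :: real
    show "ennreal (normal_density 0 s (t + s)) * indicator {t..t + s} x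
        \<le> ennreal (normal_density 0 s x) * indicator {t..t + s} x"
    proof (cases "x \<in> {t..t + s}")
      case True
      then have "x\<^sup>2 \<le> (t + s)\<^sup>2" using \<open>t \<ge> 0\<close> by (intro power_mono) auto
      then have "normal_density 0 s (t + s) \<le> normal_density 0 s x"
        using \<open>s > 0\<close> by (simp add: normal_density_def divide_right_mono mult_left_mono)
      then show ?thesis by (intro mult_right_mono ennreal_leI) auto
    qed simp
  qed
  also have "\<dots> = (\<integral>\<^sup>+\<omega>. indicator {t..t + s} (Z \<omega>) \<partial>M)"
    using \<open>s > 0\<close> by (subst nn_integral_normally_distributed[OF Z]) auto
  also have "\<dots> = (\<integral>\<^sup>+\<omega>. indicator {\<omega> \<in> space M. t \<le> Z \<omega> \<and> Z \<omega> \<le> t + s} \<omega> \<partial>M)"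
    by (intro nn_integral_cong) (auto simp: indicator_def)
  also have "\<dots> = emeasure M {\<omega> \<in> space M. t \<le> Z \<omega> \<and> Z \<omega> \<le> t + s}" by simp
  finally have "g \<le> prob {\<omega> \<in> space M. t \<le> Z \<omega> \<and> Z \<omega> \<le> t + s}"
    by (simp add: emeasure_eq_measure g_def)
  also have "\<dots> \<le> prob {\<omega> \<in> space M. \<not> \<bar>Z \<omega>\<bar> < t}" by (intro finite_measure_mono) auto
  also have "\<dots> = 1 - prob {\<omega> \<in> space M. \<bar>Z \<omega>\<bar> < t}" by (rule prob_neg) measurable
  finally show ?thesis by (simp add: emeasure_eq_measure g_def ennreal_leI)
qed

section \<open>Gaussian designs\<close>

locale gaussian_design = prob_space \<Omega> for \<Omega> :: "'a measure" +
  fixes n p :: nat and X :: "'a \<Rightarrow> nat \<Rightarrow> nat \<Rightarrow> real" and z :: "'a \<Rightarrow> nat \<Rightarrow> real" and \<sigma> :: real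
  assumes n_pos: "n > 0"
    and X_normal: "\<And>i j. i < n \<Longrightarrow> j < p \<Longrightarrow>
      normally_distributed \<Omega> (\<lambda>\<omega>. X \<omega> i j) 0 (sqrt (1 / real n))"
    and \<sigma>_nonneg: "\<sigma> \<ge> 0"
    and z_normal: "\<And>i. i < n \<Longrightarrow> normally_distributed \<Omega> (\<lambda>\<omega>. z \<omega> i) 0 \<sigma>"
    and indep: "indep_vars (\<lambda>_. borel)
      (\<lambda>s \<omega>. case s of Inl (i, j) \<Rightarrow> X \<omega> i j | Inr i \<Rightarrow> z \<omega> i)
      (({..<n} \<times> {..<p}) <+> {..<n})"
begin

definition entry :: "nat \<times> nat + nat \<Rightarrow> 'a \<Rightarrow> real" where
  "entry s \<omega> = (case s of Inl (i, j) \<Rightarrow> X \<omega> i j | Inr i \<Rightarrow> z \<omega> i)"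

definition entry_sd :: "nat \<times> nat + nat \<Rightarrow> real" where
  "entry_sd s = (case s of Inl _ \<Rightarrow> sqrt (1 / real n) | Inr _ \<Rightarrow> \<sigma>)"

definition row :: "nat \<Rightarrow> (nat \<times> nat + nat) set" where
  "row a = insert (Inr a) ((\<lambda>j. Inl (a, j)) ` {..<p})"

lemma indep_entries: "indep_vars (\<lambda>_. borel) entry (({..<n} \<times> {..<p}) <+> {..<n})"
  using indep unfolding entry_def[abs_def] .

lemma row_subset: "a < n \<Longrightarrow> row a \<subseteq> ({..<n} \<times> {..<p}) <+> {..<n}"
  by (auto simp: row_def)

lemma finite_row: "finite (row a)" by (simp add: row_def)

lemma entry_normal: "a < n \<Longrightarrow> s \<in> row a \<Longrightarrow> normally_distributed \<Omega> (entry s) 0 (entry_sd s)"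
  using X_normal z_normal by (auto simp: row_def entry_def[abs_def] entry_sd_def)

lemma entry_sd_nonneg: "entry_sd s \<ge> 0"
  using \<sigma>_nonneg by (auto simp: entry_sd_def split: sum.split)

lemma X_measurable [measurable]: "i < n \<Longrightarrow> j < p \<Longrightarrow> (\<lambda>\<omega>. X \<omega> i j) \<in> borel_measurable \<Omega>"
  using X_normal by (auto simp: normally_distributed_def)

lemma z_measurable [measurable]: "i < n \<Longrightarrow> (\<lambda>\<omega>. z \<omega> i) \<in> borel_measurable \<Omega>"
  using z_normal by (auto simp: normally_distributed_def)

text \<open>
  Columns, the response and the response without the contribution of one column all have entries
  that are linear combinations within a row with the same coefficients in every row. One family of
  tail bounds therefore serves them all.
\<close>

definition comb :: "(nat \<Rightarrow> real) \<Rightarrow> real \<Rightarrow> 'a \<Rightarrow> nat \<Rightarrow> real" where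
  "comb \<gamma> \<delta> \<omega> a = (\<Sum>j<p. \<gamma> j * X \<omega> a j) + \<delta> * z \<omega> a"

definition comb_var :: "(nat \<Rightarrow> real) \<Rightarrow> real \<Rightarrow> real" where
  "comb_var \<gamma> \<delta> = (\<Sum>j<p. (\<gamma> j)\<^sup>2) / real n + \<delta>\<^sup>2 * \<sigma>\<^sup>2"

definition weight :: "(nat \<Rightarrow> real) \<Rightarrow> real \<Rightarrow> nat \<times> nat + nat \<Rightarrow> real" where
  "weight \<gamma> \<delta> s = (case s of Inl (i, j) \<Rightarrow> \<gamma> j | Inr i \<Rightarrow> \<delta>)"

lemma comb_measurable [measurable]: "a < n \<Longrightarrow> (\<lambda>\<omega>. comb \<gamma> \<delta> \<omega> a) \<in> borel_measurable \<Omega>"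
  unfolding comb_def by measurable

lemma sum_row: "sum f (row a) = (\<Sum>j<p. f (Inl (a, j))) + f (Inr a)"
  unfolding row_def by (subst sum.insert) (auto simp: sum.reindex inj_on_def add.commute)

lemma comb_row: "comb \<gamma> \<delta> \<omega> a = (\<Sum>s\<in>row a. weight \<gamma> \<delta> s * entry s \<omega>)"
  by (simp add: sum_row comb_def weight_def entry_def)

lemma comb_var_row: "comb_var \<gamma> \<delta> = (\<Sum>s\<in>row a. (\<bar>weight \<gamma> \<delta> s\<bar> * entry_sd s)\<^sup>2)"
  by (simp add: sum_row comb_var_def weight_def entry_sd_def power_mult_distrib power_divide
      sum_divide_distrib real_sqrt_divide)

lemma comb_normal:
  assumes "a < n"
  shows "normally_distributed \<Omega> (\<lambda>\<omega>. comb \<gamma> \<delta> \<omega> a) 0 (sqrt (comb_var \<gamma> \<delta>))"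
  unfolding comb_row comb_var_row[of \<gamma> \<delta> a]
  using indep_vars_subset[OF indep_entries row_subset[OF assms]] entry_normal[OF assms] entry_sd_nonneg
  by (intro normally_distributed_sum normally_distributed_scale finite_row indep_vars_compose2[where Y="\<lambda>s x. weight \<gamma> \<delta> s * x"] prob_space_axioms)
     auto

lemma indep_rows:
  assumes "\<And>a. a < n \<Longrightarrow> f a \<in> borel_measurable (Pi\<^sub>M (row a) (\<lambda>_. borel))"
  shows "indep_vars (\<lambda>_. borel) (\<lambda>a \<omega>. f a (restrict (\<lambda>s. entry s \<omega>) (row a))) {..<n}"
proof -
  have "indep_vars (\<lambda>a. Pi\<^sub>M (row a) (\<lambda>_. borel)) (\<lambda>a \<omega>. restrict (\<lambda>s. entry s \<omega>) (row a)) {..<n}"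
    using row_subset by (intro indep_vars_restrict[OF indep_entries]) (auto simp: disjoint_family_on_def row_def)
  then show ?thesis by (rule indep_vars_compose2) (use assms in auto)
qed

lemma indep_comb: "indep_vars (\<lambda>_. borel) (\<lambda>a \<omega>. comb \<gamma> \<delta> \<omega> a) {..<n}"
proof -
  have "indep_vars (\<lambda>_. borel) (\<lambda>a \<omega>. \<Sum>s\<in>row a. weight \<gamma> \<delta> s * restrict (\<lambda>s. entry s \<omega>) (row a) s) {..<n}"
    by (rule indep_rows) (auto intro!: borel_measurable_sum borel_measurable_times measurable_component_singleton)
  then show ?thesis by (simp add: comb_row)
qed

lemma indep_products:
  assumes "i < p"
  shows "indep_vars (\<lambda>_. borel) (\<lambda>a \<omega>. X \<omega> a i * comb \<gamma> \<delta> \<omega> a) {..<n}"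
proof -
  have in_row: "Inl (a, i) \<in> row a" for a using assms by (simp add: row_def)
  have "indep_vars (\<lambda>_. borel) (\<lambda>a \<omega>. restrict (\<lambda>s. entry s \<omega>) (row a) (Inl (a, i)) *
      (\<Sum>s\<in>row a. weight \<gamma> \<delta> s * restrict (\<lambda>s. entry s \<omega>) (row a) s)) {..<n}"
    by (rule indep_rows)
       (auto intro!: borel_measurable_sum borel_measurable_times measurable_component_singleton in_row)
  then show ?thesis using in_row by (simp add: comb_row) (simp add: entry_def)
qed

lemma indep_column_comb:
  assumes "i < p" "\<gamma> i = 0" "a < n"
  shows "indep_var borel (\<lambda>\<omega>. X \<omega> a i) borel (\<lambda>\<omega>. comb \<gamma> \<delta> \<omega> a)"
proof -
  define w where "w s = (if s = Inl (a, i) then 1 else weight \<gamma> \<delta> s)" for s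
  have in_row: "Inl (a, i) \<in> row a" using assms by (simp add: row_def)
  have "indep_vars (\<lambda>_. borel) (\<lambda>s \<omega>. w s * entry s \<omega>) (row a)"
    by (rule indep_vars_compose2[OF indep_vars_subset[OF indep_entries row_subset[OF assms(3)]]]) auto
  then have "indep_var borel (\<lambda>\<omega>. w (Inl (a, i)) * entry (Inl (a, i)) \<omega>)
      borel (\<lambda>\<omega>. \<Sum>s\<in>row a - {Inl (a, i)}. w s * entry s \<omega>)"
    by (intro indep_vars_sum) (auto simp: finite_row insert_absorb[OF in_row])
  moreover have "(\<Sum>s\<in>row a - {Inl (a, i)}. w s * entry s \<omega>) = comb \<gamma> \<delta> \<omega> a" for \<omega>
    unfolding comb_row using assms(2) in_row
    by (subst sum.remove[of "row a" "Inl (a, i)"]) (auto simp: finite_row w_def weight_def intro!: sum.cong)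
  ultimately show ?thesis by (simp add: w_def entry_def)
qed

subsection \<open>Tail bounds\<close>

lemma comb_var_nonneg: "comb_var \<gamma> \<delta> \<ge> 0"
  by (simp add: comb_var_def sum_nonneg)

text \<open>
  Chernoff's bound with exponent \<open>t = c sqrt (ln p) / r\<close>. The generating function of a product of
  Gaussians is at most \<open>(1 - x) powr (- 1 / 2)\<close> with \<open>x = c\<^sup>2 ln p / n\<close>, and its \<open>n\<close>-th power is the
  Gaussian value \<open>exp (c\<^sup>2 ln p / 2)\<close> up to the factor \<open>exp (n x\<^sup>2)\<close>, which the second smallness
  condition keeps below 2. The sign \<open>e\<close> yields both tails.
\<close>

lemma inner_comb_one_sided_tail:
  assumes i: "i < p" "\<gamma> i = 0" and r: "r > 0" "comb_var \<gamma> \<delta> \<le> r\<^sup>2" and "c \<ge> 0"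
    and small: "c\<^sup>2 * ln (real p) / real n \<le> 1 / 2" "c ^ 4 * (ln (real p))\<^sup>2 / real n \<le> ln 2" and e: "\<bar>e\<bar> = 1"
  shows "emeasure \<Omega> {\<omega> \<in> space \<Omega>. c * r * sqrt (ln (real p)) \<le> e * (\<Sum>a<n. X \<omega> a i * comb \<gamma> \<delta> \<omega> a)}
    \<le> ennreal (2 * real p powr (- (c\<^sup>2 / 2)))"
proof -
  have p: "real p \<ge> 1" "ln (real p) \<ge> 0" using i(1) by auto
  define L where "L = ln (real p)"
  have "L \<ge> 0" using p by (simp add: L_def)
  define t where "t = c * sqrt L / r"
  have t: "t \<ge> 0" using \<open>c \<ge> 0\<close> r(1) \<open>L \<ge> 0\<close> by (simp add: t_def)
  define x where "x = c\<^sup>2 * L / real n"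
  have x: "0 \<le> x" "x \<le> 1 / 2" using small(1) \<open>L \<ge> 0\<close> by (auto simp: x_def L_def)
  have e2: "e\<^sup>2 = 1" using e by (metis one_power2 power2_abs)
  define m where "m = 1 / sqrt (1 - x)"
  have x_ge: "(e * t)\<^sup>2 * (sqrt (1 / real n))\<^sup>2 * (sqrt (comb_var \<gamma> \<delta>))\<^sup>2 \<le> x"
  proof -
    have "(e * t)\<^sup>2 * (sqrt (1 / real n))\<^sup>2 * (sqrt (comb_var \<gamma> \<delta>))\<^sup>2 = t\<^sup>2 * (1 / real n) * comb_var \<gamma> \<delta>"
      using comb_var_nonneg by (simp add: power_mult_distrib e2)
    also have "\<dots> \<le> t\<^sup>2 * (1 / real n) * r\<^sup>2" using r(2) by (intro mult_left_mono) auto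
    also have "\<dots> = x" using r(1) \<open>L \<ge> 0\<close> by (simp add: t_def x_def power_mult_distrib power_divide)
    finally show ?thesis .
  qed
  have "emeasure \<Omega> {\<omega> \<in> space \<Omega>. c * r * sqrt L \<le> e * (\<Sum>a<n. X \<omega> a i * comb \<gamma> \<delta> \<omega> a)}
      \<le> emeasure \<Omega> {\<omega> \<in> space \<Omega>. c\<^sup>2 * L \<le> (\<Sum>a<n. e * t * (X \<omega> a i * comb \<gamma> \<delta> \<omega> a))}"
  proof (intro emeasure_mono)
    show "{\<omega> \<in> space \<Omega>. c * r * sqrt L \<le> e * (\<Sum>a<n. X \<omega> a i * comb \<gamma> \<delta> \<omega> a)}
      \<subseteq> {\<omega> \<in> space \<Omega>. c\<^sup>2 * L \<le> (\<Sum>a<n. e * t * (X \<omega> a i * comb \<gamma> \<delta> \<omega> a))}"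
    proof safe
      fix \<omega> assume "c * r * sqrt L \<le> e * (\<Sum>a<n. X \<omega> a i * comb \<gamma> \<delta> \<omega> a)"
      then have "t * (c * r * sqrt L) \<le> t * (e * (\<Sum>a<n. X \<omega> a i * comb \<gamma> \<delta> \<omega> a))"
        using t by (rule mult_left_mono)
      moreover have "t * (c * r * sqrt L) = c\<^sup>2 * L"
        using r(1) \<open>L \<ge> 0\<close> by (simp add: t_def power2_eq_square)
      ultimately show "c\<^sup>2 * L \<le> (\<Sum>a<n. e * t * (X \<omega> a i * comb \<gamma> \<delta> \<omega> a))"
        by (simp add: sum_distrib_left mult_ac)
    qed
  qed (use i in measurable)
  also have "\<dots> \<le> ennreal (m ^ card {..<n} * exp (- (c\<^sup>2 * L)))"
  proof (rule chernoff_sum[OF prob_space_axioms])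
    show "indep_vars (\<lambda>_. borel) (\<lambda>a \<omega>. e * t * (X \<omega> a i * comb \<gamma> \<delta> \<omega> a)) {..<n}"
      by (rule indep_vars_compose2[OF indep_products[OF i(1)], of "\<lambda>_ v. e * t * v"]) auto
    show "m \<ge> 0" using x by (simp add: m_def)
  next
    fix a assume "a \<in> {..<n}"
    then have a: "a < n" by simp
    have "(\<integral>\<^sup>+\<omega>. ennreal (exp (e * t * (X \<omega> a i * comb \<gamma> \<delta> \<omega> a))) \<partial>\<Omega>)
        = ennreal (1 / sqrt (1 - (e * t)\<^sup>2 * (sqrt (1 / real n))\<^sup>2 * (sqrt (comb_var \<gamma> \<delta>))\<^sup>2))"
      using x_ge x comb_var_nonneg
      by (intro nn_integral_exp_product[OF prob_space_axioms indep_column_comb[of i \<gamma> a \<delta>, OF i a]] X_normal comb_normal a i) auto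
    also have "\<dots> \<le> ennreal m"
      unfolding m_def using x_ge x by (intro ennreal_leI divide_left_mono) auto
    finally show "(\<integral>\<^sup>+\<omega>. ennreal (exp (e * t * (X \<omega> a i * comb \<gamma> \<delta> \<omega> a))) \<partial>\<Omega>) \<le> ennreal m" .
  qed simp
  also have "\<dots> \<le> ennreal (2 * real p powr (- (c\<^sup>2 / 2)))"
  proof (rule ennreal_leI)
    have "m \<le> exp ((x + 2 * x\<^sup>2) / 2)"
    proof -
      have "exp (- (x + 2 * x\<^sup>2)) \<le> 1 - x"
        using ln_one_minus_pos_lower_bound[OF x] x by (subst ln_ge_iff[symmetric]) auto
      then have "sqrt (exp (- (x + 2 * x\<^sup>2))) \<le> sqrt (1 - x)" by (rule real_sqrt_le_mono)
      moreover have "sqrt (exp (- (x + 2 * x\<^sup>2))) = exp (- ((x + 2 * x\<^sup>2) / 2))"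
        by (rule real_sqrt_unique) (auto simp: power2_eq_square exp_add[symmetric])
      ultimately have le: "exp (- ((x + 2 * x\<^sup>2) / 2)) \<le> sqrt (1 - x)" by (simp only:)
      have "1 / sqrt (1 - x) \<le> 1 / exp (- ((x + 2 * x\<^sup>2) / 2))"
        by (rule frac_le[OF zero_le_one order_refl exp_gt_zero le])
      moreover have "1 / exp (- h) = exp h" for h :: real by (simp add: exp_minus inverse_eq_divide)
      ultimately show ?thesis by (simp only: m_def)
    qed
    then have "m ^ n \<le> exp ((x + 2 * x\<^sup>2) / 2) ^ n" using x by (intro power_mono) (auto simp: m_def)
    also have "\<dots> = exp (real n * x / 2 + real n * x\<^sup>2)"
      by (simp add: exp_of_nat_mult[symmetric] algebra_simps)
    also have "real n * x / 2 + real n * x\<^sup>2 = c\<^sup>2 * L / 2 + c ^ 4 * L\<^sup>2 / real n"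
      using n_pos by (simp add: x_def power2_eq_square power4_eq_xxxx)
    also have "exp \<dots> \<le> exp (c\<^sup>2 * L / 2) * 2"
      using small(2) by (subst exp_add) (simp add: ln_ge_iff L_def)
    finally have "m ^ n * exp (- (c\<^sup>2 * L)) \<le> exp (c\<^sup>2 * L / 2) * 2 * exp (- (c\<^sup>2 * L))" by simp
    also have "\<dots> = 2 * exp (- (c\<^sup>2 / 2) * L)" by (simp add: exp_add[symmetric] field_simps)
    also have "\<dots> = 2 * real p powr (- (c\<^sup>2 / 2))" using p by (simp add: powr_def L_def)
    finally show "m ^ card {..<n} * exp (- (c\<^sup>2 * L)) \<le> 2 * real p powr (- (c\<^sup>2 / 2))" by simp
  qed
  finally show ?thesis unfolding L_def .
qed

lemma inner_comb_tail:
  assumes "i < p" "\<gamma> i = 0" "r > 0" "comb_var \<gamma> \<delta> \<le> r\<^sup>2" "c \<ge> 0"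
    and "c\<^sup>2 * ln (real p) / real n \<le> 1 / 2" "c ^ 4 * (ln (real p))\<^sup>2 / real n \<le> ln 2"
  shows "emeasure \<Omega> {\<omega> \<in> space \<Omega>. c * r * sqrt (ln (real p)) \<le> \<bar>\<Sum>a<n. X \<omega> a i * comb \<gamma> \<delta> \<omega> a\<bar>}
    \<le> ennreal (4 * real p powr (- (c\<^sup>2 / 2)))"
proof -
  define B where "B e = {\<omega> \<in> space \<Omega>. c * r * sqrt (ln (real p)) \<le> e * (\<Sum>a<n. X \<omega> a i * comb \<gamma> \<delta> \<omega> a)}" for e :: real
  have "emeasure \<Omega> {\<omega> \<in> space \<Omega>. c * r * sqrt (ln (real p)) \<le> \<bar>\<Sum>a<n. X \<omega> a i * comb \<gamma> \<delta> \<omega> a\<bar>}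
      \<le> emeasure \<Omega> (B 1 \<union> B (-1))"
    unfolding B_def using assms(1) by (intro emeasure_mono) (auto simp: abs_if split: if_splits)
  also have "\<dots> \<le> emeasure \<Omega> (B 1) + emeasure \<Omega> (B (-1))"
    unfolding B_def using assms(1) by (intro emeasure_subadditive) measurable
  also have "\<dots> \<le> ennreal (2 * real p powr (- (c\<^sup>2 / 2))) + ennreal (2 * real p powr (- (c\<^sup>2 / 2)))"
    unfolding B_def using assms by (intro add_mono inner_comb_one_sided_tail) auto
  finally show ?thesis by (simp add: ennreal_plus[symmetric] del: ennreal_plus)
qed

text \<open>
  Chernoff's bound for the squared norm; positive \<open>c\<close> gives the upper tail and negative \<open>c\<close> the
  lower one.
\<close>

lemma comb_norm_tail:
  assumes var: "comb_var \<gamma> \<delta> > 0" and c: "2 * c < 1" and q: "exp (- u) / sqrt (1 - 2 * c) \<le> q"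
  shows "emeasure \<Omega> {\<omega> \<in> space \<Omega>. real n * comb_var \<gamma> \<delta> * u \<le> c * (\<Sum>a<n. (comb \<gamma> \<delta> \<omega> a)\<^sup>2)} \<le> ennreal (q ^ n)"
proof -
  have "{\<omega> \<in> space \<Omega>. real n * comb_var \<gamma> \<delta> * u \<le> c * (\<Sum>a<n. (comb \<gamma> \<delta> \<omega> a)\<^sup>2)}
      = {\<omega> \<in> space \<Omega>. real n * u \<le> (\<Sum>a<n. c / comb_var \<gamma> \<delta> * (comb \<gamma> \<delta> \<omega> a)\<^sup>2)}"
  proof -
    have "(\<Sum>a<n. c / comb_var \<gamma> \<delta> * (comb \<gamma> \<delta> \<omega> a)\<^sup>2) = c * (\<Sum>a<n. (comb \<gamma> \<delta> \<omega> a)\<^sup>2) / comb_var \<gamma> \<delta>" for \<omega>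
      by (simp add: sum_distrib_left sum_divide_distrib)
    then show ?thesis
      using var by (intro Collect_cong conj_cong refl) (simp only: pos_le_divide_eq mult_ac)
  qed
  also have "emeasure \<Omega> \<dots> \<le> ennreal ((1 / sqrt (1 - 2 * c)) ^ card {..<n} * exp (- (real n * u)))"
  proof (rule chernoff_sum[OF prob_space_axioms])
    show "indep_vars (\<lambda>_. borel) (\<lambda>a \<omega>. c / comb_var \<gamma> \<delta> * (comb \<gamma> \<delta> \<omega> a)\<^sup>2) {..<n}"
      by (rule indep_vars_compose2[OF indep_comb, of "\<lambda>_ v. c / comb_var \<gamma> \<delta> * v\<^sup>2"]) auto
    fix a assume "a \<in> {..<n}"
    then show "(\<integral>\<^sup>+\<omega>. ennreal (exp (c / comb_var \<gamma> \<delta> * (comb \<gamma> \<delta> \<omega> a)\<^sup>2)) \<partial>\<Omega>) \<le> ennreal (1 / sqrt (1 - 2 * c))"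
      using nn_integral_exp_square[OF comb_normal[of a \<gamma> \<delta>], of "c / comb_var \<gamma> \<delta>"] var c by simp
  qed (use c in auto)
  also have "\<dots> \<le> ennreal (q ^ n)"
  proof (rule ennreal_leI)
    have "(1 / sqrt (1 - 2 * c)) ^ card {..<n} * exp (- (real n * u)) = (exp (- u) / sqrt (1 - 2 * c)) ^ n"
      by (simp add: power_divide exp_of_nat_mult[symmetric])
    also have "\<dots> \<le> q ^ n" using q c by (intro power_mono) auto
    finally show "(1 / sqrt (1 - 2 * c)) ^ card {..<n} * exp (- (real n * u)) \<le> q ^ n" .
  qed
  finally show ?thesis .
qed

lemma comb_norm_upper_tail:
  assumes "comb_var \<gamma> \<delta> > 0"
  shows "emeasure \<Omega> {\<omega> \<in> space \<Omega>. 1.1 * real n * comb_var \<gamma> \<delta> \<le> (\<Sum>a<n. (comb \<gamma> \<delta> \<omega> a)\<^sup>2)} \<le> ennreal (0.999 ^ n)"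
proof -
  \<comment> \<open>exponent \<open>c = 0.04\<close>, so that the level \<open>1.1\<close> contributes \<open>u = 0.04 * 1.1\<close>\<close>
  have "exp (- 0.044) / sqrt (1 - 2 * 0.04) \<le> (0.999 :: real)"
  proof -
    have "1 + 0.088 + 0.088\<^sup>2 / 2 \<le> exp (0.088 :: real)" by (rule exp_lower_Taylor_quadratic) simp
    then have "exp (- 0.088 :: real) \<le> 1 / (1 + 0.088 + 0.088\<^sup>2 / 2)"
      by (simp only: exp_minus inverse_eq_divide) (intro divide_left_mono mult_pos_pos, auto intro: add_pos_nonneg)
    also have "\<dots> \<le> 0.999\<^sup>2 * 0.92" by (simp add: power2_eq_square)
    finally have "(exp (- 0.044 :: real))\<^sup>2 \<le> (0.999 * sqrt 0.92)\<^sup>2"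
      by (simp add: power2_eq_square exp_add[symmetric])
    then have "exp (- 0.044 :: real) \<le> 0.999 * sqrt 0.92" by (rule power2_le_imp_le) simp
    then show ?thesis by (simp add: pos_divide_le_eq)
  qed
  from comb_norm_tail[OF assms _ this] show ?thesis
    by (simp add: algebra_simps)
qed

lemma comb_norm_lower_tail:
  assumes "comb_var \<gamma> \<delta> > 0"
  shows "emeasure \<Omega> {\<omega> \<in> space \<Omega>. (\<Sum>a<n. (comb \<gamma> \<delta> \<omega> a)\<^sup>2) \<le> 0.9 * real n * comb_var \<gamma> \<delta>} \<le> ennreal (0.999 ^ n)"
proof -
  \<comment> \<open>exponent \<open>c = - 0.04\<close>, so that the level \<open>0.9\<close> contributes \<open>u = - 0.04 * 0.9\<close>\<close>
  have "exp (- (- 0.036)) / sqrt (1 - 2 * (- 0.04)) \<le> (0.999 :: real)"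
  proof -
    have "exp (0.072 :: real) \<le> 1 + 0.072 + 0.072\<^sup>2" by (rule exp_bound) auto
    also have "\<dots> \<le> 0.999\<^sup>2 * 1.08" by (simp add: power2_eq_square)
    finally have "(exp (0.036 :: real))\<^sup>2 \<le> (0.999 * sqrt 1.08)\<^sup>2"
      by (simp add: power2_eq_square exp_add[symmetric])
    then have "exp (0.036 :: real) \<le> 0.999 * sqrt 1.08" by (rule power2_le_imp_le) simp
    then show ?thesis by (simp add: pos_divide_le_eq)
  qed
  from comb_norm_tail[OF assms _ this] show ?thesis
    by (simp add: algebra_simps)
qed

text \<open>
  Columns that do not enter the combination are independent of it. Given its value \<open>w\<close>, their inner
  products with \<open>w\<close> are independent Gaussians with standard deviation \<open>norm w / sqrt n\<close>, which is
  bounded below by the event \<open>v \<le> (norm w)\<^sup>2\<close>, so the probability that all of them are small is a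
  power.
\<close>

lemma noise_inner_all_small:
  assumes N: "N \<subseteq> {..<p}" "\<And>j. j \<in> N \<Longrightarrow> \<gamma> j = 0" and "v > 0" "t \<ge> 0"
  shows "emeasure \<Omega> {\<omega> \<in> space \<Omega>. (\<forall>j\<in>N. \<bar>\<Sum>a<n. X \<omega> a j * comb \<gamma> \<delta> \<omega> a\<bar> < t) \<and>
      v \<le> (\<Sum>a<n. (comb \<gamma> \<delta> \<omega> a)\<^sup>2)}
    \<le> ennreal ((1 - exp (- (t / sqrt (v / real n) + 1)\<^sup>2 / 2) / sqrt (2 * pi)) ^ card N)"
proof -
  define q where "q = 1 - exp (- (t / sqrt (v / real n) + 1)\<^sup>2 / 2) / sqrt (2 * pi)"
  have q: "q \<ge> 0"
  proof -
    have "1 \<le> sqrt (2 * pi)" using pi_gt3 by (intro real_le_rsqrt) simp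
    then have "exp (- (t / sqrt (v / real n) + 1)\<^sup>2 / 2) / sqrt (2 * pi) \<le> 1 / 1"
      by (intro frac_le) simp_all
    then show ?thesis by (simp only: q_def)
  qed
  have "finite N" using N(1) finite_subset by blast
  define I where "I = ({..<n} \<times> {..<p}) <+> {..<n}"
  define A :: "(nat \<times> nat + nat) set" where "A = Inl ` ({..<n} \<times> N)"
  define B where "B = I - A"
  define small where "small x = (indicator {x. \<bar>x\<bar> < t} x :: ennreal)" for x :: real
  have small_meas [measurable]: "small \<in> borel_measurable borel" unfolding small_def[abs_def] by measurable
  have ind_meas: "(indicator {v..} :: real \<Rightarrow> ennreal) \<in> borel_measurable borel" by measurable
  define w where "w f a = (\<Sum>j\<in>{..<p} - N. \<gamma> j * f (Inl (a, j))) + \<delta> * f (Inr a)"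
    for f :: "nat \<times> nat + nat \<Rightarrow> real" and a
  \<comment> \<open>the event as a measurable function of the columns in \<open>N\<close> and of all other entries\<close>
  define F where "F = (\<lambda>(f :: nat \<times> nat + nat \<Rightarrow> real, f'). (\<Prod>j\<in>N. small (\<Sum>a<n. f (Inl (a, j)) * w f' a)) *
    (indicator {v..} (\<Sum>a<n. (w f' a)\<^sup>2) :: ennreal))"
  have comp: "(\<lambda>x. fst x s) \<in> borel_measurable (Pi\<^sub>M A (\<lambda>_. borel) \<Otimes>\<^sub>M Pi\<^sub>M B (\<lambda>_. borel))" if "s \<in> A" for s
    by (rule measurable_compose[OF measurable_fst measurable_component_singleton[OF that, of "\<lambda>_. borel"]])
  have comp': "(\<lambda>x. snd x s) \<in> borel_measurable (Pi\<^sub>M A (\<lambda>_. borel) \<Otimes>\<^sub>M Pi\<^sub>M B (\<lambda>_. borel))" if "s \<in> B" for s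
    by (rule measurable_compose[OF measurable_snd measurable_component_singleton[OF that, of "\<lambda>_. borel"]])
  have w_meas: "(\<lambda>x. w (snd x) a) \<in> borel_measurable (Pi\<^sub>M A (\<lambda>_. borel) \<Otimes>\<^sub>M Pi\<^sub>M B (\<lambda>_. borel))" if "a < n" for a
    unfolding w_def using that
    by (intro borel_measurable_add borel_measurable_sum borel_measurable_times borel_measurable_const comp')
       (auto simp: B_def I_def A_def)
  have F_meas: "F \<in> borel_measurable (Pi\<^sub>M A (\<lambda>_. borel) \<Otimes>\<^sub>M Pi\<^sub>M B (\<lambda>_. borel))"
    unfolding F_def case_prod_beta'
    by (intro borel_measurable_times_ennreal borel_measurable_prod_ennreal
        measurable_compose[OF _ small_meas] measurable_compose[OF _ ind_meas]
        borel_measurable_sum borel_measurable_times borel_measurable_power comp w_meas)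
       (auto simp: A_def)
  have comb_w: "w (restrict (\<lambda>s. entry s \<omega>) B) a = comb \<gamma> \<delta> \<omega> a" if "a < n" for \<omega> a
  proof -
    have "(\<Sum>j\<in>{..<p} - N. \<gamma> j * X \<omega> a j) = (\<Sum>j<p. \<gamma> j * X \<omega> a j)"
      using N(2) by (intro sum.mono_neutral_left) auto
    moreover have "Inr a \<in> B" "\<And>j. j \<in> {..<p} - N \<Longrightarrow> Inl (a, j) \<in> B"
      using that by (auto simp: B_def I_def A_def)
    ultimately show ?thesis by (simp add: w_def comb_def entry_def)
  qed
  have entry_A: "restrict (\<lambda>s. entry s \<omega>) A (Inl (a, j)) = X \<omega> a j" if "a < n" "j \<in> N" for \<omega> a j
    using that by (auto simp: A_def entry_def)
  have F_eq: "F (restrict (\<lambda>s. entry s \<omega>') A, restrict (\<lambda>s. entry s \<omega>) B) =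
      (\<Prod>j\<in>N. small (\<Sum>a<n. X \<omega>' a j * comb \<gamma> \<delta> \<omega> a)) * indicator {v..} (\<Sum>a<n. (comb \<gamma> \<delta> \<omega> a)\<^sup>2)" for \<omega> \<omega>'
    unfolding F_def by (simp add: comb_w entry_A del: restrict_apply)
  have indep_AB: "indep_var (Pi\<^sub>M A (\<lambda>_. borel)) (\<lambda>\<omega>. restrict (\<lambda>s. entry s \<omega>) A)
      (Pi\<^sub>M B (\<lambda>_. borel)) (\<lambda>\<omega>. restrict (\<lambda>s. entry s \<omega>) B)"
    using N(1) by (intro indep_var_restrict[OF indep_entries]) (auto simp: A_def B_def I_def)
  have inner: "(\<integral>\<^sup>+\<omega>'. (\<Prod>j\<in>N. small (\<Sum>a<n. X \<omega>' a j * c a)) * indicator {v..} (\<Sum>a<n. (c a)\<^sup>2) \<partial>\<Omega>)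
      \<le> ennreal (q ^ card N)" for c
  proof (cases "v \<le> (\<Sum>a<n. (c a)\<^sup>2)")
    case True
    define col where "col j = (\<lambda>a. Inl (a, j) :: nat \<times> nat + nat) ` {..<n}" for j
    have "indep_vars (\<lambda>j. Pi\<^sub>M (col j) (\<lambda>_. borel)) (\<lambda>j \<omega>. restrict (\<lambda>s. entry s \<omega>) (col j)) N"
      using N(1) by (intro indep_vars_restrict[OF indep_entries]) (auto simp: disjoint_family_on_def col_def)
    then have "indep_vars (\<lambda>_. borel)
        (\<lambda>j \<omega>. small (\<Sum>a<n. restrict (\<lambda>s. entry s \<omega>) (col j) (Inl (a, j)) * c a)) N"
      by (rule indep_vars_compose2)
         (auto intro!: measurable_compose[OF _ small_meas] borel_measurable_sum borel_measurable_times
            measurable_component_singleton simp: col_def)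
    then have ind: "indep_vars (\<lambda>_. borel) (\<lambda>j \<omega>. small (\<Sum>a<n. X \<omega> a j * c a)) N"
      by (simp add: col_def entry_def)
    have "(\<integral>\<^sup>+\<omega>'. (\<Prod>j\<in>N. small (\<Sum>a<n. X \<omega>' a j * c a)) * indicator {v..} (\<Sum>a<n. (c a)\<^sup>2) \<partial>\<Omega>)
        = (\<integral>\<^sup>+\<omega>'. (\<Prod>j\<in>N. small (\<Sum>a<n. X \<omega>' a j * c a)) \<partial>\<Omega>)"
      using True by simp
    also have "\<dots> = (\<Prod>j\<in>N. \<integral>\<^sup>+\<omega>'. small (\<Sum>a<n. X \<omega>' a j * c a) \<partial>\<Omega>)"
      using ind \<open>finite N\<close> by (intro indep_vars_nn_integral) auto
    also have "\<dots> \<le> (\<Prod>j\<in>N. ennreal q)"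
    proof (rule prod_mono_ennreal)
      fix j assume "j \<in> N"
      then have "j < p" using N(1) by auto
      have "indep_vars (\<lambda>_. borel) entry (col j)"
        using \<open>j < p\<close> by (intro indep_vars_subset[OF indep_entries]) (auto simp: col_def)
      then have "indep_vars (\<lambda>_. borel) (\<lambda>s \<omega>. c (fst (projl s)) * entry s \<omega>) (col j)"
        by (rule indep_vars_compose2[where Y="\<lambda>s x. c (fst (projl s)) * x"]) auto
      then have "normally_distributed \<Omega> (\<lambda>\<omega>. \<Sum>s\<in>col j. c (fst (projl s)) * entry s \<omega>) 0
          (sqrt (\<Sum>s\<in>col j. (\<bar>c (fst (projl s))\<bar> * entry_sd s)\<^sup>2))"
        using \<open>j < p\<close>
        by (intro normally_distributed_sum normally_distributed_scale prob_space_axioms entry_sd_nonneg)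
           (auto simp: col_def row_def intro!: entry_normal entry_sd_nonneg mult_nonneg_nonneg)
      then have "normally_distributed \<Omega> (\<lambda>\<omega>. \<Sum>a<n. c a * X \<omega> a j) 0
          (sqrt (\<Sum>a<n. (\<bar>c a\<bar> * sqrt (1 / real n))\<^sup>2))"
        by (simp add: col_def sum.reindex inj_on_def entry_def entry_sd_def)
      also have "(\<Sum>a<n. (\<bar>c a\<bar> * sqrt (1 / real n))\<^sup>2) = (\<Sum>a<n. (c a)\<^sup>2) / real n"
        by (simp add: power_mult_distrib sum_divide_distrib)
      finally have Z: "normally_distributed \<Omega> (\<lambda>\<omega>. \<Sum>a<n. X \<omega> a j * c a) 0 (sqrt ((\<Sum>a<n. (c a)\<^sup>2) / real n))"
        by (simp add: mult.commute)
      have [measurable]: "(\<lambda>\<omega>. \<Sum>a<n. X \<omega> a j * c a) \<in> borel_measurable \<Omega>"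
        using Z by (auto simp: normally_distributed_def)
      have "(\<integral>\<^sup>+\<omega>'. small (\<Sum>a<n. X \<omega>' a j * c a) \<partial>\<Omega>)
          = (\<integral>\<^sup>+\<omega>'. indicator {\<omega> \<in> space \<Omega>. \<bar>\<Sum>a<n. X \<omega> a j * c a\<bar> < t} \<omega>' \<partial>\<Omega>)"
        unfolding small_def by (intro nn_integral_cong) (auto simp: indicator_def)
      also have "\<dots> = emeasure \<Omega> {\<omega> \<in> space \<Omega>. \<bar>\<Sum>a<n. X \<omega> a j * c a\<bar> < t}" by simp
      also have "\<dots> \<le> ennreal q"
        unfolding q_def using True \<open>v > 0\<close> \<open>t \<ge> 0\<close> n_pos
        by (intro normal_abs_less[OF prob_space_axioms Z]) (auto simp: divide_right_mono)
      finally show "(\<integral>\<^sup>+\<omega>'. small (\<Sum>a<n. X \<omega>' a j * c a) \<partial>\<Omega>) \<le> ennreal q" .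
    qed
    also have "\<dots> = ennreal (q ^ card N)" using q by (simp add: ennreal_power)
    finally show ?thesis .
  qed simp
  let ?E = "{\<omega> \<in> space \<Omega>. (\<forall>j\<in>N. \<bar>\<Sum>a<n. X \<omega> a j * comb \<gamma> \<delta> \<omega> a\<bar> < t) \<and> v \<le> (\<Sum>a<n. (comb \<gamma> \<delta> \<omega> a)\<^sup>2)}"
  have Xm: "(\<lambda>\<omega>. X \<omega> a j) \<in> borel_measurable \<Omega>" if "a < n" "j \<in> N" for a j
    using that N(1) X_measurable by auto
  have "(\<lambda>\<omega>. \<Sum>a<n. X \<omega> a j * comb \<gamma> \<delta> \<omega> a) \<in> borel_measurable \<Omega>" if "j \<in> N" for j
    using Xm that comb_measurable by (intro borel_measurable_sum borel_measurable_times) auto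
  then have "?E \<in> sets \<Omega>" using \<open>finite N\<close> by measurable
  then have "emeasure \<Omega> ?E = (\<integral>\<^sup>+\<omega>. indicator ?E \<omega> \<partial>\<Omega>)" by simp
  also have "\<dots> = (\<integral>\<^sup>+\<omega>. F (restrict (\<lambda>s. entry s \<omega>) A, restrict (\<lambda>s. entry s \<omega>) B) \<partial>\<Omega>)"
  proof (rule nn_integral_cong)
    fix \<omega> assume "\<omega> \<in> space \<Omega>"
    show "indicator ?E \<omega> = F (restrict (\<lambda>s. entry s \<omega>) A, restrict (\<lambda>s. entry s \<omega>) B)"
    proof (cases "\<forall>j\<in>N. \<bar>\<Sum>a<n. X \<omega> a j * comb \<gamma> \<delta> \<omega> a\<bar> < t")
      case True
      then have "(\<Prod>j\<in>N. small (\<Sum>a<n. X \<omega> a j * comb \<gamma> \<delta> \<omega> a)) = 1"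
        by (intro prod.neutral) (auto simp: small_def)
      then show ?thesis using True \<open>\<omega> \<in> space \<Omega>\<close> unfolding F_eq by (simp add: indicator_def)
    next
      case False
      then obtain j where "j \<in> N" "\<not> \<bar>\<Sum>a<n. X \<omega> a j * comb \<gamma> \<delta> \<omega> a\<bar> < t" by blast
      then have "\<exists>j\<in>N. small (\<Sum>a<n. X \<omega> a j * comb \<gamma> \<delta> \<omega> a) = 0"
        by (intro bexI[of _ j]) (simp_all add: small_def)
      then have "(\<Prod>j\<in>N. small (\<Sum>a<n. X \<omega> a j * comb \<gamma> \<delta> \<omega> a)) = 0"
        using \<open>finite N\<close> by (intro prod_zero)
      then show ?thesis using False unfolding F_eq by simp
    qed
  qed
  also have "\<dots> = (\<integral>\<^sup>+\<omega>. (\<integral>\<^sup>+\<omega>'. F (restrict (\<lambda>s. entry s \<omega>') A, restrict (\<lambda>s. entry s \<omega>) B) \<partial>\<Omega>) \<partial>\<Omega>)"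
    by (rule nn_integral_indep_var[OF prob_space_axioms indep_AB F_meas])
  also have "\<dots> \<le> (\<integral>\<^sup>+\<omega>. ennreal (q ^ card N) \<partial>\<Omega>)"
    unfolding F_eq by (intro nn_integral_mono inner)
  also have "\<dots> = ennreal (q ^ card N)" by (simp add: emeasure_space_1)
  finally show ?thesis unfolding q_def .
qed

end

section \<open>Sparse Gaussian linear models\<close>

locale sparse_gaussian_model = gaussian_design \<Omega> n p X z \<sigma>
  for \<Omega> :: "'a measure" and n p X z \<sigma> +
  fixes S :: "nat set" and M :: real and \<beta> :: "nat \<Rightarrow> real" and y :: "'a \<Rightarrow> nat \<Rightarrow> real"
  assumes support: "S \<subseteq> {..<p}" "S \<noteq> {}" and M_nonzero: "M \<noteq> 0"
    and \<beta>_eq: "\<And>j. j < p \<Longrightarrow> \<beta> j = (if j \<in> S then M else 0)"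
    and y_eq: "\<And>\<omega> i. \<omega> \<in> space \<Omega> \<Longrightarrow> i < n \<Longrightarrow> y \<omega> i = (\<Sum>j<p. X \<omega> i j * \<beta> j) + z \<omega> i"
begin

definition \<tau> :: real where "\<tau> = sqrt (comb_var \<beta> 1)"

lemma comb_var_\<beta>: "comb_var \<beta> 1 = M\<^sup>2 * real (card S) / real n + \<sigma>\<^sup>2"
proof -
  have "(\<Sum>j<p. (\<beta> j)\<^sup>2) = (\<Sum>j\<in>S. M\<^sup>2)"
    using support(1) by (intro sum.mono_neutral_cong_right) (auto simp: \<beta>_eq subset_iff split: if_splits)
  then show ?thesis by (simp add: comb_var_def mult.commute)
qed

lemma finite_S: "finite S" using support(1) finite_subset by blast

lemma \<tau>_pos: "\<tau> > 0" and \<tau>_square: "\<tau>\<^sup>2 = comb_var \<beta> 1"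
proof -
  have "comb_var \<beta> 1 > 0"
    using M_nonzero support(2) finite_S n_pos
    by (auto simp: comb_var_\<beta> card_gt_0_iff intro!: add_pos_nonneg divide_pos_pos mult_pos_pos)
  then show "\<tau> > 0" "\<tau>\<^sup>2 = comb_var \<beta> 1" by (auto simp: \<tau>_def)
qed

text \<open>
  The shift \<open>M\<close> of the signal columns is bounded by the standard deviation of the response because
  the signals themselves contribute \<open>M\<^sup>2 k / n\<close> to the variance.
\<close>

lemma M_le_\<tau>:
  assumes "c \<ge> 0" "c * real n \<le> real (card S)"
  shows "sqrt c * \<bar>M\<bar> \<le> \<tau>"
proof -
  have "c * M\<^sup>2 \<le> M\<^sup>2 * real (card S) / real n"
    using mult_left_mono[OF assms(2), of "M\<^sup>2"] n_pos by (simp add: field_simps)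
  then have "c * M\<^sup>2 \<le> comb_var \<beta> 1" unfolding comb_var_\<beta> by (simp add: add_increasing2)
  then have "sqrt (c * M\<^sup>2) \<le> \<tau>" unfolding \<tau>_def by (rule real_sqrt_le_mono)
  then show ?thesis by (simp add: real_sqrt_mult)
qed

lemma y_comb: "\<omega> \<in> space \<Omega> \<Longrightarrow> a < n \<Longrightarrow> y \<omega> a = comb \<beta> 1 \<omega> a"
  by (simp add: y_eq comb_def mult.commute)

lemma comb_unit: "j < p \<Longrightarrow> comb (\<lambda>l. if l = j then 1 else 0) 0 \<omega> a = X \<omega> a j"
  by (simp add: comb_def if_distrib[of "\<lambda>x. x * _"] cong: if_cong)

lemma comb_var_unit: "j < p \<Longrightarrow> comb_var (\<lambda>l. if l = j then 1 else 0) 0 = 1 / real n"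
  by (simp add: comb_var_def if_distrib[of "\<lambda>x. x\<^sup>2"] cong: if_cong)

lemma comb_remove: "i < p \<Longrightarrow> comb \<beta> 1 \<omega> a = \<beta> i * X \<omega> a i + comb (\<beta>(i := 0)) 1 \<omega> a"
  by (simp add: comb_def sum.remove[of "{..<p}" i])

lemma comb_var_remove: "comb_var (\<beta>(i := 0)) 1 \<le> \<tau>\<^sup>2"
  unfolding \<tau>_square comb_var_def by (intro add_right_mono divide_right_mono sum_mono) auto

text \<open>
  The exceptional events. For column \<open>i\<close> the response is split into \<open>\<beta> i\<close> times the column and the
  rest, \<open>comb (\<beta>(i := 0)) 1\<close>, which is independent of the column.
\<close>

definition bad_column :: "nat \<Rightarrow> 'a set" where
  "bad_column j = {\<omega> \<in> space \<Omega>. 1.1 \<le> (\<Sum>a<n. (X \<omega> a j)\<^sup>2)} \<union> {\<omega> \<in> space \<Omega>. (\<Sum>a<n. (X \<omega> a j)\<^sup>2) \<le> 0.9}"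

definition bad_pair :: "nat \<Rightarrow> nat \<Rightarrow> 'a set" where
  "bad_pair i j = {\<omega> \<in> space \<Omega>. 4 * sqrt (1 / real n) * sqrt (ln (real p)) \<le> \<bar>\<Sum>a<n. X \<omega> a i * X \<omega> a j\<bar>}"

definition exceeds :: "real \<Rightarrow> nat \<Rightarrow> 'a set" where
  "exceeds c i = {\<omega> \<in> space \<Omega>. c * \<tau> * sqrt (ln (real p)) \<le> \<bar>\<Sum>a<n. X \<omega> a i * comb (\<beta>(i := 0)) 1 \<omega> a\<bar>}"

definition many_exceed :: "'a set" where
  "many_exceed = {\<omega> \<in> space \<Omega>. real p powr 0.46 \<le> real (card {i. i < p \<and> \<omega> \<in> exceeds 1.05 i})}"

definition short_response :: "'a set" where
  "short_response = {\<omega> \<in> space \<Omega>. (\<Sum>a<n. (comb \<beta> 1 \<omega> a)\<^sup>2) \<le> 0.9 * real n * \<tau>\<^sup>2}"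

definition no_noise_leader :: "'a set" where
  "no_noise_leader = {\<omega> \<in> space \<Omega>.
     (\<forall>j\<in>{..<p} - S. \<bar>\<Sum>a<n. X \<omega> a j * comb \<beta> 1 \<omega> a\<bar> < 1.3 * (\<tau> * sqrt (ln (real p)))) \<and>
     0.9 * real n * \<tau>\<^sup>2 \<le> (\<Sum>a<n. (comb \<beta> 1 \<omega> a)\<^sup>2)}"

definition bad :: "'a set" where
  "bad = (\<Union>j<p. bad_column j) \<union> (\<Union>i<p. \<Union>j\<in>{..<p} - {i}. bad_pair i j) \<union> (\<Union>i<p. exceeds 2 i)
     \<union> many_exceed \<union> short_response \<union> no_noise_leader"

lemma emeasure_bad_column:
  assumes j: "j < p"
  shows "bad_column j \<in> sets \<Omega>" "emeasure \<Omega> (bad_column j) \<le> ennreal (2 * 0.999 ^ n)"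
proof -
  let ?u = "\<lambda>l. if l = j then 1 else 0 :: real"
  have var: "comb_var ?u 0 > 0" using comb_var_unit[OF j] n_pos by simp
  let ?A = "{\<omega> \<in> space \<Omega>. 1.1 \<le> (\<Sum>a<n. (X \<omega> a j)\<^sup>2)}" and ?B = "{\<omega> \<in> space \<Omega>. (\<Sum>a<n. (X \<omega> a j)\<^sup>2) \<le> 0.9}"
  have sets: "?A \<in> sets \<Omega>" "?B \<in> sets \<Omega>" using j by measurable
  show "bad_column j \<in> sets \<Omega>" unfolding bad_column_def by (rule sets.Un[OF sets])
  have "emeasure \<Omega> (bad_column j) \<le> emeasure \<Omega> ?A + emeasure \<Omega> ?B"
    unfolding bad_column_def by (rule emeasure_subadditive[OF sets])
  also have "\<dots> \<le> ennreal (0.999 ^ n) + ennreal (0.999 ^ n)"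
    using comb_norm_upper_tail[OF var] comb_norm_lower_tail[OF var] n_pos
    unfolding comb_unit[OF j] comb_var_unit[OF j] by (intro add_mono) auto
  finally show "emeasure \<Omega> (bad_column j) \<le> ennreal (2 * 0.999 ^ n)"
    by (simp add: ennreal_plus[symmetric] del: ennreal_plus)
qed

lemma emeasure_exceeds:
  assumes "i < p" "0 \<le> c" "c \<le> 4"
    and small: "16 * ln (real p) / real n \<le> 1 / 2" "256 * (ln (real p))\<^sup>2 / real n \<le> ln 2"
  shows "exceeds c i \<in> sets \<Omega>" "emeasure \<Omega> (exceeds c i) \<le> ennreal (4 * real p powr (- (c\<^sup>2 / 2)))"
proof -
  show "exceeds c i \<in> sets \<Omega>" unfolding exceeds_def using assms(1) by measurable
  have "ln (real p) \<ge> 0" using assms(1) by simp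
  have "c\<^sup>2 \<le> 4\<^sup>2" "c ^ 4 \<le> 4 ^ 4" using power_mono[of c 4 2] power_mono[of c 4 4] assms(2,3) by auto
  then have "c\<^sup>2 * ln (real p) / real n \<le> 16 * ln (real p) / real n"
    "c ^ 4 * (ln (real p))\<^sup>2 / real n \<le> 256 * (ln (real p))\<^sup>2 / real n"
    using \<open>ln (real p) \<ge> 0\<close> by (auto intro!: divide_right_mono mult_right_mono)
  then have "c\<^sup>2 * ln (real p) / real n \<le> 1 / 2" "c ^ 4 * (ln (real p))\<^sup>2 / real n \<le> ln 2"
    using small by (meson order_trans)+
  with assms(1-3) \<tau>_pos comb_var_remove show "emeasure \<Omega> (exceeds c i) \<le> ennreal (4 * real p powr (- (c\<^sup>2 / 2)))"
    unfolding exceeds_def by (intro inner_comb_tail) simp_all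
qed

lemma emeasure_bad_pair:
  assumes "i < p" "j < p" "i \<noteq> j"
    and small: "16 * ln (real p) / real n \<le> 1 / 2" "256 * (ln (real p))\<^sup>2 / real n \<le> ln 2"
  shows "bad_pair i j \<in> sets \<Omega>" "emeasure \<Omega> (bad_pair i j) \<le> ennreal (4 * real p powr (- 8))"
proof -
  show "bad_pair i j \<in> sets \<Omega>" unfolding bad_pair_def using assms by measurable
  show "emeasure \<Omega> (bad_pair i j) \<le> ennreal (4 * real p powr (- 8))"
    using inner_comb_tail[of i "\<lambda>l. if l = j then 1 else 0" "sqrt (1 / real n)" 0 4] assms n_pos
    unfolding bad_pair_def comb_unit[OF assms(2)] comb_var_unit[OF assms(2)] by simp
qed

text \<open>
  The expected number of exceedances is at most \<open>4 p powr (1 - 1.05\<^sup>2 / 2)\<close>, of order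
  \<open>p powr 0.449\<close>. Markov's inequality leaves room below \<open>p powr 0.46\<close>, and \<open>0.46 < 1 / 2\<close> is what
  the incoherence argument needs.
\<close>

lemma emeasure_many_exceed:
  assumes "p > 0" and small: "16 * ln (real p) / real n \<le> 1 / 2" "256 * (ln (real p))\<^sup>2 / real n \<le> ln 2"
  shows "many_exceed \<in> sets \<Omega>"
    "emeasure \<Omega> many_exceed \<le> ennreal (real p * (4 * real p powr (- (1.05\<^sup>2 / 2))) / real p powr 0.46)"
proof -
  define E where "E = exceeds 1.05"
  define tail where "tail = 4 * real p powr (- (1.05\<^sup>2 / 2))"
  define c where "c = real p powr 0.46"
  have "c > 0" "tail \<ge> 0" using assms(1) by (simp_all add: c_def tail_def)
  have [measurable]: "E i \<in> sets \<Omega>" if "i < p" for i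
    unfolding E_def by (rule emeasure_exceeds(1)[OF that _ _ small]) simp_all
  have E_le: "emeasure \<Omega> (E i) \<le> ennreal tail" if "i < p" for i
    unfolding E_def tail_def by (rule emeasure_exceeds(2)[OF that _ _ small]) simp_all
  let ?N = "\<lambda>\<omega>. \<Sum>i<p. indicator (E i) \<omega> :: ennreal"
  have N: "?N \<omega> = ennreal (real (card {i. i < p \<and> \<omega> \<in> E i}))" for \<omega>
  proof -
    have "?N \<omega> = (\<Sum>i\<in>{i. i < p \<and> \<omega> \<in> E i}. 1)"
      by (intro sum.mono_neutral_cong_right) (auto simp: indicator_def)
    then show ?thesis by (simp add: ennreal_of_nat_eq_real_of_nat)
  qed
  have N_meas: "?N \<in> borel_measurable \<Omega>" by measurable
  have eq: "many_exceed = {\<omega> \<in> space \<Omega>. 1 \<le> ennreal (1 / c) * ?N \<omega>}"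
    unfolding many_exceed_def c_def[symmetric] E_def[symmetric] N using \<open>c > 0\<close>
    by (auto simp: ennreal_mult''[symmetric] field_simps)
  show "many_exceed \<in> sets \<Omega>" unfolding eq using N_meas by measurable
  have "emeasure \<Omega> many_exceed \<le> ennreal (1 / c) * (\<integral>\<^sup>+\<omega>. ?N \<omega> * indicator (space \<Omega>) \<omega> \<partial>\<Omega>)"
    unfolding eq using N_meas by (intro nn_integral_Markov_inequality) auto
  also have "(\<integral>\<^sup>+\<omega>. ?N \<omega> * indicator (space \<Omega>) \<omega> \<partial>\<Omega>) = (\<integral>\<^sup>+\<omega>. ?N \<omega> \<partial>\<Omega>)"
    by (intro nn_integral_cong) simp
  also have "\<dots> = (\<Sum>i<p. emeasure \<Omega> (E i))"
    by (subst nn_integral_sum) auto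
  also have "ennreal (1 / c) * \<dots> \<le> ennreal (1 / c) * (\<Sum>i<p. ennreal tail)"
    using E_le by (intro mult_left_mono sum_mono) auto
  also have "\<dots> = ennreal (real p * tail / c)"
    using \<open>c > 0\<close> \<open>tail \<ge> 0\<close>
    by (simp add: ennreal_mult''[symmetric] ennreal_of_nat_eq_real_of_nat)
  finally show "emeasure \<Omega> many_exceed \<le> ennreal (real p * (4 * real p powr (- (1.05\<^sup>2 / 2))) / real p powr 0.46)"
    unfolding c_def tail_def .
qed

text \<open>
  On the event the response has length at least \<open>sqrt (0.9 n) \<tau>\<close>, so a single noise column fails to
  reach \<open>1.3 \<theta>\<close> only if a standard normal variable stays below \<open>1.3 / sqrt 0.9 < 1.38\<close> times
  \<open>sqrt (ln p)\<close>. As \<open>1.38\<^sup>2 / 2 < 1\<close>, the exponent grows like a positive power of \<open>p\<close>, up to smaller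
  factors.
\<close>

lemma emeasure_no_noise_leader:
  assumes "p > 0" and noise: "0.01 * real p \<le> real p - real (card S)"
  shows "no_noise_leader \<in> sets \<Omega>" "emeasure \<Omega> no_noise_leader \<le>
    ennreal (exp (- (0.01 * real p * (exp (- (1.38 * sqrt (ln (real p)) + 1)\<^sup>2 / 2) / sqrt (2 * pi)))))"
proof -
  define L where "L = sqrt (ln (real p))"
  have "L \<ge> 0" using assms(1) by (simp add: L_def)
  define N where "N = {..<p} - S"
  have N: "card N = p - card S" "N \<subseteq> {..<p}" using support(1) finite_S by (auto simp: N_def card_Diff_subset)
  have [measurable]: "j \<in> N \<Longrightarrow> a < n \<Longrightarrow> (\<lambda>\<omega>. X \<omega> a j) \<in> borel_measurable \<Omega>" for j a
    using N(2) X_measurable by auto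
  have [measurable]: "j \<in> N \<Longrightarrow> (\<lambda>\<omega>. \<Sum>a<n. X \<omega> a j * comb \<beta> 1 \<omega> a) \<in> borel_measurable \<Omega>" for j
    using comb_measurable by (intro borel_measurable_sum borel_measurable_times) auto
  have [simp]: "finite N" by (simp add: N_def)
  show "no_noise_leader \<in> sets \<Omega>" unfolding no_noise_leader_def N_def[symmetric] by measurable
  define g where "g b = exp (- (b + 1)\<^sup>2 / 2) / sqrt (2 * pi)" for b :: real
  define b where "b = 1.3 * (\<tau> * L) / sqrt (0.9 * real n * \<tau>\<^sup>2 / real n)"
  have b: "0 \<le> b" "b \<le> 1.38 * L"
  proof -
    have "b = 1.3 / sqrt 0.9 * L"
      using n_pos \<tau>_pos by (simp add: b_def real_sqrt_mult real_sqrt_divide)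
    moreover have "1.3 \<le> 1.38 * sqrt (0.9 :: real)"
    proof -
      have "1.3 / 1.38 \<le> sqrt (0.9 :: real)" by (rule real_le_rsqrt) (simp add: power2_eq_square)
      then show ?thesis by (simp add: field_simps)
    qed
    moreover from this have "1.3 / sqrt 0.9 \<le> (1.38 :: real)" by (simp add: pos_divide_le_eq)
    ultimately show "0 \<le> b" "b \<le> 1.38 * L"
      using \<open>L \<ge> 0\<close> mult_right_mono[of "1.3 / sqrt 0.9" "1.38" L] by simp_all
  qed
  have g_le: "g (1.38 * L) \<le> g b"
    unfolding g_def using b by (intro divide_right_mono) (auto intro!: power_mono)
  have g_pos: "g c \<ge> 0" for c by (simp add: g_def)
  have g_le_1: "g b \<le> 1"
  proof -
    have "1 \<le> sqrt (2 * pi)" using pi_gt3 by (intro real_le_rsqrt) simp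
    then have "exp (- (b + 1)\<^sup>2 / 2) / sqrt (2 * pi) \<le> 1 / 1" by (intro frac_le) simp_all
    then show ?thesis by (simp only: g_def)
  qed
  have "emeasure \<Omega> no_noise_leader \<le> ennreal ((1 - g b) ^ card N)"
    unfolding no_noise_leader_def g_def b_def L_def[symmetric] N_def[symmetric]
    using N(2) \<tau>_pos n_pos \<open>L \<ge> 0\<close>
    by (intro noise_inner_all_small) (auto simp: N_def \<beta>_eq)
  also have "\<dots> \<le> ennreal (exp (- (0.01 * real p * g (1.38 * L))))"
  proof (rule ennreal_leI)
    have "(1 - g b) ^ card N \<le> exp (- g b) ^ card N"
      using exp_ge_add_one_self[of "- g b"] g_le_1 by (intro power_mono) auto
    also have "\<dots> = exp (- (real (card N) * g b))" by (simp add: exp_of_nat_mult[symmetric])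
    also have "\<dots> \<le> exp (- (0.01 * real p * g (1.38 * L)))"
      using noise N(1) g_le g_pos by (simp only: exp_le_cancel_iff neg_le_iff_le) (intro mult_mono, auto)
    finally show "(1 - g b) ^ card N \<le> exp (- (0.01 * real p * g (1.38 * L)))" .
  qed
  finally show "emeasure \<Omega> no_noise_leader \<le>
      ennreal (exp (- (0.01 * real p * (exp (- (1.38 * sqrt (ln (real p)) + 1)\<^sup>2 / 2) / sqrt (2 * pi)))))"
    by (simp only: g_def L_def)
qed

lemma emeasure_short_response:
  "short_response \<in> sets \<Omega>" "emeasure \<Omega> short_response \<le> ennreal (0.999 ^ n)"
proof -
  show "short_response \<in> sets \<Omega>" unfolding short_response_def by measurable
  have "comb_var \<beta> 1 > 0" using zero_less_power[OF \<tau>_pos, of 2] unfolding \<tau>_square .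
  then show "emeasure \<Omega> short_response \<le> ennreal (0.999 ^ n)"
    unfolding short_response_def \<tau>_square by (rule comb_norm_lower_tail)
qed

lemma emeasure_union_columns:
  assumes "\<And>i. i < p \<Longrightarrow> A i \<in> sets \<Omega>" "\<And>i. i < p \<Longrightarrow> emeasure \<Omega> (A i) \<le> ennreal c" "c \<ge> 0"
  shows "(\<Union>i<p. A i) \<in> sets \<Omega>" "emeasure \<Omega> (\<Union>i<p. A i) \<le> ennreal (real p * c)"
proof -
  have "emeasure \<Omega> (\<Union>i<p. A i) \<le> (\<Sum>i<p. emeasure \<Omega> (A i))"
    using assms by (intro emeasure_subadditive_finite) auto
  also have "\<dots> \<le> (\<Sum>i<p. ennreal c)" using assms by (intro sum_mono) auto
  also have "\<dots> = ennreal (real p * c)"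
    using assms(3) by (simp add: ennreal_mult'' ennreal_of_nat_eq_real_of_nat)
  finally show "emeasure \<Omega> (\<Union>i<p. A i) \<le> ennreal (real p * c)" .
  show "(\<Union>i<p. A i) \<in> sets \<Omega>" using assms(1) by auto
qed

lemma emeasure_bad:
  assumes "p > 0" and noise: "0.01 * real p \<le> real p - real (card S)"
    and small: "16 * ln (real p) / real n \<le> 1 / 2" "256 * (ln (real p))\<^sup>2 / real n \<le> ln 2"
  shows "bad \<in> sets \<Omega>" "emeasure \<Omega> bad \<le> ennreal (
      real p * (2 * 0.999 ^ n) + real p * (real p * (4 * real p powr (- 8)))
      + real p * (4 * real p powr (- (2\<^sup>2 / 2)))
      + real p * (4 * real p powr (- (1.05\<^sup>2 / 2))) / real p powr 0.46 + 0.999 ^ n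
      + exp (- (0.01 * real p * (exp (- (1.38 * sqrt (ln (real p)) + 1)\<^sup>2 / 2) / sqrt (2 * pi)))))"
proof -
  have pair: "(\<Union>j\<in>{..<p} - {i}. bad_pair i j) \<in> sets \<Omega>"
    "emeasure \<Omega> (\<Union>j\<in>{..<p} - {i}. bad_pair i j) \<le> ennreal (real p * (4 * real p powr (- 8)))" if "i < p" for i
  proof -
    define A where "A j = (if j = i then {} else bad_pair i j)" for j
    have eq: "(\<Union>j\<in>{..<p} - {i}. bad_pair i j) = (\<Union>j<p. A j)" by (auto simp: A_def split: if_splits)
    have "A j \<in> sets \<Omega>" "emeasure \<Omega> (A j) \<le> ennreal (4 * real p powr (- 8))" if "j < p" for j
      unfolding A_def using emeasure_bad_pair[OF \<open>i < p\<close> that _ small] by auto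
    from emeasure_union_columns[OF this]
    show "(\<Union>j\<in>{..<p} - {i}. bad_pair i j) \<in> sets \<Omega>"
      "emeasure \<Omega> (\<Union>j\<in>{..<p} - {i}. bad_pair i j) \<le> ennreal (real p * (4 * real p powr (- 8)))"
      unfolding eq by auto
  qed
  note exc = emeasure_exceeds[of _ 2, OF _ _ _ small]
  have columns: "(\<Union>j<p. bad_column j) \<in> sets \<Omega>" "emeasure \<Omega> (\<Union>j<p. bad_column j) \<le> ennreal (real p * (2 * 0.999 ^ n))"
    by (rule emeasure_union_columns[OF emeasure_bad_column]; simp)+
  have pairs: "(\<Union>i<p. \<Union>j\<in>{..<p} - {i}. bad_pair i j) \<in> sets \<Omega>"
    "emeasure \<Omega> (\<Union>i<p. \<Union>j\<in>{..<p} - {i}. bad_pair i j) \<le> ennreal (real p * (real p * (4 * real p powr (- 8))))"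
    by (rule emeasure_union_columns[OF pair]; simp)+
  have exceed: "(\<Union>i<p. exceeds 2 i) \<in> sets \<Omega>"
    "emeasure \<Omega> (\<Union>i<p. exceeds 2 i) \<le> ennreal (real p * (4 * real p powr (- (2\<^sup>2 / 2))))"
    by (rule emeasure_union_columns[OF exc]; simp)+
  note rest = emeasure_many_exceed[OF assms(1) small] emeasure_short_response
    emeasure_no_noise_leader[OF assms(1) noise]
  show "bad \<in> sets \<Omega>" unfolding bad_def by (intro sets.Un columns pairs exceed rest)
  have sub: "emeasure \<Omega> (A \<union> B) \<le> ennreal (a + b)" if "A \<in> sets \<Omega>" "B \<in> sets \<Omega>"
    "emeasure \<Omega> A \<le> ennreal a" "emeasure \<Omega> B \<le> ennreal b" "a \<ge> 0" "b \<ge> 0" for A B a b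
    using order_trans[OF emeasure_subadditive[OF that(1,2)] add_mono[OF that(3,4)]] that(5,6)
    by (simp add: ennreal_plus)
  show "emeasure \<Omega> bad \<le> ennreal (
      real p * (2 * 0.999 ^ n) + real p * (real p * (4 * real p powr (- 8)))
      + real p * (4 * real p powr (- (2\<^sup>2 / 2)))
      + real p * (4 * real p powr (- (1.05\<^sup>2 / 2))) / real p powr 0.46 + 0.999 ^ n
      + exp (- (0.01 * real p * (exp (- (1.38 * sqrt (ln (real p)) + 1)\<^sup>2 / 2) / sqrt (2 * pi)))))"
    unfolding bad_def
    by (intro sub sets.Un columns pairs exceed rest add_nonneg_nonneg) simp_all
qed

text \<open>
  The two hypotheses on sizes make the shift of the signal columns smaller than the gap between
  \<open>1.05 \<theta>\<close> and \<open>1.1 \<theta>\<close>, and the set \<open>H\<close> sparse relative to the coherence.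
\<close>

lemma incoherent_outside_bad:
  assumes "\<omega> \<in> space \<Omega>" "\<omega> \<notin> bad" and "p \<ge> 2"
    and M: "1.1 * \<bar>M\<bar> \<le> 0.05 * (\<tau> * sqrt (ln (real p)))"
    and sparse: "real p powr 0.46 * (4 * sqrt (1 / real n) * sqrt (ln (real p))) \<le> 1 / 10000"
  defines "\<theta> \<equiv> \<tau> * sqrt (ln (real p))"
  shows "real (card (large_inner n p (X \<omega>) (y \<omega>) \<theta>)) \<le> real p powr 0.46"
    and "\<exists>j. \<beta> j = 0 \<and>
      incoherent_design n p (X \<omega>) (y \<omega>) \<theta> (4 * sqrt (1 / real n) * sqrt (ln (real p))) j"
proof -
  have L: "sqrt (ln (real p)) > 0" using \<open>p \<ge> 2\<close> by simp
  then have "\<theta> > 0" using \<tau>_pos by (simp add: \<theta>_def)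
  define R where "R i = (\<Sum>a<n. X \<omega> a i * comb (\<beta>(i := 0)) 1 \<omega> a)" for i
  define c where "c = inner_with n (X \<omega>) (y \<omega>)"
  have c_comb: "c i = (\<Sum>a<n. X \<omega> a i * comb \<beta> 1 \<omega> a)" for i
    using assms(1) by (simp add: c_def inner_with_def y_comb)
  have gram: "gram n (X \<omega>) i i = (\<Sum>a<n. (X \<omega> a i)\<^sup>2)" for i by (simp add: gram_def power2_eq_square)
  have column: "0.9 \<le> gram n (X \<omega>) i i" "gram n (X \<omega>) i i \<le> 1.1" if "i < p" for i
    using assms(1,2) that by (force simp: gram bad_def bad_column_def)+
  have c_R: "c i = \<beta> i * gram n (X \<omega>) i i + R i" if "i < p" for i
    using that by (simp add: c_comb comb_remove R_def gram distrib_left sum.distrib sum_distrib_left power2_eq_square mult_ac)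
  have near: "\<bar>c i - R i\<bar> \<le> 0.05 * \<theta>" if "i < p" for i
  proof -
    have "\<bar>\<beta> i\<bar> * \<bar>gram n (X \<omega>) i i\<bar> \<le> \<bar>M\<bar> * 1.1"
      using column[OF that] that by (intro mult_mono) (auto simp: \<beta>_eq)
    then show ?thesis using c_R[OF that] M by (simp add: abs_mult \<theta>_def)
  qed
  have R_less: "\<bar>R i\<bar> < 2 * \<theta>" if "i < p" for i
    using assms(1,2) that by (force simp: bad_def exceeds_def R_def \<theta>_def)
  have "large_inner n p (X \<omega>) (y \<omega>) \<theta> \<subseteq> {i. i < p \<and> \<omega> \<in> exceeds 1.05 i}"
  proof
    fix i assume "i \<in> large_inner n p (X \<omega>) (y \<omega>) \<theta>"
    then have "i < p" "1.1 * \<theta> \<le> \<bar>c i\<bar>" by (auto simp: large_inner_def c_def)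
    then have "1.05 * \<theta> \<le> \<bar>R i\<bar>" using near[of i] abs_triangle_ineq2[of "c i" "R i"] by simp
    then show "i \<in> {i. i < p \<and> \<omega> \<in> exceeds 1.05 i}"
      using \<open>i < p\<close> assms(1) by (simp add: exceeds_def R_def \<theta>_def mult.assoc)
  qed
  then have "card (large_inner n p (X \<omega>) (y \<omega>) \<theta>) \<le> card {i. i < p \<and> \<omega> \<in> exceeds 1.05 i}"
    by (intro card_mono) auto
  moreover have "real (card {i. i < p \<and> \<omega> \<in> exceeds 1.05 i}) < real p powr 0.46"
    using assms(1,2) by (force simp: bad_def many_exceed_def)
  ultimately show card: "real (card (large_inner n p (X \<omega>) (y \<omega>) \<theta>)) \<le> real p powr 0.46" by linarith
  obtain j where j: "j < p" "j \<notin> S" "1.3 * \<theta> \<le> \<bar>c j\<bar>"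
    using assms(1,2) unfolding bad_def no_noise_leader_def short_response_def c_comb \<theta>_def by force
  have "incoherent_design n p (X \<omega>) (y \<omega>) \<theta> (4 * sqrt (1 / real n) * sqrt (ln (real p))) j"
  proof
    show "\<theta> > 0" by fact
    show "0 \<le> 4 * sqrt (1 / real n) * sqrt (ln (real p))" using L by simp
    show "\<bar>gram n (X \<omega>) i j\<bar> \<le> 4 * sqrt (1 / real n) * sqrt (ln (real p))" if "i < p" "j < p" "i \<noteq> j" for i j
      using assms(1,2) that by (force simp: bad_def bad_pair_def gram_def)
    show "\<bar>inner_with n (X \<omega>) (y \<omega>) i\<bar> \<le> 3 * \<theta>" if "i < p" for i
      using near[OF that] R_less[OF that] \<open>\<theta> > 0\<close> abs_triangle_ineq2[of "c i" "R i"] by (simp add: c_def)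
    show "real (card (large_inner n p (X \<omega>) (y \<omega>) \<theta>)) * (4 * sqrt (1 / real n) * sqrt (ln (real p))) \<le> 1 / 10000"
      using mult_right_mono[OF card, of "4 * sqrt (1 / real n) * sqrt (ln (real p))"] sparse L by simp
  qed (use column j in \<open>auto simp: c_def\<close>)
  then show "\<exists>j. \<beta> j = 0 \<and>
      incoherent_design n p (X \<omega>) (y \<omega>) \<theta> (4 * sqrt (1 / real n) * sqrt (ln (real p))) j"
    using j by (intro exI[of _ j]) (auto simp: \<beta>_eq)
qed

lemma first_noise_rank_outside_bad:
  assumes "\<omega> \<in> space \<Omega>" "\<omega> \<notin> bad" "p \<ge> 2"
    and "1.1 * \<bar>M\<bar> \<le> 0.05 * (\<tau> * sqrt (ln (real p)))"
    and "real p powr 0.46 * (4 * sqrt (1 / real n) * sqrt (ln (real p))) \<le> 1 / 10000"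
    and sel: "procedure \<in> {forward_stepwise, lasso, least_angle_regression}"
      "procedure n p (X \<omega>) (y \<omega>) sel"
  shows "real (first_noise_rank \<beta> sel) \<le> real p powr 0.46"
proof -
  define \<theta> where "\<theta> = \<tau> * sqrt (ln (real p))"
  note outside = incoherent_outside_bad[OF assms(1-5), folded \<theta>_def]
  obtain j where "\<beta> j = 0"
    and "incoherent_design n p (X \<omega>) (y \<omega>) \<theta> (4 * sqrt (1 / real n) * sqrt (ln (real p))) j"
    using outside(2) by blast
  then have "first_noise_rank \<beta> sel \<le> card (large_inner n p (X \<omega>) (y \<omega>) \<theta>)"
    using sel by (intro incoherent_design.first_noise_rank_le) auto
  then show ?thesis using outside(1) by linarith
qed

end

section \<open>Asymptotics\<close>

definition min_rows :: "real \<Rightarrow> real \<Rightarrow> real \<Rightarrow> real" where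
  "min_rows c1 c2 x = c1 * x / ln x powr c2"

text \<open>
  The bound of \<open>emeasure_bad\<close> with \<open>n\<close> replaced by its lower bound, so that only \<open>p\<close> remains.
\<close>

definition bad_bound :: "real \<Rightarrow> real \<Rightarrow> real \<Rightarrow> real" where
  "bad_bound c1 c2 x = x * (2 * 0.999 powr min_rows c1 c2 x) + x * (x * (4 * x powr (- 8)))
      + x * (4 * x powr (- (2\<^sup>2 / 2)))
      + x * (4 * x powr (- (1.05\<^sup>2 / 2))) / x powr 0.46 + 0.999 powr min_rows c1 c2 x
      + exp (- (0.01 * x * (exp (- (1.38 * sqrt (ln x) + 1)\<^sup>2 / 2) / sqrt (2 * pi))))"

lemma bad_bound_tendsto_0:
  assumes "c1 > 0" "c2 > 0"
  shows "(bad_bound c1 c2 \<longlongrightarrow> 0) at_top"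
proof -
  have 1: "((\<lambda>x. x * (2 * 0.999 powr min_rows c1 c2 x)) \<longlongrightarrow> 0) at_top"
    "((\<lambda>x. 0.999 powr min_rows c1 c2 x) \<longlongrightarrow> 0) at_top"
  proof -
    define a where "a = - ln (0.999 :: real)"
    have "a > 0" by (simp add: a_def)
    have eq: "(0.999 :: real) powr u = exp (- (a * u))" for u by (simp add: powr_def a_def mult.commute)
    show "((\<lambda>x. x * (2 * 0.999 powr min_rows c1 c2 x)) \<longlongrightarrow> 0) at_top"
      "((\<lambda>x. 0.999 powr min_rows c1 c2 x) \<longlongrightarrow> 0) at_top"
      unfolding min_rows_def eq using assms \<open>a > 0\<close> by - real_asymp+
  qed
  have 2: "((\<lambda>x::real. x * (x * (4 * x powr (- 8)))) \<longlongrightarrow> 0) at_top"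
    "((\<lambda>x::real. x * (4 * x powr (- (2\<^sup>2 / 2)))) \<longlongrightarrow> 0) at_top"
    by - real_asymp+
  have 4: "((\<lambda>x::real. x * (4 * x powr (- (1.05\<^sup>2 / 2))) / x powr 0.46) \<longlongrightarrow> 0) at_top"
  proof (rule Lim_transform_eventually)
    show "((\<lambda>x::real. 4 * x powr (- 0.01125)) \<longlongrightarrow> 0) at_top" by real_asymp
    show "eventually (\<lambda>x::real. 4 * x powr (- 0.01125) = x * (4 * x powr (- (1.05\<^sup>2 / 2))) / x powr 0.46) at_top"
      using eventually_gt_at_top[of 0]
    proof eventually_elim
      case (elim x)
      \<comment> \<open>the exponent is barely negative: \<open>p powr 0.46\<close> just exceeds the expected count\<close>
      have exponent: "- 0.01125 = 1 + - (1.05\<^sup>2 / 2) - (0.46 :: real)" by (simp add: power2_eq_square)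
      show ?case unfolding exponent powr_diff powr_add using elim by simp
    qed
  qed
  have 3: "((\<lambda>x::real. exp (- (0.01 * x * (exp (- (1.38 * sqrt (ln x) + 1)\<^sup>2 / 2) / sqrt (2 * pi))))) \<longlongrightarrow> 0) at_top"
  proof -
    define K where "K = sqrt (2 * pi)"
    have "K > 0" by (simp add: K_def)
    \<comment> \<open>with \<open>u = sqrt (ln x)\<close> the inner exponent is a quadratic whose leading coefficient
      \<open>1 - 1.38\<^sup>2 / 2\<close> is positive\<close>
    have exponent: "u\<^sup>2 - (1.38 * u + 1)\<^sup>2 / 2 = 239 / 5000 * u\<^sup>2 - 69 / 50 * u - 1 / 2" for u :: real
      by (simp add: power2_eq_square field_simps)
    have "((\<lambda>u::real. exp (- (0.01 * exp (u\<^sup>2 - (1.38 * u + 1)\<^sup>2 / 2) / K))) \<longlongrightarrow> 0) at_top"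
      unfolding exponent using \<open>K > 0\<close> by real_asymp
    moreover have "filterlim (\<lambda>x::real. sqrt (ln x)) at_top at_top" by real_asymp
    ultimately have lim: "((\<lambda>x::real. exp (- (0.01 * exp ((sqrt (ln x))\<^sup>2 - (1.38 * sqrt (ln x) + 1)\<^sup>2 / 2) / K))) \<longlongrightarrow> 0) at_top"
      by (rule filterlim_compose)
    show ?thesis
    proof (rule Lim_transform_eventually[OF lim])
      show "eventually (\<lambda>x::real. exp (- (0.01 * exp ((sqrt (ln x))\<^sup>2 - (1.38 * sqrt (ln x) + 1)\<^sup>2 / 2) / K))
          = exp (- (0.01 * x * (exp (- (1.38 * sqrt (ln x) + 1)\<^sup>2 / 2) / sqrt (2 * pi))))) at_top"
        using eventually_gt_at_top[of 1]
      proof eventually_elim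
        case (elim x)
        define w where "w = (1.38 * sqrt (ln x) + 1)\<^sup>2 / 2"
        have "exp ((sqrt (ln x))\<^sup>2 - w) = x * exp (- w)"
          using elim by (simp add: exp_diff exp_minus divide_inverse)
        then show ?case by (simp add: w_def K_def)
      qed
    qed
  qed
  show ?thesis
    unfolding bad_bound_def[abs_def]
    using tendsto_add[OF tendsto_add[OF tendsto_add[OF tendsto_add[OF tendsto_add[OF 1(1) 2(1)] 2(2)] 4] 1(2)] 3] by simp
qed

lemma min_rows_limits:
  assumes "c1 > 0" "c2 > 0"
  shows "((\<lambda>x. 16 * ln x / min_rows c1 c2 x) \<longlongrightarrow> 0) at_top"
    "((\<lambda>x. 256 * (ln x)\<^sup>2 / min_rows c1 c2 x) \<longlongrightarrow> 0) at_top"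
    "((\<lambda>x. x powr 0.46 * (4 * sqrt (1 / min_rows c1 c2 x) * sqrt (ln x))) \<longlongrightarrow> 0) at_top"
    "((\<lambda>x. x powr 0.46 / min_rows c1 c2 x) \<longlongrightarrow> 0) at_top"
  unfolding min_rows_def using assms by - real_asymp+

lemma outer_measure_of_le:
  assumes "A \<subseteq> B" "B \<in> sets M"
  shows "outer_measure_of M A \<le> emeasure M B"
  using outer_measure_of_mono[OF assms(1), of M] assms(2) by simp

theorem corollary2:
  fixes \<Omega> :: "nat \<Rightarrow> 'a measure"
    and k n p :: "nat \<Rightarrow> nat"
    and X :: "nat \<Rightarrow> 'a \<Rightarrow> nat \<Rightarrow> nat \<Rightarrow> real"
    and y z :: "nat \<Rightarrow> 'a \<Rightarrow> nat \<Rightarrow> real"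
    and \<beta> :: "nat \<Rightarrow> nat \<Rightarrow> real"
    and M \<sigma> :: "nat \<Rightarrow> real"
    and c1 c2 c3 c4 c5 :: real
  assumes sizes: "filterlim k at_top sequentially" "filterlim n at_top sequentially"
      "filterlim p at_top sequentially"
    and prob: "\<And>l. prob_space (\<Omega> l)"
    and X_normal: "\<And>l i j. i < n l \<Longrightarrow> j < p l \<Longrightarrow>
      normally_distributed (\<Omega> l) (\<lambda>\<omega>. X l \<omega> i j) 0 (sqrt (1 / real (n l)))"
    and \<sigma>: "\<And>l. \<sigma> l \<ge> 0"
    and z_normal: "\<And>l i. i < n l \<Longrightarrow> normally_distributed (\<Omega> l) (\<lambda>\<omega>. z l \<omega> i) 0 (\<sigma> l)"
    and indep: "\<And>l. prob_space.indep_vars (\<Omega> l) (\<lambda>_. borel)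
      (\<lambda>s \<omega>. case s of Inl (i, j) \<Rightarrow> X l \<omega> i j | Inr i \<Rightarrow> z l \<omega> i)
      (({..<n l} \<times> {..<p l}) <+> {..<n l})"
    and M: "\<And>l. M l \<noteq> 0"
    and \<beta>: "\<And>l. \<exists>S\<subseteq>{..<p l}. card S = k l \<and> (\<forall>j<p l. \<beta> l j = (if j \<in> S then M l else 0))"
    and y: "\<And>l \<omega> i. \<omega> \<in> space (\<Omega> l) \<Longrightarrow> i < n l \<Longrightarrow>
      y l \<omega> i = (\<Sum>j<p l. X l \<omega> i j * \<beta> l j) + z l \<omega> i"
    and c: "c1 > 0" "c2 > 0" "c3 > 0" "c4 > 0" "c5 > 0"
    and n_lower: "\<And>l. c1 * real (p l) / ln (real (p l)) powr c2 \<le> real (n l)"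
    and n_upper: "\<And>l. real (n l) \<le> c3 * real (p l)"
    and k_lower: "\<And>l. c4 * real (n l) \<le> real (k l)"
    and k_upper: "\<And>l. real (k l) \<le>
      min (0.99 * real (p l)) (c5 * real (n l) * ln (real (p l)) powr 0.99)"
  shows "\<forall>procedure \<in> {forward_stepwise, lasso, least_angle_regression}.
    \<forall>sel. (\<forall>l. AE \<omega> in \<Omega> l. procedure (n l) (p l) (X l \<omega>) (y l \<omega>) (sel l \<omega>)) \<longrightarrow>
      tendsto_in_probability \<Omega>
        (\<lambda>l \<omega>. real (first_noise_rank (\<beta> l) (sel l \<omega>)) / real (k l)) 0"
proof (intro ballI allI impI)
  fix procedure sel
  assume procedure: "procedure \<in> {forward_stepwise, lasso, least_angle_regression}"
    and sel: "\<forall>l. AE \<omega> in \<Omega> l. procedure (n l) (p l) (X l \<omega>) (y l \<omega>) (sel l \<omega>)"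
  obtain S where S: "\<And>l. S l \<subseteq> {..<p l}" "\<And>l. card (S l) = k l"
    and \<beta>_S: "\<And>l j. j < p l \<Longrightarrow> \<beta> l j = (if j \<in> S l then M l else 0)"
    using \<beta> by metis
  have model: "sparse_gaussian_model (\<Omega> l) (n l) (p l) (X l) (z l) (\<sigma> l) (S l) (M l) (\<beta> l) (y l)"
    if "n l > 0" "k l > 0" for l
  proof -
    interpret prob_space "\<Omega> l" by (rule prob)
    have "S l \<noteq> {}" using S(2)[of l] that(2) by auto
    then show ?thesis
      by unfold_locales (use that X_normal \<sigma> z_normal indep S(1) M \<beta>_S y in auto)
  qed
  have p_lim: "filterlim (\<lambda>l. real (p l)) at_top sequentially"
    using filterlim_compose[OF filterlim_real_sequentially sizes(3)] .
  define r where "r l = min_rows c1 c2 (real (p l))" for l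
  note limits = min_rows_limits[OF c(1,2), THEN filterlim_compose[OF _ p_lim], folded r_def]
  show "tendsto_in_probability \<Omega> (\<lambda>l \<omega>. real (first_noise_rank (\<beta> l) (sel l \<omega>)) / real (k l)) 0"
    unfolding tendsto_in_probability_def
  proof (intro allI impI)
    fix \<epsilon> :: real assume "\<epsilon> > 0"
    let ?E = "\<lambda>l. {\<omega> \<in> space (\<Omega> l). \<bar>real (first_noise_rank (\<beta> l) (sel l \<omega>)) / real (k l) - 0\<bar> > \<epsilon>}"
    have "eventually (\<lambda>l. 16 * ln (real (p l)) / r l < 1 / 2) sequentially"
      using limits(1) by (rule order_tendstoD) simp
    moreover have "eventually (\<lambda>l. 256 * (ln (real (p l)))\<^sup>2 / r l < ln 2) sequentially"
      using limits(2) by (rule order_tendstoD) simp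
    moreover have "eventually (\<lambda>l. real (p l) powr 0.46 * (4 * sqrt (1 / r l) * sqrt (ln (real (p l)))) < 1 / 10000) sequentially"
      using limits(3) by (rule order_tendstoD) simp
    moreover have "eventually (\<lambda>l. real (p l) powr 0.46 / r l < c4 * \<epsilon>) sequentially"
      using limits(4) by (rule order_tendstoD) (use \<open>\<epsilon> > 0\<close> c in simp)
    \<comment> \<open>\<open>22 = 1.1 / 0.05\<close>, the ratio needed to absorb the shift of the signal columns\<close>
    moreover have "eventually (\<lambda>l. 22 / sqrt c4 \<le> sqrt (ln (real (p l)))) sequentially"
    proof -
      have "filterlim (\<lambda>x. sqrt (ln x)) at_top at_top" by real_asymp
      from filterlim_compose[OF this p_lim] show ?thesis by (simp add: filterlim_at_top)
    qed
    moreover have "eventually (\<lambda>l. 0 < n l) sequentially" "eventually (\<lambda>l. 0 < k l) sequentially"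
      "eventually (\<lambda>l. 2 \<le> p l) sequentially"
      using eventually_compose_filterlim[OF eventually_gt_at_top sizes(2)]
        eventually_compose_filterlim[OF eventually_gt_at_top sizes(1)]
        eventually_compose_filterlim[OF eventually_ge_at_top sizes(3)] by auto
    ultimately have upper: "eventually (\<lambda>l. outer_measure_of (\<Omega> l) (?E l) \<le> ennreal (bad_bound c1 c2 (real (p l)))) sequentially"
    proof eventually_elim
      case (elim l)
      interpret sparse_gaussian_model "\<Omega> l" "n l" "p l" "X l" "z l" "\<sigma> l" "S l" "M l" "\<beta> l" "y l"
        using model elim by blast
      have "ln (real (p l)) > 0" using elim by simp
      have "r l > 0" using c elim by (simp add: r_def min_rows_def)
      have "r l \<le> real (n l)" using n_lower[of l] by (simp add: r_def min_rows_def)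
      have small: "16 * ln (real (p l)) / real (n l) \<le> 1 / 2" "256 * (ln (real (p l)))\<^sup>2 / real (n l) \<le> ln 2"
      proof -
        have "16 * ln (real (p l)) / real (n l) \<le> 16 * ln (real (p l)) / r l"
          "256 * (ln (real (p l)))\<^sup>2 / real (n l) \<le> 256 * (ln (real (p l)))\<^sup>2 / r l"
          using \<open>ln (real (p l)) > 0\<close> \<open>r l > 0\<close> \<open>r l \<le> real (n l)\<close> by (auto intro!: divide_left_mono)
        then show "16 * ln (real (p l)) / real (n l) \<le> 1 / 2" "256 * (ln (real (p l)))\<^sup>2 / real (n l) \<le> ln 2"
          using elim(1,2) by linarith+
      qed
      have sparse: "real (p l) powr 0.46 * (4 * sqrt (1 / real (n l)) * sqrt (ln (real (p l)))) \<le> 1 / 10000"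
      proof -
        have "sqrt (1 / real (n l)) \<le> sqrt (1 / r l)"
          using \<open>r l > 0\<close> \<open>r l \<le> real (n l)\<close> by (auto intro!: divide_left_mono)
        then have "real (p l) powr 0.46 * (4 * sqrt (1 / real (n l)) * sqrt (ln (real (p l))))
            \<le> real (p l) powr 0.46 * (4 * sqrt (1 / r l) * sqrt (ln (real (p l))))"
          using \<open>ln (real (p l)) > 0\<close> by (intro mult_left_mono mult_right_mono) auto
        then show ?thesis using elim(3) by linarith
      qed
      have weak: "1.1 * \<bar>M l\<bar> \<le> 0.05 * (\<tau> * sqrt (ln (real (p l))))"
      proof -
        have "sqrt c4 * \<bar>M l\<bar> \<le> \<tau>" using k_lower[of l] c S(2)[of l] by (intro M_le_\<tau>) auto
        moreover have "22 \<le> sqrt c4 * sqrt (ln (real (p l)))"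
          using elim(5) c by (simp add: pos_divide_le_eq mult.commute)
        ultimately have "22 * (sqrt c4 * \<bar>M l\<bar>) \<le> sqrt c4 * sqrt (ln (real (p l))) * \<tau>"
          using c by (intro mult_mono) auto
        then have "sqrt c4 * (22 * \<bar>M l\<bar>) \<le> sqrt c4 * (\<tau> * sqrt (ln (real (p l))))" by (simp add: mult_ac)
        then have "22 * \<bar>M l\<bar> \<le> \<tau> * sqrt (ln (real (p l)))" using c by simp
        then show ?thesis by simp
      qed
      have noise: "0.01 * real (p l) \<le> real (p l) - real (card (S l))"
        using k_upper[of l] S(2)[of l] by simp
      obtain N where N: "N \<in> null_sets (\<Omega> l)"
        "{\<omega> \<in> space (\<Omega> l). \<not> procedure (n l) (p l) (X l \<omega>) (y l \<omega>) (sel l \<omega>)} \<subseteq> N"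
        using spec[OF sel, of l] unfolding eventually_ae_filter by blast
      have "?E l \<subseteq> bad \<union> N"
      proof (rule subsetI, rule ccontr)
        fix \<omega> assume "\<omega> \<in> ?E l" "\<omega> \<notin> bad \<union> N"
        then have \<omega>: "\<omega> \<in> space (\<Omega> l)" "\<omega> \<notin> bad" "procedure (n l) (p l) (X l \<omega>) (y l \<omega>) (sel l \<omega>)"
          and large: "\<epsilon> < real (first_noise_rank (\<beta> l) (sel l \<omega>)) / real (k l)"
          using N(2) by auto
        have "real (first_noise_rank (\<beta> l) (sel l \<omega>)) \<le> real (p l) powr 0.46"
          using elim by (intro first_noise_rank_outside_bad[OF \<omega>(1,2) _ weak sparse procedure \<omega>(3)]) auto
        also have "\<dots> \<le> \<epsilon> * (c4 * r l)" using elim(4) \<open>r l > 0\<close> by (simp add: pos_divide_less_eq mult_ac)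
        also have "c4 * r l \<le> c4 * real (n l)" using \<open>r l \<le> real (n l)\<close> c by (intro mult_left_mono) auto
        also have "\<dots> \<le> real (k l)" by (rule k_lower)
        finally have "real (first_noise_rank (\<beta> l) (sel l \<omega>)) \<le> \<epsilon> * real (k l)" using \<open>\<epsilon> > 0\<close> by simp
        then show False using large elim by (simp add: pos_less_divide_eq)
      qed
      note bad = emeasure_bad[OF _ noise small]
      have "p l > 0" using elim by simp
      have "outer_measure_of (\<Omega> l) (?E l) \<le> emeasure (\<Omega> l) (bad \<union> N)"
        using \<open>?E l \<subseteq> bad \<union> N\<close> bad(1)[OF \<open>p l > 0\<close>] N(1) by (intro outer_measure_of_le) auto
      also have "\<dots> = emeasure (\<Omega> l) bad" using bad(1)[OF \<open>p l > 0\<close>] N(1) by (rule emeasure_Un_null_set)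
      also note bad(2)[OF \<open>p l > 0\<close>]
      also have "ennreal (
            real (p l) * (2 * 0.999 ^ n l) + real (p l) * (real (p l) * (4 * real (p l) powr (- 8)))
            + real (p l) * (4 * real (p l) powr (- (2\<^sup>2 / 2)))
            + real (p l) * (4 * real (p l) powr (- (1.05\<^sup>2 / 2))) / real (p l) powr 0.46 + 0.999 ^ n l
            + exp (- (0.01 * real (p l) * (exp (- (1.38 * sqrt (ln (real (p l))) + 1)\<^sup>2 / 2) / sqrt (2 * pi)))))
          \<le> ennreal (bad_bound c1 c2 (real (p l)))"
      proof -
        have "(0.999 :: real) ^ n l \<le> 0.999 powr r l"
          using \<open>r l \<le> real (n l)\<close> by (subst powr_realpow[symmetric]) (auto intro!: powr_mono')
        then show ?thesis
          unfolding bad_bound_def r_def[symmetric]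
          by (intro ennreal_leI add_mono order_refl mult_left_mono) simp_all
      qed
      finally show ?case .
    qed
    have lim: "(\<lambda>l. ennreal (bad_bound c1 c2 (real (p l)))) \<longlonglongrightarrow> 0"
      using tendsto_ennrealI[OF filterlim_compose[OF bad_bound_tendsto_0[OF c(1,2)] p_lim]] by simp
    show "(\<lambda>l. outer_measure_of (\<Omega> l) (?E l)) \<longlonglongrightarrow> 0"
      by (rule tendsto_sandwich[OF always_eventually[OF allI[OF zero_le]] upper tendsto_const lim])
  qed
qed

end
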